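(* Let $d\ge2$, $\mathfrak{A}^{(d)}=\bigotimes_{i\in\mathbb{Z}}\mathfrak{A}_i^{(d)}$ with $\mathfrak{A}_i^{(d)}\cong M_d$, and write $\mathfrak{A}^{(d)}_{[m_1,m_2]}=\bigotimes_{k=m_1}^{m_2}\mathfrak{A}_k^{(d)}$. Let $T$ be an automorphism of $\mathfrak{A}^{(d)}$ satisfying $T(\mathfrak{A}^{(d)}_{[k_1,k_2]})\subset\mathfrak{A}^{(d)}_{[l_1,l_2]}$ for fixed integers with $l_1\le k_1$ and $k_2\le l_2$. Let $\omega$ be a state on $\mathfrak{A}^{(d)}$, $\omega'=\omega\circ T$, and denote by $\omega_{[m_1,m_2]}$, $\omega'_{[m_1,m_2]}$ their restrictions to $\mathfrak{A}^{(d)}_{[m_1,m_2]}$. Then, with $n=l_2-l_1-k_2+k_1$, $$S(\omega_{[k_1,k_2]})-2n\log_2 d\le S(\omega'_{[k_1,k_2]})\le S(\omega_{[k_1,k_2]})+2n\log_2 d.$$ Moreover these bounds are sharp, i.e. equality can be attained.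
   Context: $S$ denotes the von Neumann entropy $S(\varphi)=-\mathrm{Tr}\,\rho\log_2\rho$ of a state $\varphi$ on a finite matrix algebra with density matrix $\rho$. *)

theory Defs
  imports "Jordan_Normal_Form.Schur_Decomposition" "Jordan_Normal_Form.Char_Poly"
begin

definition mtrace :: "complex mat \<Rightarrow> complex" where
  "mtrace A = (\<Sum>i<dim_row A. A $$ (i, i))"

definition kron :: "complex mat \<Rightarrow> complex mat \<Rightarrow> complex mat" where
  "kron A B = mat (dim_row A * dim_row B) (dim_col A * dim_col B)
     (\<lambda>(i, j). A $$ (i div dim_row B, j div dim_col B) * B $$ (i mod dim_row B, j mod dim_col B))"

definition cvnorm :: "complex vec \<Rightarrow> real" where
  "cvnorm v = sqrt (\<Sum>i<dim_vec v. (cmod (v $ i))\<^sup>2)"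

definition opnorm :: "complex mat \<Rightarrow> real" where
  "opnorm A = Sup {cvnorm (A *\<^sub>v v) | v. v \<in> carrier_vec (dim_col A) \<and> cvnorm v \<le> 1}"

definition eta :: "real \<Rightarrow> real" where
  "eta x = (if x \<le> 0 then 0 else x * log 2 x)"

definition vN_entropy :: "complex mat \<Rightarrow> real" where
  "vN_entropy \<rho> = - (\<Sum>z\<in>{z. poly (char_poly \<rho>) z = 0}.
        real (order z (char_poly \<rho>)) * eta (Re z))"

definition density :: "nat \<Rightarrow> (complex mat \<Rightarrow> complex) \<Rightarrow> complex mat" where
  "density n f = (THE \<rho>. \<rho> \<in> carrier_mat n n \<and> (\<forall>X\<in>carrier_mat n n. f X = mtrace (\<rho> * X)))"

definition state_entropy :: "nat \<Rightarrow> (complex mat \<Rightarrow> complex) \<Rightarrow> real" where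
  "state_entropy n f = vN_entropy (density n f)"

text \<open>Level \<open>N\<close> is the local algebra of the sites \<open>[-N, N]\<close>, i.e. \<open>M_{d^(2N+1)}\<close>,
  site \<open>-N\<close> being the leftmost tensor factor.  The C*-algebra \<open>\<AA>\<^sup>(d)\<close> is realised as the
  completion of the local algebra: an element is a sequence \<open>a N \<in> M_{d^(2N+1)}\<close> which is
  Cauchy w.r.t. the canonical embeddings \<open>X \<mapsto> 1 \<otimes> X \<otimes> 1\<close>, two sequences being identified
  (relation \<open>qeq\<close>) when their distance tends to zero.\<close>

definition lvl_dim :: "nat \<Rightarrow> nat \<Rightarrow> nat" where
  "lvl_dim d N = d ^ (2 * N + 1)"

definition emb :: "nat \<Rightarrow> nat \<Rightarrow> nat \<Rightarrow> complex mat \<Rightarrow> complex mat" where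
  "emb d N M X = kron (kron (1\<^sub>m (d ^ (M - N))) X) (1\<^sub>m (d ^ (M - N)))"

definition qelem :: "nat \<Rightarrow> (nat \<Rightarrow> complex mat) \<Rightarrow> bool" where
  "qelem d a \<longleftrightarrow> (\<forall>N. a N \<in> carrier_mat (lvl_dim d N) (lvl_dim d N)) \<and>
     (\<forall>\<epsilon>>0. \<exists>N0. \<forall>N M. N0 \<le> N \<and> N \<le> M \<longrightarrow> opnorm (emb d N M (a N) - a M) < \<epsilon>)"

definition qeq :: "(nat \<Rightarrow> complex mat) \<Rightarrow> (nat \<Rightarrow> complex mat) \<Rightarrow> bool" where
  "qeq a b \<longleftrightarrow> (\<lambda>N. opnorm (a N - b N)) \<longlonglongrightarrow> 0"

definition qadd :: "(nat \<Rightarrow> complex mat) \<Rightarrow> (nat \<Rightarrow> complex mat) \<Rightarrow> nat \<Rightarrow> complex mat" where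
  "qadd a b = (\<lambda>N. a N + b N)"

definition qmult :: "(nat \<Rightarrow> complex mat) \<Rightarrow> (nat \<Rightarrow> complex mat) \<Rightarrow> nat \<Rightarrow> complex mat" where
  "qmult a b = (\<lambda>N. a N * b N)"

definition qscale :: "complex \<Rightarrow> (nat \<Rightarrow> complex mat) \<Rightarrow> nat \<Rightarrow> complex mat" where
  "qscale c a = (\<lambda>N. c \<cdot>\<^sub>m a N)"

definition qstar :: "(nat \<Rightarrow> complex mat) \<Rightarrow> nat \<Rightarrow> complex mat" where
  "qstar a = (\<lambda>N. mat_adjoint (a N))"

definition qone :: "nat \<Rightarrow> nat \<Rightarrow> complex mat" where
  "qone d = (\<lambda>N. 1\<^sub>m (lvl_dim d N))"

definition isize :: "int \<Rightarrow> int \<Rightarrow> nat" where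
  "isize m1 m2 = nat (m2 - m1 + 1)"

definition loc :: "nat \<Rightarrow> int \<Rightarrow> int \<Rightarrow> complex mat \<Rightarrow> nat \<Rightarrow> complex mat" where
  "loc d m1 m2 X = (\<lambda>N. if - int N \<le> m1 \<and> m2 \<le> int N
      then kron (kron (1\<^sub>m (d ^ nat (m1 + int N))) X) (1\<^sub>m (d ^ nat (int N - m2)))
      else 0\<^sub>m (lvl_dim d N) (lvl_dim d N))"

definition in_local :: "nat \<Rightarrow> int \<Rightarrow> int \<Rightarrow> (nat \<Rightarrow> complex mat) \<Rightarrow> bool" where
  "in_local d m1 m2 a \<longleftrightarrow> qelem d a \<and>
     (\<exists>X\<in>carrier_mat (d ^ isize m1 m2) (d ^ isize m1 m2). qeq a (loc d m1 m2 X))"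

definition qautomorphism :: "nat \<Rightarrow> ((nat \<Rightarrow> complex mat) \<Rightarrow> (nat \<Rightarrow> complex mat)) \<Rightarrow> bool" where
  "qautomorphism d T \<longleftrightarrow>
     (\<forall>a. qelem d a \<longrightarrow> qelem d (T a)) \<and>
     (\<forall>a b. qelem d a \<and> qelem d b \<and> qeq a b \<longrightarrow> qeq (T a) (T b)) \<and>
     (\<forall>a b. qelem d a \<and> qelem d b \<longrightarrow> qeq (T (qadd a b)) (qadd (T a) (T b))) \<and>
     (\<forall>c a. qelem d a \<longrightarrow> qeq (T (qscale c a)) (qscale c (T a))) \<and>
     (\<forall>a b. qelem d a \<and> qelem d b \<longrightarrow> qeq (T (qmult a b)) (qmult (T a) (T b))) \<and>
     (\<forall>a. qelem d a \<longrightarrow> qeq (T (qstar a)) (qstar (T a))) \<and>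
     (\<forall>a b. qelem d a \<and> qelem d b \<and> qeq (T a) (T b) \<longrightarrow> qeq a b) \<and>
     (\<forall>b. qelem d b \<longrightarrow> (\<exists>a. qelem d a \<and> qeq (T a) b))"

definition qstate :: "nat \<Rightarrow> ((nat \<Rightarrow> complex mat) \<Rightarrow> complex) \<Rightarrow> bool" where
  "qstate d \<omega> \<longleftrightarrow>
     (\<forall>a b. qelem d a \<and> qelem d b \<and> qeq a b \<longrightarrow> \<omega> a = \<omega> b) \<and>
     (\<forall>a b. qelem d a \<and> qelem d b \<longrightarrow> \<omega> (qadd a b) = \<omega> a + \<omega> b) \<and>
     (\<forall>c a. qelem d a \<longrightarrow> \<omega> (qscale c a) = c * \<omega> a) \<and>
     (\<forall>a. qelem d a \<longrightarrow> Im (\<omega> (qmult (qstar a) a)) = 0 \<and> Re (\<omega> (qmult (qstar a) a)) \<ge> 0) \<and>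
     \<omega> (qone d) = 1"

definition maps_local :: "nat \<Rightarrow> ((nat \<Rightarrow> complex mat) \<Rightarrow> (nat \<Rightarrow> complex mat))
    \<Rightarrow> int \<Rightarrow> int \<Rightarrow> int \<Rightarrow> int \<Rightarrow> bool" where
  "maps_local d T k1 k2 l1 l2 \<longleftrightarrow> (\<forall>a. in_local d k1 k2 a \<longrightarrow> in_local d l1 l2 (T a))"

definition restr_entropy :: "nat \<Rightarrow> ((nat \<Rightarrow> complex mat) \<Rightarrow> complex) \<Rightarrow> int \<Rightarrow> int \<Rightarrow> real" where
  "restr_entropy d \<omega> m1 m2 = state_entropy (d ^ isize m1 m2) (\<lambda>X. \<omega> (loc d m1 m2 X))"

end

theory Submission
  imports Defs "HOL-Analysis.L2_Norm"
begin

text \<open>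
  \<^bold>\<open>Idea.\<close>  \<open>T\<close> restricts to a unital \<open>*\<close>-homomorphism
  \<open>\<phi> : M_p \<rightarrow> M_q\<close> with \<open>p = d^(k2-k1+1)\<close>, \<open>q = p D\<close>, \<open>D = d^n\<close>, and so does the inclusion of
  the local algebras.  Both \<open>\<omega>'\<close> and \<open>\<omega>\<close> on \<open>[k1,k2]\<close> are therefore pull-backs of the same state on
  \<open>[l1,l2]\<close>, and it suffices that a pull-back along such a homomorphism changes the entropy
  by at most \<open>log D\<close>.

  For this, diagonalise both states, with eigenvalues \<open>\<kappa> l\<close> (big algebra, eigenvectors \<open>\<psi> l\<close>) and \<open>\<mu> i\<close>
  (small algebra, eigenvectors \<open>e i\<close>), and put
  \<open>P l i = \<langle>\<psi> l, \<phi>(|e i\<rangle>\<langle>e i|) \<psi> l\<rangle>\<close>.  The rows of \<open>P\<close> sum to 1, the columns to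
  \<open>D\<close>, and \<open>\<mu> i = \<Sum> \<kappa> l P l i\<close>; positivity of relative entropy gives one inequality.  The other one
  needs in addition \<open>\<Sum>i. \<kappa> l P l i / \<mu> i \<le> D\<close>, a form of the operator inequality
  \<open>\<rho> \<le> D (Tr\<^sub>B \<rho> \<otimes> 1)\<close>, which is Bessel's inequality in the GNS space of the big state.

  For sharpness let \<open>T\<close> exchange the sites \<open>-1\<close> and \<open>1\<close>, and let the sites \<open>-1, 0\<close> be maximally entangled
  and the site \<open>1\<close> maximally mixed: on \<open>[-1,0]\<close> the state is pure before and tracial after \<open>T\<close>.
\<close>

section \<open>Classical entropy inequalities\<close>

text \<open>The homomorphism \<open>\<phi>\<close> stays abstract: no decomposition of
  \<open>M_q\<close> into \<open>\<phi>(M_p)\<close> and its commutant is produced. The multiplicity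
  \<open>D\<close> enters through traces: the images of the minimal projections are linked by the
  images of the off-diagonal matrix units, so they share one trace, and \<open>p\<close> of them add
  up to the identity of \<open>M_q\<close>. Likewise the partial-trace inequality becomes an
  estimate on entries of images of matrix units. In both directions the relative entropy compares
  two families of weights on pairs \<open>(l, i)\<close>: the first is
  \<open>\<kappa> l * P l i\<close>, the second is \<open>P l i * \<mu> i / D\<close> in one case
  and \<open>(\<kappa> l)^2 * P l i / (\<mu> i * D)\<close> in the other. The latter has mass at
  most 1, which is what Bessel's inequality provides. Each of the two comparisons with the big state
  costs \<open>n * log 2 d\<close>, whence the factor 2. Elements of the infinite algebra are
  sequences up to \<open>qeq\<close>, so \<open>T\<close> respects the operations only up to null
  sequences; exact identities are recovered because a local element determines its matrix.\<close>

lemma eta_eq: "x \<ge> 0 \<Longrightarrow> eta x = x * log 2 x"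
  by (auto simp: eta_def)

text \<open>This is \<open>ln y \<le> y - 1\<close> at \<open>y = 1/x\<close>, the only logarithmic
  estimate behind the two entropy inequalities below; \<open>x\<close> will be a ratio of
  weights.\<close>

lemma log2_ge: "x > 0 \<Longrightarrow> (1 - 1 / x) / ln 2 \<le> log 2 (x::real)"
proof -
  assume x: "x > 0"
  have "ln (1/x) \<le> 1/x - 1" using x by (intro ln_le_minus_one) auto
  then have "1 - 1/x \<le> ln x" using x by (simp add: ln_div)
  then show ?thesis by (simp add: log_def divide_right_mono)
qed

text \<open>Nonnegativity of the relative entropy of the weights \<open>\<kappa> l * P l i\<close>
  with respect to \<open>P l i * \<mu> i / D\<close>. Both families have mass 1, by the row sums and
  by the column sums of \<open>P\<close>. The logarithm of their ratio is
  \<open>log 2 (\<kappa> l) + log 2 D - log 2 (\<mu> i)\<close>, and summing out \<open>i\<close> or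
  \<open>l\<close> leaves the two entropies.\<close>

lemma entropy_le_coarse:
  fixes \<kappa> \<mu> :: "nat \<Rightarrow> real" and P :: "nat \<Rightarrow> nat \<Rightarrow> real"
  assumes l0: "\<And>l. l < q \<Longrightarrow> 0 \<le> \<kappa> l" and l1: "(\<Sum>l<q. \<kappa> l) = 1"
    and P0: "\<And>l i. l < q \<Longrightarrow> i < p \<Longrightarrow> 0 \<le> P l i"
    and Pi: "\<And>l. l < q \<Longrightarrow> (\<Sum>i<p. P l i) = 1"
    and Pl: "\<And>i. i < p \<Longrightarrow> (\<Sum>l<q. P l i) = D"
    and D: "D > 0"
    and mu: "\<And>i. i < p \<Longrightarrow> \<mu> i = (\<Sum>l<q. \<kappa> l * P l i)"
  shows "- (\<Sum>l<q. eta (\<kappa> l)) \<le> - (\<Sum>i<p. eta (\<mu> i)) + log 2 D"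
proof -
  have mu0: "0 \<le> \<mu> i" if "i < p" for i
    using that l0 P0 by (auto simp: mu intro!: sum_nonneg)
  have mu1: "(\<Sum>i<p. \<mu> i) = 1"
  proof -
    have "(\<Sum>i<p. \<mu> i) = (\<Sum>l<q. \<Sum>i<p. \<kappa> l * P l i)"
      by (subst sum.swap) (simp add: mu)
    also have "\<dots> = 1" by (simp add: sum_distrib_left[symmetric] Pi l1)
    finally show ?thesis .
  qed
  have pt: "(\<kappa> l * P l i - P l i * \<mu> i / D) / ln 2
      \<le> \<kappa> l * P l i * log 2 (\<kappa> l) + \<kappa> l * P l i * log 2 D - \<kappa> l * P l i * log 2 (\<mu> i)"
    if li: "l < q" "i < p" for l i
  proof (cases "\<kappa> l * P l i = 0")
    \<comment> \<open>A pair of zero weight contributes only the nonpositive term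
      \<open>- P l i * \<mu> i / D\<close> on the left.\<close>
    case True
    then show ?thesis using P0[OF li] mu0[OF li(2)] D
      by (auto simp: divide_nonpos_pos)
  next
    case False
    then have lp: "\<kappa> l > 0" "P l i > 0" using l0[OF li(1)] P0[OF li] by (auto simp: less_le)
    have "\<kappa> l * P l i \<le> \<mu> i" unfolding mu[OF li(2)]
      using li l0 P0 by (intro member_le_sum) auto
    then have m: "\<mu> i > 0" using mult_pos_pos[OF lp] by linarith
    \<comment> \<open>The ratio of the two weights at \<open>(l, i)\<close>, with the common factor
      \<open>P l i\<close> cancelled.\<close>
    let ?x = "\<kappa> l * D / \<mu> i"
    have x: "?x > 0" using lp m D by simp
    have a: "\<kappa> l * P l i * ((1 - 1 / ?x) / ln 2) \<le> \<kappa> l * P l i * log 2 ?x"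
      using log2_ge[OF x] lp by (intro mult_left_mono) auto
    have b: "log 2 ?x = log 2 (\<kappa> l) + log 2 D - log 2 (\<mu> i)"
      using lp m D by (simp add: log_mult log_divide)
    have c: "\<kappa> l * P l i * ((1 - 1 / ?x) / ln 2) = (\<kappa> l * P l i - P l i * \<mu> i / D) / ln 2"
      using lp m D by (simp add: field_simps)
    show ?thesis using a unfolding c b by (simp add: distrib_left right_diff_distrib)
  qed
  have s1: "(\<Sum>l<q. \<Sum>i<p. \<kappa> l * P l i * log 2 (\<kappa> l)) = (\<Sum>l<q. eta (\<kappa> l))"
    using l0 Pi by (intro sum.cong) (auto simp: eta_eq sum_distrib_left[symmetric] sum_distrib_right[symmetric])
  have s2: "(\<Sum>l<q. \<Sum>i<p. \<kappa> l * P l i * log 2 D) = log 2 D"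
    using l1 Pi by (simp add: sum_distrib_left[symmetric] sum_distrib_right[symmetric])
  have s3: "(\<Sum>l<q. \<Sum>i<p. \<kappa> l * P l i * log 2 (\<mu> i)) = (\<Sum>i<p. eta (\<mu> i))"
    using mu0 by (subst sum.swap) (auto simp: eta_eq mu[symmetric] sum_distrib_right[symmetric] intro!: sum.cong)
  have s4: "(\<Sum>l<q. \<Sum>i<p. (\<kappa> l * P l i - P l i * \<mu> i / D) / ln 2) = 0"
  proof -
    have a: "(\<Sum>l<q. \<Sum>i<p. \<kappa> l * P l i) = 1" using l1 Pi by (simp add: sum_distrib_left[symmetric])
    have b: "(\<Sum>l<q. \<Sum>i<p. P l i * \<mu> i / D) = (\<Sum>i<p. \<Sum>l<q. P l i * (\<mu> i / D))"
      by (subst sum.swap) simp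
    also have "\<dots> = (\<Sum>i<p. \<mu> i)"
    proof (rule sum.cong[OF refl])
      fix i assume "i \<in> {..<p}"
      then show "(\<Sum>l<q. P l i * (\<mu> i / D)) = \<mu> i"
        using D Pl[of i] by (simp only: sum_distrib_right[symmetric]) simp
    qed
    finally have "(\<Sum>l<q. \<Sum>i<p. P l i * \<mu> i / D) = 1" using mu1 by simp
    then show ?thesis using a
      by (simp add: sum_divide_distrib[symmetric] sum_subtractf)
  qed
  have "0 \<le> (\<Sum>l<q. \<Sum>i<p. \<kappa> l * P l i * log 2 (\<kappa> l) + \<kappa> l * P l i * log 2 D - \<kappa> l * P l i * log 2 (\<mu> i))"
    unfolding s4[symmetric] using pt by (intro sum_mono) auto
  then show ?thesis
    by (simp add: sum.distrib sum_subtractf s1 s2 s3)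
qed

text \<open>Here the reference weights are \<open>\<kappa> l * R l i / D\<close> with
  \<open>R l i = \<kappa> l * P l i / \<mu> i\<close>. Relative entropy against weights of mass at
  most 1 is still nonnegative, and \<open>bessel\<close> bounds that mass: row \<open>l\<close> has
  mass at most \<open>\<kappa> l\<close>.\<close>

lemma entropy_coarse_le:
  fixes \<kappa> \<mu> :: "nat \<Rightarrow> real" and P :: "nat \<Rightarrow> nat \<Rightarrow> real"
  assumes l0: "\<And>l. l < q \<Longrightarrow> 0 \<le> \<kappa> l" and l1: "(\<Sum>l<q. \<kappa> l) = 1"
    and P0: "\<And>l i. l < q \<Longrightarrow> i < p \<Longrightarrow> 0 \<le> P l i"
    and Pi: "\<And>l. l < q \<Longrightarrow> (\<Sum>i<p. P l i) = 1"
    and D: "D > 0"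
    and mu: "\<And>i. i < p \<Longrightarrow> \<mu> i = (\<Sum>l<q. \<kappa> l * P l i)"
    and bessel: "\<And>l. l < q \<Longrightarrow> \<kappa> l > 0 \<Longrightarrow> (\<Sum>i<p. if \<mu> i > 0 then \<kappa> l * P l i / \<mu> i else 0) \<le> D"
  shows "- (\<Sum>i<p. eta (\<mu> i)) \<le> - (\<Sum>l<q. eta (\<kappa> l)) + log 2 D"
proof -
  have mu0: "0 \<le> \<mu> i" if "i < p" for i
    using that l0 P0 by (auto simp: mu intro!: sum_nonneg)
  define R where "R l i = (if \<mu> i > 0 then \<kappa> l * P l i / \<mu> i else 0)" for l i
  have pt: "(\<kappa> l * P l i - \<kappa> l * R l i / D) / ln 2
      \<le> \<kappa> l * P l i * log 2 (\<mu> i) + \<kappa> l * P l i * log 2 D - \<kappa> l * P l i * log 2 (\<kappa> l)"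
    if li: "l < q" "i < p" for l i
  proof (cases "\<kappa> l * P l i = 0")
    case True
    then show ?thesis by (auto simp: R_def)
  next
    case False
    then have lp: "\<kappa> l > 0" "P l i > 0" using l0[OF li(1)] P0[OF li] by (auto simp: less_le)
    have "\<kappa> l * P l i \<le> \<mu> i" unfolding mu[OF li(2)]
      using li l0 P0 by (intro member_le_sum) auto
    then have m: "\<mu> i > 0" using mult_pos_pos[OF lp] by linarith
    let ?x = "\<mu> i * D / \<kappa> l"
    have x: "?x > 0" using lp m D by simp
    have a: "\<kappa> l * P l i * ((1 - 1 / ?x) / ln 2) \<le> \<kappa> l * P l i * log 2 ?x"
      using log2_ge[OF x] lp by (intro mult_left_mono) auto
    have b: "log 2 ?x = log 2 (\<mu> i) + log 2 D - log 2 (\<kappa> l)"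
      using lp m D by (simp add: log_mult log_divide)
    have c: "\<kappa> l * P l i * ((1 - 1 / ?x) / ln 2) = (\<kappa> l * P l i - \<kappa> l * R l i / D) / ln 2"
      using lp m D by (simp add: field_simps R_def)
    show ?thesis using a unfolding c b by (simp add: distrib_left right_diff_distrib)
  qed
  have s1: "(\<Sum>l<q. \<Sum>i<p. \<kappa> l * P l i * log 2 (\<kappa> l)) = (\<Sum>l<q. eta (\<kappa> l))"
    using l0 Pi by (intro sum.cong) (auto simp: eta_eq sum_distrib_left[symmetric] sum_distrib_right[symmetric])
  have s2: "(\<Sum>l<q. \<Sum>i<p. \<kappa> l * P l i * log 2 D) = log 2 D"
    using l1 Pi by (simp add: sum_distrib_left[symmetric] sum_distrib_right[symmetric])
  have s3: "(\<Sum>l<q. \<Sum>i<p. \<kappa> l * P l i * log 2 (\<mu> i)) = (\<Sum>i<p. eta (\<mu> i))"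
    using mu0 by (subst sum.swap) (auto simp: eta_eq mu[symmetric] sum_distrib_right[symmetric] intro!: sum.cong)
  have s4: "0 \<le> (\<Sum>l<q. \<Sum>i<p. (\<kappa> l * P l i - \<kappa> l * R l i / D) / ln 2)"
  proof (rule sum_nonneg)
    fix l assume "l \<in> {..<q}"
    then have l: "l < q" by simp
    \<comment> \<open>For \<open>\<kappa> l = 0\<close> the hypothesis \<open>bessel\<close> is
      silent, but the factor \<open>\<kappa> l\<close> makes the whole row vanish.\<close>
    have "\<kappa> l * (\<Sum>i<p. R l i) \<le> \<kappa> l * D"
      using bessel[OF l] l0[OF l] by (cases "\<kappa> l = 0") (auto simp: R_def)
    then have "\<kappa> l * (\<Sum>i<p. R l i) / D \<le> \<kappa> l" using D by (simp add: field_simps)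
    moreover have "(\<Sum>i<p. (\<kappa> l * P l i - \<kappa> l * R l i / D)) = \<kappa> l - \<kappa> l * (\<Sum>i<p. R l i) / D"
      using Pi[OF l] by (simp add: sum_subtractf sum_distrib_left[symmetric] sum_divide_distrib[symmetric])
    ultimately show "0 \<le> (\<Sum>i<p. (\<kappa> l * P l i - \<kappa> l * R l i / D) / ln 2)"
      by (simp add: sum_divide_distrib[symmetric])
  qed
  also have "\<dots> \<le> (\<Sum>l<q. \<Sum>i<p. \<kappa> l * P l i * log 2 (\<mu> i) + \<kappa> l * P l i * log 2 D - \<kappa> l * P l i * log 2 (\<kappa> l))"
    using pt by (intro sum_mono) auto
  finally show ?thesis
    by (simp add: sum.distrib sum_subtractf s1 s2 s3)
qed

text \<open>Induction on \<open>I\<close>: removing from \<open>Y\<close> its component along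
  \<open>Z k\<close> lowers the squared norm by \<open>|c|^2 / \<mu> k\<close> and leaves the
  coefficients along the other, orthogonal \<open>Z i\<close> unchanged. Weights may vanish, so the
  form is only semidefinite; positive norms are required of the \<open>Z i\<close> alone.\<close>

lemma bessel_inequality:
  fixes w :: "'s \<Rightarrow> real" and Z :: "'i \<Rightarrow> 's \<Rightarrow> complex"
  assumes "finite I" and S: "finite S" and w: "\<And>s. s \<in> S \<Longrightarrow> 0 \<le> w s"
    and "\<And>i. i \<in> I \<Longrightarrow> \<mu> i > 0"
    and "\<And>i j. i \<in> I \<Longrightarrow> j \<in> I \<Longrightarrow>
      (\<Sum>s\<in>S. of_real (w s) * cnj (Z i s) * Z j s) = (if i = j then of_real (\<mu> i) else 0)"
  shows "(\<Sum>i\<in>I. (cmod (\<Sum>s\<in>S. of_real (w s) * cnj (Z i s) * Y s))\<^sup>2 / \<mu> i)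
    \<le> (\<Sum>s\<in>S. w s * (cmod (Y s))\<^sup>2)"
  using assms(1,4,5)
proof (induction I arbitrary: Y rule: finite_induct)
  case empty
  then show ?case using w by (auto intro!: sum_nonneg)
next
  case (insert k I)
  define c where "c = (\<Sum>s\<in>S. of_real (w s) * cnj (Z k s) * Y s)"
  have mk: "\<mu> k > 0" using insert by auto
  define Y' where "Y' s = Y s - c / of_real (\<mu> k) * Z k s" for s
  have proj: "(\<Sum>s\<in>S. of_real (w s) * cnj (Z i s) * Y' s) = (\<Sum>s\<in>S. of_real (w s) * cnj (Z i s) * Y s)"
    if "i \<in> I" for i
  proof -
    have "(\<Sum>s\<in>S. of_real (w s) * cnj (Z i s) * Y' s) = (\<Sum>s\<in>S. of_real (w s) * cnj (Z i s) * Y s)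
       - c / of_real (\<mu> k) * (\<Sum>s\<in>S. of_real (w s) * cnj (Z i s) * Z k s)"
      unfolding Y'_def by (simp add: algebra_simps sum_subtractf sum_distrib_left)
    also have "(\<Sum>s\<in>S. of_real (w s) * cnj (Z i s) * Z k s) = 0"
      using insert.prems(2)[of i k] insert.hyps that by auto
    finally show ?thesis by simp
  qed
  have e: "complex_of_real (w s * (cmod (Y' s))\<^sup>2) = of_real (w s) * (cnj (Y s) * Y s)
      - c / of_real (\<mu> k) * cnj (of_real (w s) * cnj (Z k s) * Y s)
      - cnj (c / of_real (\<mu> k)) * (of_real (w s) * cnj (Z k s) * Y s)
      + (c / of_real (\<mu> k)) * cnj (c / of_real (\<mu> k)) * (of_real (w s) * cnj (Z k s) * Z k s)" for s
    unfolding Y'_def of_real_mult complex_norm_square by (simp add: algebra_simps)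
  have "complex_of_real (\<Sum>s\<in>S. w s * (cmod (Y' s))\<^sup>2) = (\<Sum>s\<in>S. of_real (w s) * (cnj (Y s) * Y s))
      - c / of_real (\<mu> k) * cnj c - cnj (c / of_real (\<mu> k)) * c
      + (c / of_real (\<mu> k)) * cnj (c / of_real (\<mu> k)) * (\<Sum>s\<in>S. of_real (w s) * cnj (Z k s) * Z k s)"
    unfolding of_real_sum e sum.distrib sum_subtractf c_def cnj_sum sum_distrib_left by simp
  also have "(\<Sum>s\<in>S. of_real (w s) * cnj (Z k s) * Z k s) = of_real (\<mu> k)"
    using insert.prems(2)[of k k] by auto
  also have "(\<Sum>s\<in>S. of_real (w s) * (cnj (Y s) * Y s)) = complex_of_real (\<Sum>s\<in>S. w s * (cmod (Y s))\<^sup>2)"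
    by (simp add: complex_norm_square mult.commute del: of_real_power)
  also have "complex_of_real (\<Sum>s\<in>S. w s * (cmod (Y s))\<^sup>2) - c / of_real (\<mu> k) * cnj c - cnj (c / of_real (\<mu> k)) * c
      + (c / of_real (\<mu> k)) * cnj (c / of_real (\<mu> k)) * of_real (\<mu> k)
      = complex_of_real ((\<Sum>s\<in>S. w s * (cmod (Y s))\<^sup>2) - (cmod c)\<^sup>2 / \<mu> k)"
    using mk by (simp add: complex_norm_square field_simps del: of_real_power)
  finally have n: "(\<Sum>s\<in>S. w s * (cmod (Y' s))\<^sup>2) = (\<Sum>s\<in>S. w s * (cmod (Y s))\<^sup>2) - (cmod c)\<^sup>2 / \<mu> k"
    using of_real_eq_iff by blast
  have "(\<Sum>i\<in>I. (cmod (\<Sum>s\<in>S. of_real (w s) * cnj (Z i s) * Y s))\<^sup>2 / \<mu> i)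
     = (\<Sum>i\<in>I. (cmod (\<Sum>s\<in>S. of_real (w s) * cnj (Z i s) * Y' s))\<^sup>2 / \<mu> i)"
    using proj by (intro sum.cong) auto
  also have "\<dots> \<le> (\<Sum>s\<in>S. w s * (cmod (Y' s))\<^sup>2)"
    using insert.prems by (intro insert.IH) auto
  finally show ?case using insert.hyps n by (simp add: c_def[symmetric])
qed

text \<open>\<open>G i j\<close> is the image of the \<open>(i,j)\<close> matrix unit of \<open>M_p\<close>, written in an eigenbasis of the
  big state, whose eigenvalues are \<open>\<kappa>\<close>.\<close>

lemma matrix_units_entropy:
  fixes G :: "nat \<Rightarrow> nat \<Rightarrow> nat \<Rightarrow> nat \<Rightarrow> complex" and \<kappa> \<mu> :: "nat \<Rightarrow> real"
  assumes p: "p > 0" and D: "D > 0" and q: "q = p * D"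
    and k0: "\<And>l. l < q \<Longrightarrow> 0 \<le> \<kappa> l" and k1: "(\<Sum>l<q. \<kappa> l) = 1"
    and mult: "\<And>i j k m a b. i < p \<Longrightarrow> j < p \<Longrightarrow> k < p \<Longrightarrow> m < p \<Longrightarrow> a < q \<Longrightarrow> b < q \<Longrightarrow>
      (\<Sum>c<q. G i j a c * G k m c b) = (if j = k then G i m a b else 0)"
    and star: "\<And>i j a b. i < p \<Longrightarrow> j < p \<Longrightarrow> a < q \<Longrightarrow> b < q \<Longrightarrow> cnj (G i j a b) = G j i b a"
    and unit: "\<And>a b. a < q \<Longrightarrow> b < q \<Longrightarrow> (\<Sum>i<p. G i i a b) = (if a = b then 1 else 0)"
    and state: "\<And>i j. i < p \<Longrightarrow> j < p \<Longrightarrow>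
      (\<Sum>l<q. of_real (\<kappa> l) * G i j l l) = (if i = j then of_real (\<mu> i) else 0)"
  shows "\<bar>(\<Sum>l<q. eta (\<kappa> l)) - (\<Sum>i<p. eta (\<mu> i))\<bar> \<le> log 2 D"
proof -
  define P where "P l i = Re (G i i l l)" for l i
  have diag: "G i i l l = of_real (P l i)" if "i < p" "l < q" for i l
    using star[of i i l l] that by (simp add: P_def complex_eq_iff)
  \<comment> \<open>\<open>G i j\<close> times its adjoint \<open>G j i\<close> is
    \<open>G i i\<close>; compare diagonal entries.\<close>
  have row: "(\<Sum>k<q. (cmod (G i j l k))\<^sup>2) = P l i" if "i < p" "j < p" "l < q" for i j l
  proof -
    have "complex_of_real (\<Sum>k<q. (cmod (G i j l k))\<^sup>2) = (\<Sum>k<q. G i j l k * G j i k l)"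
      unfolding of_real_sum complex_norm_square using that by (intro sum.cong) (auto simp only: star lessThan_iff)
    also have "\<dots> = of_real (P l i)" using mult[of i j j i l l] that diag by simp
    finally show ?thesis using of_real_eq_iff by blast
  qed
  have P0: "0 \<le> P l i" if "l < q" "i < p" for l i
    unfolding row[OF that(2) that(2) that(1), symmetric] by (intro sum_nonneg) auto
  have Pi: "(\<Sum>i<p. P l i) = 1" if "l < q" for l
  proof -
    have "complex_of_real (\<Sum>i<p. P l i) = (\<Sum>i<p. G i i l l)"
      unfolding of_real_sum using that diag by (intro sum.cong) auto
    also have "\<dots> = of_real 1" using unit[OF that that] by simp
    finally show ?thesis using of_real_eq_iff by blast
  qed
  \<comment> \<open>\<open>G i i = G i 0 * G 0 i\<close> and \<open>G 0 0 = G 0 i * G i 0\<close>,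
    and the trace is cyclic.\<close>
  have Pl0: "(\<Sum>l<q. P l i) = (\<Sum>l<q. P l 0)" if i: "i < p" for i
  proof -
    have "complex_of_real (\<Sum>l<q. P l i) = (\<Sum>l<q. \<Sum>c<q. G i 0 l c * G 0 i c l)"
      unfolding of_real_sum using i p mult[of i 0 0 i] diag by (intro sum.cong) auto
    also have "\<dots> = (\<Sum>c<q. \<Sum>l<q. G 0 i c l * G i 0 l c)"
      by (subst sum.swap) (simp add: mult.commute)
    also have "\<dots> = of_real (\<Sum>l<q. P l 0)"
      unfolding of_real_sum using i p mult[of 0 i i 0] diag by (intro sum.cong) auto
    finally show ?thesis using of_real_eq_iff by blast
  qed
  \<comment> \<open>The trace of the identity, computed by rows and by columns, fixes the common
    trace as \<open>q / p = D\<close>.\<close>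
  have "real q = (\<Sum>l<q. \<Sum>i<p. P l i)" using Pi by simp
  also have "\<dots> = (\<Sum>i<p. \<Sum>l<q. P l i)" by (rule sum.swap)
  also have "\<dots> = (\<Sum>i<p. \<Sum>l<q. P l 0)" by (intro sum.cong Pl0) auto
  also have "\<dots> = real p * (\<Sum>l<q. P l 0)" by simp
  finally have "(\<Sum>l<q. P l 0) = D" using p q by simp
  then have Pl: "(\<Sum>l<q. P l i) = D" if "i < p" for i using Pl0[OF that] by simp
  have mu: "\<mu> i = (\<Sum>l<q. \<kappa> l * P l i)" if "i < p" for i
  proof -
    have "complex_of_real (\<mu> i) = of_real (\<Sum>l<q. \<kappa> l * P l i)"
      using state[OF that that] that diag by simp
    then show ?thesis using of_real_eq_iff by blast
  qed
  have bessel: "(\<Sum>i<p. if \<mu> i > 0 then \<kappa> l * P l i / \<mu> i else 0) \<le> D" if l: "l < q" and kl: "\<kappa> l > 0" for l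
  proof -
    \<comment> \<open>In the semi-inner product \<open>\<langle>Z, W\<rangle> = Tr (\<rho> Z\<^sup>* W)\<close> the \<open>G 0 i\<close> are orthogonal with squared norm \<open>\<mu> i\<close>.
      Bessel's inequality is applied to \<open>Y\<close>, which has the \<open>k\<close>-th column of \<open>G 0 0\<close> in column \<open>l\<close>;
      summing over \<open>k\<close> turns \<open>P k 0\<close> into the trace \<open>D\<close> of \<open>G 0 0\<close>.\<close>
    define I where "I = {i. i < p \<and> \<mu> i > 0}"
    define S where "S = {..<q} \<times> {..<q}"
    define w where "w s = \<kappa> (snd s)" for s :: "nat \<times> nat"
    define Z where "Z i s = G 0 i (fst s) (snd s)" for i and s :: "nat \<times> nat"
    have orth: "(\<Sum>s\<in>S. of_real (w s) * cnj (Z i s) * Z j s) = (if i = j then of_real (\<mu> i) else 0)"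
      if "i \<in> I" "j \<in> I" for i j
    proof -
      have ij: "i < p" "j < p" using that by (auto simp: I_def)
      have "(\<Sum>s\<in>S. of_real (w s) * cnj (Z i s) * Z j s)
        = (\<Sum>a<q. \<Sum>b<q. of_real (\<kappa> b) * (G i 0 b a * G 0 j a b))"
        using ij p star unfolding S_def sum.cartesian_product
        by (intro sum.cong) (auto simp: w_def Z_def)
      also have "\<dots> = (\<Sum>b<q. of_real (\<kappa> b) * (\<Sum>a<q. G i 0 b a * G 0 j a b))"
        by (subst sum.swap) (simp add: sum_distrib_left)
      also have "\<dots> = (\<Sum>b<q. of_real (\<kappa> b) * G i j b b)"
        using ij p mult[of i 0 0 j] by (intro sum.cong) auto
      finally show ?thesis using state[OF ij] by simp
    qed
    have k: "(\<Sum>i\<in>I. \<kappa> l * (cmod (G i 0 l k))\<^sup>2 / \<mu> i) \<le> P k 0" if k: "k < q" for k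
    proof -
      define Y where "Y s = (if snd s = l then G 0 0 (fst s) k else 0)" for s :: "nat \<times> nat"
      have zy: "(\<Sum>s\<in>S. of_real (w s) * cnj (Z i s) * Y s) = of_real (\<kappa> l) * G i 0 l k"
        if "i \<in> I" for i
      proof -
        have i: "i < p" using that by (auto simp: I_def)
        have "(\<Sum>s\<in>S. of_real (w s) * cnj (Z i s) * Y s)
          = (\<Sum>a<q. \<Sum>b<q. if b = l then of_real (\<kappa> l) * (G i 0 l a * G 0 0 a k) else 0)"
          using i p star unfolding S_def sum.cartesian_product
          by (intro sum.cong) (auto simp: w_def Z_def Y_def)
        also have "\<dots> = of_real (\<kappa> l) * (\<Sum>a<q. G i 0 l a * G 0 0 a k)"
          using l by (simp add: sum_distrib_left)
        finally show ?thesis using mult[of i 0 0 0 l k] i p l k by simp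
      qed
      have yy: "(\<Sum>s\<in>S. w s * (cmod (Y s))\<^sup>2) = \<kappa> l * P k 0"
      proof -
        have "(\<Sum>s\<in>S. w s * (cmod (Y s))\<^sup>2)
          = (\<Sum>a<q. \<Sum>b<q. if b = l then \<kappa> l * (cmod (G 0 0 k a))\<^sup>2 else 0)"
          unfolding S_def sum.cartesian_product
        proof (intro sum.cong refl)
          fix s assume "s \<in> {..<q} \<times> {..<q}"
          then have "cmod (G 0 0 k (fst s)) = cmod (G 0 0 (fst s) k)"
            using star[of 0 0 "fst s" k] p k by (metis complex_mod_cnj lessThan_iff mem_Times_iff)
          then show "w s * (cmod (Y s))\<^sup>2 = (case s of (a, b) \<Rightarrow> if b = l then \<kappa> l * (cmod (G 0 0 k a))\<^sup>2 else 0)"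
            by (auto simp: w_def Y_def split: prod.splits)
        qed
        also have "\<dots> = \<kappa> l * (\<Sum>a<q. (cmod (G 0 0 k a))\<^sup>2)" using l by (simp add: sum_distrib_left)
        finally show ?thesis using row[of 0 0 k] p k by simp
      qed
      have "(\<Sum>i\<in>I. (cmod (\<Sum>s\<in>S. of_real (w s) * cnj (Z i s) * Y s))\<^sup>2 / \<mu> i) \<le> (\<Sum>s\<in>S. w s * (cmod (Y s))\<^sup>2)"
        by (rule bessel_inequality) (auto simp: orth, auto simp: I_def S_def w_def k0)
      \<comment> \<open>Each coefficient carries a factor \<open>\<kappa> l\<close>, hence its
        square appears on the left, while the squared norm of \<open>Y\<close> carries it once; one
        factor cancels since \<open>\<kappa> l > 0\<close>.\<close>
      also have "(\<Sum>i\<in>I. (cmod (\<Sum>s\<in>S. of_real (w s) * cnj (Z i s) * Y s))\<^sup>2 / \<mu> i)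
          = \<kappa> l * (\<Sum>i\<in>I. \<kappa> l * (cmod (G i 0 l k))\<^sup>2 / \<mu> i)"
        unfolding sum_distrib_left using kl
        by (intro sum.cong) (auto simp: zy norm_mult power2_eq_square)
      finally show ?thesis using kl by (simp add: yy)
    qed
    have "(\<Sum>i<p. if \<mu> i > 0 then \<kappa> l * P l i / \<mu> i else 0) = (\<Sum>i\<in>I. \<kappa> l * P l i / \<mu> i)"
      by (subst sum.inter_filter[symmetric]) (auto simp: I_def intro!: sum.cong)
    \<comment> \<open>The choice \<open>j = 0\<close> in \<open>row\<close>: \<open>P l i\<close> is
      the squared length of row \<open>l\<close> of \<open>G i 0\<close>.\<close>
    also have "\<dots> = (\<Sum>i\<in>I. \<Sum>k<q. \<kappa> l * (cmod (G i 0 l k))\<^sup>2 / \<mu> i)"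
      using l p by (intro sum.cong) (auto simp: I_def row[symmetric, of _ 0] sum_distrib_left sum_divide_distrib)
    also have "\<dots> = (\<Sum>k<q. \<Sum>i\<in>I. \<kappa> l * (cmod (G i 0 l k))\<^sup>2 / \<mu> i)" by (rule sum.swap)
    also have "\<dots> \<le> (\<Sum>k<q. P k 0)" using k by (intro sum_mono) auto
    also have "\<dots> = D" using Pl p by simp
    finally show ?thesis .
  qed
  have "- (\<Sum>l<q. eta (\<kappa> l)) \<le> - (\<Sum>i<p. eta (\<mu> i)) + log 2 D"
    using D by (intro entropy_le_coarse[where P = P] k0 k1 P0 Pi Pl mu) auto
  moreover have "- (\<Sum>i<p. eta (\<mu> i)) \<le> - (\<Sum>l<q. eta (\<kappa> l)) + log 2 D"
    using D by (intro entropy_coarse_le[where P = P] k0 k1 P0 Pi mu bessel) auto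
  ultimately show ?thesis by linarith
qed

section \<open>The spectral theorem for Hermitian matrices\<close>

lemma dim_mat_adjoint [simp]:
  "dim_row (mat_adjoint A) = dim_col A" "dim_col (mat_adjoint A) = dim_row A"
  by (auto simp: mat_adjoint_def)

lemma mat_adjoint_index [simp]:
  "i < dim_col (A :: complex mat) \<Longrightarrow> j < dim_row A \<Longrightarrow> mat_adjoint A $$ (i, j) = cnj (A $$ (j, i))"
  by (auto simp: mat_adjoint_def mat_of_rows_def conjugate_vec_def cols_nth col_def)

lemma mat_adjoint_carrier [simp]:
  "mat_adjoint A \<in> carrier_mat n m \<longleftrightarrow> A \<in> carrier_mat m n"
  by (metis carrier_matI carrier_matD dim_mat_adjoint)

lemma mat_adjoint_adjoint [simp]: "mat_adjoint (mat_adjoint A) = (A :: complex mat)"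
  by (rule eq_matI) auto

lemma mult_mat_index:
  "A \<in> carrier_mat n m \<Longrightarrow> B \<in> carrier_mat m k \<Longrightarrow> i < n \<Longrightarrow> j < k \<Longrightarrow>
    (A * B) $$ (i, j) = (\<Sum>l<m. A $$ (i, l) * B $$ (l, j))"
  by (auto simp: scalar_prod_def atLeast0LessThan intro!: sum.cong)

lemma mat_adjoint_mult:
  assumes "(A :: complex mat) \<in> carrier_mat n m" "B \<in> carrier_mat m k"
  shows "mat_adjoint (A * B) = mat_adjoint B * mat_adjoint A"
proof (rule eq_matI)
  fix i j assume "i < dim_row (mat_adjoint B * mat_adjoint A)" "j < dim_col (mat_adjoint B * mat_adjoint A)"
  then have ij: "i < k" "j < n" using assms by auto
  have "mat_adjoint (A * B) $$ (i, j) = (\<Sum>l<m. cnj (A $$ (j, l)) * cnj (B $$ (l, i)))"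
    using ij assms by (simp add: mult_mat_index[OF assms] del: index_mult_mat(1))
  also have "\<dots> = (mat_adjoint B * mat_adjoint A) $$ (i, j)"
    using ij assms
    by (subst mult_mat_index[of _ k m _ n]) (auto intro!: sum.cong)
  finally show "mat_adjoint (A * B) $$ (i, j) = (mat_adjoint B * mat_adjoint A) $$ (i, j)" .
qed (use assms in auto)

lemma mtrace_mult:
  assumes "A \<in> carrier_mat n m" "B \<in> carrier_mat m n"
  shows "mtrace (A * B) = (\<Sum>i<n. \<Sum>l<m. A $$ (i, l) * B $$ (l, i))"
  using assms by (simp add: mtrace_def mult_mat_index[OF assms] del: index_mult_mat(1))

lemma mtrace_comm:
  assumes "A \<in> carrier_mat n m" "B \<in> carrier_mat m n"
  shows "mtrace (A * B) = mtrace (B * A)"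
  unfolding mtrace_mult[OF assms] mtrace_mult[OF assms(2,1)]
  by (subst sum.swap) (simp add: mult.commute)

section \<open>Entropy and the characteristic polynomial\<close>

lemma order_prod_linear:
  fixes n :: nat
  shows "order z (\<Prod>i<n. [:- a i, 1:]) = card {i. i < n \<and> a i = (z :: complex)}"
proof (induction n)
  case 0
  then show ?case by (simp add: order_1_eq_0 order_0I)
next
  case (Suc n)
  have nz: "(\<Prod>i<n. [:- a i, 1:]) * [:- a n, 1:] \<noteq> 0"
    by (subst mult_eq_0_iff) (simp add: prod_zero_iff)
  have "{i. i < Suc n \<and> a i = z} = {i. i < n \<and> a i = z} \<union> (if a n = z then {n} else {})"
    by (auto simp: less_Suc_eq)
  moreover have "order z [:- a n, 1:] = (if a n = z then 1 else 0)"
    using order_linear_power[of z "- a n" 1] by auto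
  ultimately show ?case using Suc order_mult[OF nz, of z] by simp
qed

text \<open>\<open>vN_entropy\<close> runs over the distinct roots weighted by their order. The
  order of a root is the number of indices that carry it, so grouping the indices by value gives a
  plain sum.\<close>

lemma vN_entropy_char_poly:
  fixes \<kappa> :: "nat \<Rightarrow> real"
  assumes "char_poly A = (\<Prod>i<n. [:- of_real (\<kappa> i), 1:])"
  shows "vN_entropy A = - (\<Sum>i<n. eta (\<kappa> i))"
proof -
  have r: "{z. poly (char_poly A) z = 0} = (\<lambda>i. complex_of_real (\<kappa> i)) ` {..<n}"
    unfolding assms poly_prod by (auto simp: image_def)
  have "(\<Sum>z\<in>{z. poly (char_poly A) z = 0}. real (order z (char_poly A)) * eta (Re z))
     = (\<Sum>z\<in>(\<lambda>i. complex_of_real (\<kappa> i)) ` {..<n}. \<Sum>i\<in>{i. i < n \<and> of_real (\<kappa> i) = z}. eta (\<kappa> i))"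
    unfolding r unfolding assms order_prod_linear by (intro sum.cong) auto
  also have "\<dots> = (\<Sum>i<n. eta (\<kappa> i))"
    using sum.image_gen[of "{..<n}" "\<lambda>i. eta (\<kappa> i)" "\<lambda>i. complex_of_real (\<kappa> i)"] by simp
  finally show ?thesis by (simp add: vN_entropy_def)
qed

lemma prod_list_map_upt: "(\<Prod>i\<leftarrow>[0..<n]. f i) = (\<Prod>i<n. f i)"
  for f :: "nat \<Rightarrow> 'a :: comm_monoid_mult"
  by (induction n) (auto simp: mult.commute)

text \<open>If \<open>c\<close> were the only eigenvalue, every diagonal entry of a Schur form would
  be \<open>c\<close>, and the trace, invariant under similarity, would be
  \<open>n * c\<close>.\<close>

lemma exists_eigenvalue_neq:
  fixes C :: "complex mat"
  assumes C: "C \<in> carrier_mat n n" and tr: "mtrace C \<noteq> of_nat n * c"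
  shows "\<exists>\<theta>. \<theta> \<noteq> c \<and> eigenvalue C \<theta>"
proof (rule ccontr)
  assume "\<not> ?thesis"
  then have all: "\<theta> = c" if "eigenvalue C \<theta>" for \<theta> using that by blast
  from char_poly_factorized[OF C] obtain es where es: "char_poly C = (\<Prod>a\<leftarrow>es. [:- a, 1:])" by auto
  from schur_decomposition_exists[OF C es] obtain B where
    B: "B \<in> carrier_mat n n" "upper_triangular B" "similar_mat C B" by auto
  from char_poly_similar[OF B(3)] char_poly_upper_triangular[OF B(1,2)]
  have cp: "char_poly C = (\<Prod>a\<leftarrow>diag_mat B. [:- a, 1:])" by simp
  have d: "B $$ (i, i) = c" if "i < n" for i
  proof (rule all)
    have "B $$ (i, i) \<in> set (diag_mat B)" using that B by (auto simp: diag_mat_def)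
    then show "eigenvalue C (B $$ (i, i))"
      unfolding eigenvalue_root_char_poly[OF C] cp poly_prod_list
      by (auto simp: prod_list_zero_iff image_iff intro!: bexI[of _ "B $$ (i,i)"])
  qed
  from B(3) obtain P Q where w: "similar_mat_wit C B P Q" by (auto simp: similar_mat_def)
  from similar_mat_witD2[OF C w] have PQ: "P \<in> carrier_mat n n" "Q \<in> carrier_mat n n"
    "Q * P = 1\<^sub>m n" "C = P * B * Q" by auto
  have "mtrace C = mtrace (P * (B * Q))" using PQ B by (simp add: assoc_mult_mat[of _ n n _ n _ n])
  also have "\<dots> = mtrace (B * Q * P)" using PQ B by (intro mtrace_comm[of _ n n]) auto
  also have "B * Q * P = B" using PQ B by (simp add: assoc_mult_mat[of _ n n _ n _ n])
  also have "mtrace B = of_nat n * c" using B d by (simp add: mtrace_def)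
  finally show False using tr by simp
qed

text \<open>The induction step of the spectral theorem. Deflation keeps the full space, so neither a
  basis of the orthogonal complement nor a compression of \<open>A\<close> has to be built.\<close>

lemma orthonormal_eigenvectors_extend:
  fixes A :: "complex mat" and e :: "nat \<Rightarrow> nat \<Rightarrow> complex" and \<kappa> :: "nat \<Rightarrow> real"
  assumes A: "A \<in> carrier_mat n n"
    and herm: "\<And>i j. i < n \<Longrightarrow> j < n \<Longrightarrow> cnj (A $$ (i, j)) = A $$ (j, i)"
    and k: "k < n"
    and on: "\<And>i j. i < k \<Longrightarrow> j < k \<Longrightarrow> (\<Sum>a<n. cnj (e i a) * e j a) = (if i = j then 1 else 0)"
    and ev: "\<And>i a. i < k \<Longrightarrow> a < n \<Longrightarrow> (\<Sum>b<n. A $$ (a, b) * e i b) = of_real (\<kappa> i) * e i a"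
  shows "\<exists>v \<theta>. (\<Sum>a<n. cnj (v a) * v a) = 1 \<and> (\<forall>i<k. (\<Sum>a<n. cnj (e i a) * v a) = 0) \<and>
    (\<forall>a<n. (\<Sum>b<n. A $$ (a, b) * v b) = complex_of_real \<theta> * v a)"
proof -
  \<comment> \<open>\<open>C\<close> moves the eigenvalues of the known eigenvectors to \<open>c\<close>; by the choice of \<open>c\<close>
    the trace forces a further eigenvalue of \<open>C\<close>, and its eigenvectors are orthogonal to the \<open>e i\<close>.\<close>
  define c where "c = (Re (mtrace A) - (\<Sum>i<k. \<kappa> i)) / real (n - k) + 1"
  define C where "C = mat n n (\<lambda>(a, b). A $$ (a, b) + (\<Sum>i<k. of_real (c - \<kappa> i) * e i a * cnj (e i b)))"
  have C: "C \<in> carrier_mat n n" by (simp add: C_def)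
  have "mtrace C = mtrace A + (\<Sum>i<k. of_real (c - \<kappa> i) * (\<Sum>a<n. cnj (e i a) * e i a))"
    unfolding mtrace_def C_def using A
    by (simp add: sum.distrib sum_distrib_left mult_ac) (subst sum.swap, simp)
  also have "(\<Sum>i<k. of_real (c - \<kappa> i) * (\<Sum>a<n. cnj (e i a) * e i a)) = of_real (\<Sum>i<k. c - \<kappa> i)"
    by (simp add: on)
  finally have "Re (mtrace C) = Re (mtrace A) + real k * c - (\<Sum>i<k. \<kappa> i)"
    by (simp add: sum_subtractf)
  moreover have "real (n - k) * c = Re (mtrace A) - (\<Sum>i<k. \<kappa> i) + real (n - k)"
    using k by (simp add: c_def field_simps)
  ultimately have "Re (mtrace C) \<noteq> real n * c" using k by (simp add: of_nat_diff algebra_simps)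
  then have "mtrace C \<noteq> of_nat n * of_real c" by auto
  from exists_eigenvalue_neq[OF C this] obtain \<theta> v where \<theta>: "\<theta> \<noteq> of_real c"
    and v: "v \<in> carrier_vec n" "v \<noteq> 0\<^sub>v n" "C *\<^sub>v v = \<theta> \<cdot>\<^sub>v v"
    using C by (auto simp: eigenvalue_def eigenvector_def)
  have Cv: "(\<Sum>b<n. A $$ (a, b) * v $ b) + (\<Sum>i<k. of_real (c - \<kappa> i) * e i a * (\<Sum>b<n. cnj (e i b) * v $ b))
     = \<theta> * v $ a" if a: "a < n" for a
  proof -
    have "(C *\<^sub>v v) $ a = (\<Sum>b<n. (A $$ (a, b) + (\<Sum>i<k. of_real (c - \<kappa> i) * e i a * cnj (e i b))) * v $ b)"
      using a v(1) C by (simp add: scalar_prod_def atLeast0LessThan C_def)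
    also have "\<dots> = (\<Sum>b<n. A $$ (a, b) * v $ b) + (\<Sum>b<n. \<Sum>i<k. of_real (c - \<kappa> i) * e i a * (cnj (e i b) * v $ b))"
      by (simp add: distrib_right sum.distrib sum_distrib_right mult.assoc)
    also have "(\<Sum>b<n. \<Sum>i<k. of_real (c - \<kappa> i) * e i a * (cnj (e i b) * v $ b))
      = (\<Sum>i<k. of_real (c - \<kappa> i) * e i a * (\<Sum>b<n. cnj (e i b) * v $ b))"
      by (subst sum.swap) (simp add: sum_distrib_left)
    finally show ?thesis using a v by simp
  qed
  \<comment> \<open>Pair the eigenvalue equation with \<open>e j\<close>: \<open>A\<close>
    contributes the factor \<open>\<kappa> j\<close> by Hermiticity, the deflation term contributes
    \<open>c - \<kappa> j\<close>, so \<open>\<theta> - c\<close> annihilates the pairing.\<close>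
  have orth: "(\<Sum>b<n. cnj (e j b) * v $ b) = 0" if j: "j < k" for j
  proof -
    let ?s = "\<lambda>i. \<Sum>b<n. cnj (e i b) * v $ b"
    have swap: "(\<Sum>a<n. f a * (\<Sum>i<k. g i * e i a * s i)) = (\<Sum>i<k. g i * s i * (\<Sum>a<n. f a * e i a))"
      for f g s unfolding sum_distrib_left by (subst sum.swap) (simp add: mult_ac)
    have "\<theta> * ?s j = (\<Sum>a<n. cnj (e j a) * (\<theta> * v $ a))" by (simp add: sum_distrib_left mult_ac)
    also have "\<dots> = (\<Sum>a<n. cnj (e j a) * (\<Sum>b<n. A $$ (a, b) * v $ b))
        + (\<Sum>a<n. cnj (e j a) * (\<Sum>i<k. of_real (c - \<kappa> i) * e i a * ?s i))"
      unfolding sum.distrib[symmetric] distrib_left[symmetric] by (intro sum.cong refl) (simp only: Cv lessThan_iff)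
    also have "(\<Sum>a<n. cnj (e j a) * (\<Sum>b<n. A $$ (a, b) * v $ b))
       = (\<Sum>b<n. (\<Sum>a<n. cnj (e j a) * A $$ (a, b)) * v $ b)"
      unfolding sum_distrib_left sum_distrib_right by (subst sum.swap) (simp add: mult_ac)
    also have "\<dots> = (\<Sum>b<n. cnj (of_real (\<kappa> j) * e j b) * v $ b)"
    proof (intro sum.cong refl arg_cong2[where f = "(*)"])
      fix b assume "b \<in> {..<n}"
      then have b: "b < n" by simp
      show "(\<Sum>a<n. cnj (e j a) * A $$ (a, b)) = cnj (of_real (\<kappa> j) * e j b)"
        unfolding ev[OF j b, symmetric] cnj_sum by (intro sum.cong) (auto simp: herm b mult.commute)
    qed
    also have "\<dots> = of_real (\<kappa> j) * ?s j" by (simp add: sum_distrib_left mult_ac)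
    also have "(\<Sum>a<n. cnj (e j a) * (\<Sum>i<k. of_real (c - \<kappa> i) * e i a * ?s i))
       = (\<Sum>i<k. of_real (c - \<kappa> i) * ?s i * (\<Sum>a<n. cnj (e j a) * e i a))"
      by (rule swap)
    also have "\<dots> = (\<Sum>i<k. if i = j then of_real (c - \<kappa> j) * ?s j else 0)"
      using j by (intro sum.cong) (auto simp: on)
    also have "\<dots> = of_real (c - \<kappa> j) * ?s j" using j by simp
    finally have "(\<theta> - of_real c) * ?s j = 0" by (simp add: algebra_simps)
    then show ?thesis using \<theta> by simp
  qed
  have Av: "(\<Sum>b<n. A $$ (a, b) * v $ b) = \<theta> * v $ a" if "a < n" for a
    using Cv[OF that] by (simp add: orth)
  define N where "N = (\<Sum>a<n. (cmod (v $ a))\<^sup>2)"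
  have Nc: "(\<Sum>a<n. cnj (v $ a) * v $ a) = of_real N"
    unfolding N_def of_real_sum complex_norm_square by (simp add: mult.commute)
  obtain a where "a < n" "v $ a \<noteq> 0" using v by (metis eq_vecI carrier_vecD index_zero_vec)
  then have N: "N > 0" unfolding N_def by (intro sum_pos2[of _ a]) auto
  have "\<theta> * of_real N = (\<Sum>a<n. cnj (v $ a) * (\<theta> * v $ a))"
    unfolding Nc[symmetric] by (simp add: sum_distrib_left mult_ac)
  also have "\<dots> = (\<Sum>a<n. \<Sum>b<n. cnj (v $ a) * A $$ (a, b) * v $ b)"
    by (intro sum.cong refl) (simp add: Av[symmetric] sum_distrib_left mult_ac)
  finally have t: "\<theta> * of_real N = (\<Sum>a<n. \<Sum>b<n. cnj (v $ a) * A $$ (a, b) * v $ b)" .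
  \<comment> \<open>\<open>\<theta> * N\<close> is the quadratic form of \<open>A\<close> at
    \<open>v\<close>, which Hermiticity makes real.\<close>
  have "cnj (\<theta> * of_real N) = \<theta> * of_real N"
    unfolding t by (subst sum.swap) (auto simp: herm mult_ac intro!: sum.cong)
  then have "cnj \<theta> = \<theta>" using N by simp
  then have \<theta>r: "\<theta> = of_real (Re \<theta>)" by (simp add: complex_eq_iff)
  let ?r = "complex_of_real (sqrt N)"
  have r: "?r \<noteq> 0" "cnj ?r = ?r" "?r * ?r = of_real N" using N by (auto simp flip: of_real_mult)
  show ?thesis
  proof (intro exI[of _ "\<lambda>a. v $ a / ?r"] exI[of _ "Re \<theta>"] conjI allI impI)
    show "(\<Sum>a<n. cnj (v $ a / ?r) * (v $ a / ?r)) = 1"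
      using r N by (simp add: Nc sum_divide_distrib[symmetric])
    show "(\<Sum>a<n. cnj (e i a) * (v $ a / ?r)) = 0" if "i < k" for i
      using orth[OF that] by (simp add: sum_divide_distrib[symmetric])
    show "(\<Sum>b<n. A $$ (a, b) * (v $ b / ?r)) = of_real (Re \<theta>) * (v $ a / ?r)" if "a < n" for a
      using Av[OF that] \<theta>r by (simp add: sum_divide_distrib[symmetric])
  qed
qed

text \<open>An orthonormal eigenbasis, built one vector at a time from the empty family, supplies
  the columns of \<open>U\<close>. The entropy formula follows because similar matrices share their
  characteristic polynomial.\<close>

lemma hermitian_spectral:
  fixes A :: "complex mat"
  assumes A: "A \<in> carrier_mat n n" and herm: "mat_adjoint A = A"
  obtains U and \<kappa> :: "nat \<Rightarrow> real" where "U \<in> carrier_mat n n"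
    "mat_adjoint U * U = 1\<^sub>m n" "U * mat_adjoint U = 1\<^sub>m n"
    "mat_adjoint U * A * U = mat n n (\<lambda>(i, j). if i = j then of_real (\<kappa> i) else 0)"
    "vN_entropy A = - (\<Sum>i<n. eta (\<kappa> i))"
proof -
  have h: "cnj (A $$ (i, j)) = A $$ (j, i)" if "i < n" "j < n" for i j
    using mat_adjoint_index[of j A i] herm A that by auto
  have "\<exists>e (\<kappa> :: nat \<Rightarrow> real). (\<forall>i<k. \<forall>j<k. (\<Sum>a<n. cnj (e i a) * e j a) = (if i = j then 1 else 0)) \<and>
     (\<forall>i<k. \<forall>a<n. (\<Sum>b<n. A $$ (a, b) * e i b) = of_real (\<kappa> i) * e i a)" if "k \<le> n" for k
    using that
  proof (induction k)
    case 0
    then show ?case by simp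
  next
    case (Suc k)
    from Suc.IH[OF Suc_leD[OF Suc.prems]] obtain e and \<kappa> :: "nat \<Rightarrow> real" where
      e': "\<forall>i<k. \<forall>j<k. (\<Sum>a<n. cnj (e i a) * e j a) = (if i = j then 1 else 0)"
      "\<forall>i<k. \<forall>a<n. (\<Sum>b<n. A $$ (a, b) * e i b) = of_real (\<kappa> i) * e i a"
      by blast
    note e = e'[rule_format]
    have "k < n" using Suc by simp
    from orthonormal_eigenvectors_extend[OF A h this e] obtain v \<theta> where
      v: "(\<Sum>a<n. cnj (v a) * v a) = 1" "\<And>i. i < k \<Longrightarrow> (\<Sum>a<n. cnj (e i a) * v a) = 0"
      "\<And>a. a < n \<Longrightarrow> (\<Sum>b<n. A $$ (a, b) * v b) = complex_of_real \<theta> * v a" by blast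
    have v2: "(\<Sum>a<n. cnj (v a) * e i a) = 0" if "i < k" for i
    proof -
      have "cnj (\<Sum>a<n. cnj (e i a) * v a) = 0" using v(2)[OF that] by simp
      then show ?thesis by (simp add: mult.commute)
    qed
    show ?case
      by (rule exI[of _ "e(k := v)"], rule exI[of _ "\<kappa>(k := \<theta>)"])
        (auto simp: less_Suc_eq e v v2)
  qed
  from this[of n] obtain e and \<kappa> :: "nat \<Rightarrow> real" where
    e': "\<forall>i<n. \<forall>j<n. (\<Sum>a<n. cnj (e i a) * e j a) = (if i = j then 1 else 0)"
      "\<forall>i<n. \<forall>a<n. (\<Sum>b<n. A $$ (a, b) * e i b) = of_real (\<kappa> i) * e i a"
    by blast
  note e = e'[rule_format]
  define U where "U = mat n n (\<lambda>(a, i). e i a)"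
  define D where "D = mat n n (\<lambda>(i, j). if i = j then complex_of_real (\<kappa> i) else 0)"
  have U: "U \<in> carrier_mat n n" and D: "D \<in> carrier_mat n n" by (auto simp: U_def D_def)
  have U': "mat_adjoint U \<in> carrier_mat n n" using U by simp
  have 1: "mat_adjoint U * U = 1\<^sub>m n"
    by (rule eq_matI) (use U U' in \<open>auto simp: mult_mat_index[OF U' U] e simp del: index_mult_mat(1)\<close>,
        auto simp: U_def e)
  have 2: "U * mat_adjoint U = 1\<^sub>m n" by (rule mat_mult_left_right_inverse[OF U' U 1])
  have AU: "A * U = U * D"
  proof (rule eq_matI)
    fix a i assume "a < dim_row (U * D)" "i < dim_col (U * D)"
    then have ai: "a < n" "i < n" using U D by auto
    have "(A * U) $$ (a, i) = of_real (\<kappa> i) * e i a"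
      using ai A U by (simp add: mult_mat_index[OF A U] del: index_mult_mat(1)) (simp add: U_def e)
    also have "\<dots> = (\<Sum>l<n. if l = i then e i a * of_real (\<kappa> i) else 0)" using ai by simp
    also have "\<dots> = (U * D) $$ (a, i)" unfolding mult_mat_index[OF U D ai] using ai
      by (intro sum.cong) (auto simp: U_def D_def)
    finally show "(A * U) $$ (a, i) = (U * D) $$ (a, i)" .
  qed (use A U D in auto)
  have 3: "mat_adjoint U * A * U = D"
    using A U U' D by (simp add: assoc_mult_mat[of _ n n _ n _ n] AU)
      (simp add: assoc_mult_mat[of _ n n _ n _ n, symmetric] 1)
  have "A = A * (U * mat_adjoint U)" using A 2 by simp
  also have "\<dots> = U * D * mat_adjoint U" using A U U' by (simp add: assoc_mult_mat[of _ n n _ n _ n, symmetric] AU)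
  finally have "similar_mat_wit A D U (mat_adjoint U)"
    using A U U' D 1 2 by (auto simp: similar_mat_wit_def Let_def)
  then have "char_poly A = char_poly D" by (intro char_poly_similar) (auto simp: similar_mat_def)
  also have "\<dots> = (\<Prod>a\<leftarrow>diag_mat D. [:- a, 1:])"
    by (rule char_poly_upper_triangular[OF D]) (auto simp: D_def)
  also have "\<dots> = (\<Prod>a\<leftarrow>map (\<lambda>i. complex_of_real (\<kappa> i)) [0..<n]. [:- a, 1:])"
    by (intro arg_cong[where f = prod_list] map_cong) (auto simp: D_def diag_mat_def)
  also have "\<dots> = (\<Prod>i<n. [:- of_real (\<kappa> i), 1:])"
    unfolding prod_list_map_upt[symmetric] by (simp add: o_def)
  finally have "vN_entropy A = - (\<Sum>i<n. eta (\<kappa> i))" by (rule vN_entropy_char_poly)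
  then show ?thesis using that[OF U 1 2 3[unfolded D_def]] by blast
qed

section \<open>Entropy under unital homomorphisms of matrix algebras\<close>

text \<open>The finite-dimensional counterpart of \<open>qstate\<close>: what a state of the
  quasi-local algebra leaves on a local algebra, with no density matrix presupposed.\<close>

definition matrix_state :: "nat \<Rightarrow> (complex mat \<Rightarrow> complex) \<Rightarrow> bool" where
  "matrix_state n f \<longleftrightarrow>
     (\<forall>X\<in>carrier_mat n n. \<forall>Y\<in>carrier_mat n n. f (X + Y) = f X + f Y) \<and>
     (\<forall>c. \<forall>X\<in>carrier_mat n n. f (c \<cdot>\<^sub>m X) = c * f X) \<and>
     (\<forall>X\<in>carrier_mat n n. Im (f (mat_adjoint X * X)) = 0 \<and> 0 \<le> Re (f (mat_adjoint X * X))) \<and>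
     f (1\<^sub>m n) = 1"

definition munit :: "nat \<Rightarrow> nat \<Rightarrow> nat \<Rightarrow> complex mat" where
  "munit n i j = mat n n (\<lambda>(a, b). if a = i \<and> b = j then 1 else 0)"

lemma munit_carrier [simp]: "munit n i j \<in> carrier_mat n n"
  by (simp add: munit_def)

lemma mult_square_carrier [simp]:
  "A \<in> carrier_mat n n \<Longrightarrow> B \<in> carrier_mat n n \<Longrightarrow> A * B \<in> carrier_mat n n"
  by (rule mult_carrier_mat)

lemma munit_mult:
  assumes "i < n" "j < n" "k < n" "m < n"
  shows "munit n i j * munit n k m = (if j = k then munit n i m else 0\<^sub>m n n)"
proof (rule eq_matI)
  fix a b assume "a < dim_row (if j = k then munit n i m else 0\<^sub>m n n)"
    "b < dim_col (if j = k then munit n i m else 0\<^sub>m n n)"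
  then have ab: "a < n" "b < n" by (auto simp: munit_def split: if_splits)
  have "(munit n i j * munit n k m) $$ (a, b)
      = (\<Sum>l<n. if l = j then if a = i \<and> j = k \<and> b = m then 1 else 0 else 0)"
    unfolding mult_mat_index[OF munit_carrier munit_carrier ab]
    using ab by (intro sum.cong) (auto simp: munit_def)
  then show "(munit n i j * munit n k m) $$ (a, b) = (if j = k then munit n i m else 0\<^sub>m n n) $$ (a, b)"
    using ab assms by (auto simp: munit_def)
qed (auto simp: munit_def)

lemma munit_adjoint: "i < n \<Longrightarrow> j < n \<Longrightarrow> mat_adjoint (munit n i j) = munit n j i"
  by (rule eq_matI) (auto simp: munit_def)

lemma linear_expansion:
  fixes f :: "complex mat \<Rightarrow> complex"
  assumes add: "\<And>X Y. X \<in> carrier_mat n n \<Longrightarrow> Y \<in> carrier_mat n n \<Longrightarrow> f (X + Y) = f X + f Y"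
    and smult: "\<And>c X. X \<in> carrier_mat n n \<Longrightarrow> f (c \<cdot>\<^sub>m X) = c * f X"
    and X: "X \<in> carrier_mat n n"
  shows "f X = (\<Sum>i<n. \<Sum>j<n. X $$ (i, j) * f (munit n i j))"
proof -
  \<comment> \<open>Truncating \<open>X\<close> to the entries in \<open>S\<close> turns the
    expansion into an induction on \<open>S\<close>.\<close>
  define XS where "XS S = mat n n (\<lambda>s. if s \<in> S then X $$ s else 0)" for S
  have XS: "XS S \<in> carrier_mat n n" for S by (simp add: XS_def)
  have "f (XS S) = (\<Sum>(i, j)\<in>S. X $$ (i, j) * f (munit n i j))" if "finite S" for S
    using that
  proof (induction S)
    case empty
    have "XS {} = 0 \<cdot>\<^sub>m 0\<^sub>m n n" by (rule eq_matI) (auto simp: XS_def)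
    then show ?case using smult[of "0\<^sub>m n n" 0] by simp
  next
    case (insert s S)
    obtain i j where s: "s = (i, j)" by (cases s)
    have "XS (insert s S) = (X $$ s) \<cdot>\<^sub>m munit n i j + XS S"
      using insert by (intro eq_matI) (auto simp: XS_def munit_def s)
    then show ?case using insert XS by (simp add: add smult s)
  qed
  from this[of "{..<n} \<times> {..<n}"] have "f (XS ({..<n} \<times> {..<n})) = (\<Sum>i<n. \<Sum>j<n. X $$ (i, j) * f (munit n i j))"
    by (simp add: sum.cartesian_product)
  moreover have "XS ({..<n} \<times> {..<n}) = X" using X by (intro eq_matI) (auto simp: XS_def)
  ultimately show ?thesis by simp
qed

text \<open>\<open>density\<close> is a definite description, so uniqueness has to be shown: pairing
  with \<open>munit n j i\<close> reads off the entry \<open>(i, j)\<close>.\<close>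

lemma density_eqI:
  assumes r: "\<rho> \<in> carrier_mat n n" and f: "\<And>X. X \<in> carrier_mat n n \<Longrightarrow> f X = mtrace (\<rho> * X)"
  shows "density n f = \<rho>"
  unfolding density_def
proof (rule the_equality)
  have entry: "mtrace (\<sigma> * munit n j i) = \<sigma> $$ (i, j)"
    if "\<sigma> \<in> carrier_mat n n" "i < n" "j < n" for \<sigma> i j
  proof -
    have "mtrace (\<sigma> * munit n j i) = (\<Sum>a<n. \<Sum>b<n. if b = j then if a = i then \<sigma> $$ (a, j) else 0 else 0)"
      unfolding mtrace_mult[OF that(1) munit_carrier] by (intro sum.cong) (auto simp: munit_def)
    then show ?thesis using that by simp
  qed
  show "\<sigma> = \<rho>" if "\<sigma> \<in> carrier_mat n n \<and> (\<forall>X\<in>carrier_mat n n. f X = mtrace (\<sigma> * X))" for \<sigma>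
  proof (rule eq_matI)
    fix i j assume "i < dim_row \<rho>" "j < dim_col \<rho>"
    then have ij: "i < n" "j < n" using r by auto
    show "\<sigma> $$ (i, j) = \<rho> $$ (i, j)"
      using entry[of \<sigma> i j] entry[of \<rho> i j] that r ij f[of "munit n j i"] by simp
  qed (use that r in auto)
qed (use assms in auto)

text \<open>The density has the entries \<open>f (munit n j i)\<close>. Its Hermiticity comes from
  positivity by polarisation: \<open>f\<close> is real on \<open>mat_adjoint X * X\<close> for
  \<open>X\<close> a combination of two matrix units in one row.\<close>

lemma matrix_state_density:
  assumes "matrix_state n f"
  obtains \<rho> where "\<rho> \<in> carrier_mat n n" "mat_adjoint \<rho> = \<rho>"
    "\<And>X. X \<in> carrier_mat n n \<Longrightarrow> f X = mtrace (\<rho> * X)"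
proof -
  have add: "\<And>X Y. X \<in> carrier_mat n n \<Longrightarrow> Y \<in> carrier_mat n n \<Longrightarrow> f (X + Y) = f X + f Y"
    and smult: "\<And>c X. X \<in> carrier_mat n n \<Longrightarrow> f (c \<cdot>\<^sub>m X) = c * f X"
    and pos: "\<And>X. X \<in> carrier_mat n n \<Longrightarrow> Im (f (mat_adjoint X * X)) = 0"
    using assms by (auto simp: matrix_state_def)
  define \<rho> where "\<rho> = mat n n (\<lambda>(i, j). f (munit n j i))"
  have r: "\<rho> \<in> carrier_mat n n" by (simp add: \<rho>_def)
  have f: "f X = mtrace (\<rho> * X)" if "X \<in> carrier_mat n n" for X
    unfolding mtrace_mult[OF r that]
    by (subst sum.swap, subst linear_expansion[OF add smult that]) (simp_all add: \<rho>_def mult.commute)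
  have q: "Im (cnj x * x * f (munit n i i) + cnj x * y * f (munit n i j)
      + cnj y * x * f (munit n j i) + cnj y * y * f (munit n j j)) = 0"
    if ij: "i < n" "j < n" for i j x y
  proof -
    let ?X = "x \<cdot>\<^sub>m munit n i i + y \<cdot>\<^sub>m munit n i j"
    have a: "mat_adjoint ?X = cnj x \<cdot>\<^sub>m munit n i i + cnj y \<cdot>\<^sub>m munit n j i"
      using ij by (intro eq_matI) (auto simp: munit_def)
    have "mat_adjoint ?X * ?X = (cnj x * x) \<cdot>\<^sub>m munit n i i + (cnj x * y) \<cdot>\<^sub>m munit n i j
        + (cnj y * x) \<cdot>\<^sub>m munit n j i + (cnj y * y) \<cdot>\<^sub>m munit n j j"
      unfolding a using ij
      by (simp add: add_mult_distrib_mat[of _ n n _ _ n] mult_add_distrib_mat[of _ n n _ n]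
          munit_mult mult_smult_assoc_mat[of _ n n _ n] mult_smult_distrib[of _ n n _ n]
          assoc_add_mat[of _ n n])
        (intro eq_matI, auto simp: munit_def algebra_simps)
    then have "f (mat_adjoint ?X * ?X) = cnj x * x * f (munit n i i) + cnj x * y * f (munit n i j)
      + cnj y * x * f (munit n j i) + cnj y * y * f (munit n j j)"
      by (simp add: add smult)
    then show ?thesis using pos[of ?X] by simp
  qed
  \<comment> \<open>The coefficients \<open>(1, 0)\<close> and \<open>(0, 1)\<close> make the
    diagonal values real; then \<open>(1, 1)\<close> compares imaginary parts and
    \<open>(1, \<i>)\<close> compares real parts.\<close>
  have sym: "f (munit n i j) = cnj (f (munit n j i))" if "i < n" "j < n" for i j
    using q[OF that, of 1 1] q[OF that, of 1 0] q[OF that, of 0 1] q[OF that, of 1 \<i>]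
    by (auto simp: complex_eq_iff)
  have "mat_adjoint \<rho> = \<rho>"
    by (rule eq_matI) (auto simp: \<rho>_def sym[symmetric])
  with r f that show ?thesis by blast
qed

text \<open>The density is diagonalised and the state axioms are read off the spectrum: positivity
  yields \<open>0 \<le> \<kappa> l\<close>, normalisation yields total mass 1.\<close>

lemma matrix_state_diagonalize:
  assumes st: "matrix_state n f"
  obtains U and \<kappa> :: "nat \<Rightarrow> real" where "U \<in> carrier_mat n n"
    "mat_adjoint U * U = 1\<^sub>m n" "U * mat_adjoint U = 1\<^sub>m n"
    "\<And>X. X \<in> carrier_mat n n \<Longrightarrow> f (U * X * mat_adjoint U) = (\<Sum>l<n. of_real (\<kappa> l) * X $$ (l, l))"
    "\<And>l. l < n \<Longrightarrow> 0 \<le> \<kappa> l" "(\<Sum>l<n. \<kappa> l) = 1"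
    "state_entropy n f = - (\<Sum>l<n. eta (\<kappa> l))"
proof -
  from matrix_state_density[OF st] obtain \<rho> where r: "\<rho> \<in> carrier_mat n n" "mat_adjoint \<rho> = \<rho>"
    and f: "\<And>X. X \<in> carrier_mat n n \<Longrightarrow> f X = mtrace (\<rho> * X)" by blast
  from hermitian_spectral[OF r] obtain U and \<kappa> :: "nat \<Rightarrow> real" where U: "U \<in> carrier_mat n n"
    "mat_adjoint U * U = 1\<^sub>m n" "U * mat_adjoint U = 1\<^sub>m n"
    and D: "mat_adjoint U * \<rho> * U = mat n n (\<lambda>(i, j). if i = j then of_real (\<kappa> i) else 0)" (is "_ = ?D")
    and ent: "vN_entropy \<rho> = - (\<Sum>i<n. eta (\<kappa> i))" by blast
  have U': "mat_adjoint U \<in> carrier_mat n n" using U by simp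
  have fU: "f (U * X * mat_adjoint U) = (\<Sum>l<n. of_real (\<kappa> l) * X $$ (l, l))" if X: "X \<in> carrier_mat n n" for X
  proof -
    have "f (U * X * mat_adjoint U) = mtrace (\<rho> * U * X * mat_adjoint U)"
      using U U' X r by (simp add: f assoc_mult_mat[of _ n n _ n _ n])
    also have "\<dots> = mtrace (mat_adjoint U * (\<rho> * U * X))"
      using U U' X r by (intro mtrace_comm[of _ n n]) auto
    also have "mat_adjoint U * (\<rho> * U * X) = ?D * X"
      using U U' X r by (simp add: D[symmetric] assoc_mult_mat[of _ n n _ n _ n])
    also have "mtrace (?D * X) = (\<Sum>i<n. \<Sum>l<n. if l = i then of_real (\<kappa> i) * X $$ (i, i) else 0)"
      by (subst mtrace_mult[OF _ X], simp, intro sum.cong refl) auto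
    finally show ?thesis by simp
  qed
  have k0: "0 \<le> \<kappa> l" if l: "l < n" for l
  proof -
    \<comment> \<open>\<open>mat_adjoint ?Y * ?Y\<close> is the projection onto the
      \<open>l\<close>-th eigenvector, whose expectation is \<open>\<kappa> l\<close>.\<close>
    let ?Y = "munit n l l * mat_adjoint U"
    have Y: "?Y \<in> carrier_mat n n" by (rule mult_carrier_mat[OF munit_carrier U'])
    have "mat_adjoint ?Y = U * munit n l l"
      using mat_adjoint_mult[OF munit_carrier U', of l l] l by (simp add: munit_adjoint)
    then have "mat_adjoint ?Y * ?Y = U * (munit n l l * munit n l l) * mat_adjoint U"
      using U U' by (simp add: assoc_mult_mat[of _ n n _ n _ n])
    then have "f (mat_adjoint ?Y * ?Y) = (\<Sum>a<n. of_real (\<kappa> a) * munit n l l $$ (a, a))"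
      using l by (simp add: fU munit_mult)
    also have "\<dots> = (\<Sum>a<n. if a = l then of_real (\<kappa> a) else 0)"
      by (intro sum.cong) (auto simp: munit_def)
    also have "\<dots> = of_real (\<kappa> l)" using l by simp
    finally show ?thesis using st Y by (auto simp: matrix_state_def)
  qed
  have "complex_of_real (\<Sum>l<n. \<kappa> l) = (\<Sum>l<n. of_real (\<kappa> l) * 1\<^sub>m n $$ (l, l))" by simp
  also have "\<dots> = f (U * 1\<^sub>m n * mat_adjoint U)" by (rule fU[symmetric]) simp
  also have "\<dots> = of_real 1" using st U by (simp add: matrix_state_def)
  finally have k1: "(\<Sum>l<n. \<kappa> l) = 1" using of_real_eq_iff by blast
  have "state_entropy n f = vN_entropy \<rho>"
    unfolding state_entropy_def by (simp add: density_eqI[OF r(1) f])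
  with that[OF U fU k0 k1] ent show ?thesis by simp
qed

lemma matrix_state_hom:
  assumes st: "matrix_state q f"
    and carr: "\<And>X. X \<in> carrier_mat p p \<Longrightarrow> \<phi> X \<in> carrier_mat q q"
    and add: "\<And>X Y. X \<in> carrier_mat p p \<Longrightarrow> Y \<in> carrier_mat p p \<Longrightarrow> \<phi> (X + Y) = \<phi> X + \<phi> Y"
    and smult: "\<And>c X. X \<in> carrier_mat p p \<Longrightarrow> \<phi> (c \<cdot>\<^sub>m X) = c \<cdot>\<^sub>m \<phi> X"
    and mult: "\<And>X Y. X \<in> carrier_mat p p \<Longrightarrow> Y \<in> carrier_mat p p \<Longrightarrow> \<phi> (X * Y) = \<phi> X * \<phi> Y"
    and star: "\<And>X. X \<in> carrier_mat p p \<Longrightarrow> \<phi> (mat_adjoint X) = mat_adjoint (\<phi> X)"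
    and one: "\<phi> (1\<^sub>m p) = 1\<^sub>m q"
  shows "matrix_state p (\<lambda>X. f (\<phi> X))"
  using st carr unfolding matrix_state_def by (auto simp: add smult mult star one)

text \<open>Rotating by \<open>U\<close> and \<open>V\<close> diagonalises both states at once:
  \<open>\<theta>\<close> sends the matrix units of an eigenbasis of the pulled-back state to
  matrices written in an eigenbasis of \<open>f\<close>, which is the setting of
  \<open>matrix_units_entropy\<close>.\<close>

lemma entropy_unital_hom:
  assumes st: "matrix_state q f"
    and q: "q = p * D" and p: "p > 0" and D: "D > 0"
    and carr: "\<And>X. X \<in> carrier_mat p p \<Longrightarrow> \<phi> X \<in> carrier_mat q q"
    and add: "\<And>X Y. X \<in> carrier_mat p p \<Longrightarrow> Y \<in> carrier_mat p p \<Longrightarrow> \<phi> (X + Y) = \<phi> X + \<phi> Y"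
    and smult: "\<And>c X. X \<in> carrier_mat p p \<Longrightarrow> \<phi> (c \<cdot>\<^sub>m X) = c \<cdot>\<^sub>m \<phi> X"
    and mult: "\<And>X Y. X \<in> carrier_mat p p \<Longrightarrow> Y \<in> carrier_mat p p \<Longrightarrow> \<phi> (X * Y) = \<phi> X * \<phi> Y"
    and star: "\<And>X. X \<in> carrier_mat p p \<Longrightarrow> \<phi> (mat_adjoint X) = mat_adjoint (\<phi> X)"
    and one: "\<phi> (1\<^sub>m p) = 1\<^sub>m q"
  shows "\<bar>state_entropy p (\<lambda>X. f (\<phi> X)) - state_entropy q f\<bar> \<le> log 2 (real D)"
proof -
  from matrix_state_diagonalize[OF st] obtain U and \<kappa> :: "nat \<Rightarrow> real" where U: "U \<in> carrier_mat q q"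
    "mat_adjoint U * U = 1\<^sub>m q" "U * mat_adjoint U = 1\<^sub>m q"
    and fU: "\<And>X. X \<in> carrier_mat q q \<Longrightarrow> f (U * X * mat_adjoint U) = (\<Sum>l<q. of_real (\<kappa> l) * X $$ (l, l))"
    and k: "\<And>l. l < q \<Longrightarrow> 0 \<le> \<kappa> l" "(\<Sum>l<q. \<kappa> l) = 1"
    and ek: "state_entropy q f = - (\<Sum>l<q. eta (\<kappa> l))" by blast
  have stp: "matrix_state p (\<lambda>X. f (\<phi> X))"
    by (rule matrix_state_hom[where \<phi> = \<phi>, OF st carr add smult mult star one])
  obtain V and \<mu> :: "nat \<Rightarrow> real" where V: "V \<in> carrier_mat p p"
    "mat_adjoint V * V = 1\<^sub>m p" "V * mat_adjoint V = 1\<^sub>m p"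
    and fV: "\<And>X. X \<in> carrier_mat p p \<Longrightarrow> f (\<phi> (V * X * mat_adjoint V)) = (\<Sum>l<p. of_real (\<mu> l) * X $$ (l, l))"
    and "\<And>l. l < p \<Longrightarrow> 0 \<le> \<mu> l" "(\<Sum>l<p. \<mu> l) = 1"
    and em: "state_entropy p (\<lambda>X. f (\<phi> X)) = - (\<Sum>l<p. eta (\<mu> l))"
    by (rule matrix_state_diagonalize[OF stp], rule that)
  have U': "mat_adjoint U \<in> carrier_mat q q" and V': "mat_adjoint V \<in> carrier_mat p p" using U V by auto
  define \<theta> where "\<theta> X = mat_adjoint U * \<phi> (V * X * mat_adjoint V) * U" for X
  have cV: "V * X * mat_adjoint V \<in> carrier_mat p p" if "X \<in> carrier_mat p p" for X using V V' that by auto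
  have tc: "\<theta> X \<in> carrier_mat q q" if "X \<in> carrier_mat p p" for X
    unfolding \<theta>_def using U U' carr[OF cV[OF that]] by auto
  have tadd: "\<theta> (X + Y) = \<theta> X + \<theta> Y" if "X \<in> carrier_mat p p" "Y \<in> carrier_mat p p" for X Y
  proof -
    have "V * (X + Y) * mat_adjoint V = V * X * mat_adjoint V + V * Y * mat_adjoint V"
      using V V' that by (simp add: mult_add_distrib_mat[of _ p p _ p] add_mult_distrib_mat[of _ p p _ _ p])
    then show ?thesis using that cV carr U U'
      by (simp add: \<theta>_def add mult_add_distrib_mat[of _ q q _ q] add_mult_distrib_mat[of _ q q _ _ q])
  qed
  have tsmult: "\<theta> (c \<cdot>\<^sub>m X) = c \<cdot>\<^sub>m \<theta> X" if "X \<in> carrier_mat p p" for X c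
  proof -
    have "V * (c \<cdot>\<^sub>m X) * mat_adjoint V = c \<cdot>\<^sub>m (V * X * mat_adjoint V)"
      using V V' that by (simp add: mult_smult_assoc_mat[of _ p p _ p] mult_smult_distrib[of _ p p _ p])
    then show ?thesis using that cV[OF that] carr[OF cV[OF that]] U U'
      by (simp add: \<theta>_def smult mult_smult_assoc_mat[of _ q q _ q] mult_smult_distrib[of _ q q _ q])
  qed
  have tmult: "\<theta> (X * Y) = \<theta> X * \<theta> Y" if XY: "X \<in> carrier_mat p p" "Y \<in> carrier_mat p p" for X Y
  proof -
    have "V * (X * Y) * mat_adjoint V = V * X * (mat_adjoint V * V) * Y * mat_adjoint V"
      using V XY by (simp add: assoc_mult_mat[of _ p p _ p _ p])
    also have "\<dots> = (V * X * mat_adjoint V) * (V * Y * mat_adjoint V)"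
      using V(1) V' XY by (simp add: assoc_mult_mat[of _ p p _ p _ p])
    finally have "\<phi> (V * (X * Y) * mat_adjoint V) = \<phi> (V * X * mat_adjoint V) * \<phi> (V * Y * mat_adjoint V)"
      using XY cV by (simp add: mult)
    \<comment> \<open>Inserting \<open>U * mat_adjoint U = 1\<close> splits the product into two
      conjugates.\<close>
    also have "\<dots> = \<phi> (V * X * mat_adjoint V) * (U * mat_adjoint U) * \<phi> (V * Y * mat_adjoint V)"
      using U carr[OF cV[OF XY(1)]] by simp
    finally show ?thesis unfolding \<theta>_def
      using U(1) U' carr[OF cV[OF XY(1)]] carr[OF cV[OF XY(2)]]
      by (simp add: assoc_mult_mat[of _ q q _ q _ q])
  qed
  have tstar: "\<theta> (mat_adjoint X) = mat_adjoint (\<theta> X)" if X: "X \<in> carrier_mat p p" for X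
  proof -
    have "mat_adjoint (V * X * mat_adjoint V) = V * mat_adjoint X * mat_adjoint V"
      using V V' X by (simp add: mat_adjoint_mult[of _ p p _ p] assoc_mult_mat[of _ p p _ p _ p])
    then have "\<phi> (V * mat_adjoint X * mat_adjoint V) = mat_adjoint (\<phi> (V * X * mat_adjoint V))"
      using star[OF cV[OF X]] by simp
    then show ?thesis unfolding \<theta>_def using U U' carr[OF cV[OF X]]
      by (simp add: mat_adjoint_mult[of _ q q _ q] assoc_mult_mat[of _ q q _ q _ q])
  qed
  have tone: "\<theta> (1\<^sub>m p) = 1\<^sub>m q"
    unfolding \<theta>_def using V U U' by (simp add: one)
  have tzero: "\<theta> (0\<^sub>m p p) = 0\<^sub>m q q"
  proof -
    have "0\<^sub>m p p = 0 \<cdot>\<^sub>m (0\<^sub>m p p :: complex mat)" by auto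
    then have "\<theta> (0\<^sub>m p p) = 0 \<cdot>\<^sub>m \<theta> (0\<^sub>m p p)" using tsmult[of "0\<^sub>m p p" 0] by simp
    also have "\<dots> = 0\<^sub>m q q" using tc[of "0\<^sub>m p p"] by (intro eq_matI) auto
    finally show ?thesis .
  qed
  define G where "G i j a b = \<theta> (munit p i j) $$ (a, b)" for i j a b
  have "\<bar>(\<Sum>l<q. eta (\<kappa> l)) - (\<Sum>i<p. eta (\<mu> i))\<bar> \<le> log 2 (real D)"
  proof (rule matrix_units_entropy[OF p D q k, where G = G])
    fix i j k m a b assume ij: "i < p" "j < p" "k < p" "m < p" and ab: "a < q" "b < q"
    have "(\<Sum>c<q. G i j a c * G k m c b) = (\<theta> (munit p i j) * \<theta> (munit p k m)) $$ (a, b)"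
      unfolding G_def using ab by (intro mult_mat_index[symmetric]) (auto simp: tc)
    also have "\<dots> = \<theta> (munit p i j * munit p k m) $$ (a, b)" by (simp add: tmult)
    finally show "(\<Sum>c<q. G i j a c * G k m c b) = (if j = k then G i m a b else 0)"
      using ij ab by (simp add: munit_mult tzero G_def)
  next
    fix i j a b assume ij: "i < p" "j < p" and ab: "a < q" "b < q"
    show "cnj (G i j a b) = G j i b a"
      using ij ab tc[OF munit_carrier, of i j] tstar[OF munit_carrier, of i j]
      by (simp add: G_def munit_adjoint)
  next
    fix a b assume ab: "a < q" "b < q"
    \<comment> \<open>Partial sums of the diagonal units; additivity of \<open>\<theta>\<close>
      carries the induction up to \<open>I p\<close>, the identity.\<close>
    define I where "I k = mat p p (\<lambda>(a, b). if a = b \<and> a < k then 1 else 0 :: complex)" for k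
    have "(\<Sum>i<k. G i i a b) = \<theta> (I k) $$ (a, b)" if "k \<le> p" for k
      using that
    proof (induction k)
      case 0
      have "I 0 = 0\<^sub>m p p" by (rule eq_matI) (auto simp: I_def)
      then show ?case using ab by (simp add: tzero)
    next
      case (Suc k)
      have "I (Suc k) = I k + munit p k k" by (rule eq_matI) (auto simp: I_def munit_def)
      moreover have "I k \<in> carrier_mat p p" by (simp add: I_def)
      ultimately have "\<theta> (I (Suc k)) = \<theta> (I k) + \<theta> (munit p k k)" by (simp add: tadd)
      then show ?case using Suc ab tc[OF munit_carrier, of k k] by (simp add: G_def)
    qed
    moreover have "I p = 1\<^sub>m p" by (rule eq_matI) (auto simp: I_def)
    ultimately show "(\<Sum>i<p. G i i a b) = (if a = b then 1 else 0)"
      using ab by (simp add: tone)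
  next
    fix i j assume ij: "i < p" "j < p"
    let ?Y = "\<phi> (V * munit p i j * mat_adjoint V)"
    have Y: "?Y \<in> carrier_mat q q" by (intro carr cV) simp
    have "(\<Sum>l<q. of_real (\<kappa> l) * G i j l l) = f (U * \<theta> (munit p i j) * mat_adjoint U)"
      unfolding G_def by (rule fU[symmetric]) (simp add: tc)
    \<comment> \<open>Undoing the rotation by \<open>U\<close> leaves the image of a matrix unit in
      the eigenbasis of the small state, where \<open>fV\<close> is diagonal.\<close>
    also have "U * \<theta> (munit p i j) * mat_adjoint U = (U * mat_adjoint U) * ?Y * (U * mat_adjoint U)"
      unfolding \<theta>_def using U(1) U' Y by (simp add: assoc_mult_mat[of _ q q _ q _ q])
    also have "\<dots> = ?Y" using U Y by simp
    also have "f ?Y = (\<Sum>l<p. of_real (\<mu> l) * munit p i j $$ (l, l))" by (rule fV) simp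
    also have "\<dots> = (\<Sum>l<p. if l = i then if i = j then of_real (\<mu> i) else 0 else 0)"
      by (intro sum.cong) (auto simp: munit_def)
    finally show "(\<Sum>l<q. of_real (\<kappa> l) * G i j l l) = (if i = j then of_real (\<mu> i) else 0)"
      using ij by simp
  qed
  then show ?thesis by (simp add: ek em)
qed

section \<open>Operator norm and amplifications\<close>

lemma cvnorm_L2: "cvnorm v = L2_set (\<lambda>i. cmod (v $ i)) {..<dim_vec v}"
  by (simp add: cvnorm_def L2_set_def)

lemma cvnorm_nonneg [simp]: "0 \<le> cvnorm v"
  by (simp add: cvnorm_L2 L2_set_nonneg)

lemma cvnorm_power2: "(cvnorm v)\<^sup>2 = (\<Sum>i<dim_vec v. (cmod (v $ i))\<^sup>2)"
  by (simp add: cvnorm_def sum_nonneg)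

lemma cvnorm_smult: "cvnorm (c \<cdot>\<^sub>v v) = cmod c * cvnorm v"
  by (auto simp: cvnorm_L2 norm_mult L2_set_right_distrib intro!: L2_set_cong)

lemma cvnorm_triangle:
  assumes "v \<in> carrier_vec n" "w \<in> carrier_vec n"
  shows "cvnorm (v + w) \<le> cvnorm v + cvnorm w"
proof -
  have "cvnorm (v + w) \<le> L2_set (\<lambda>i. cmod (v $ i) + cmod (w $ i)) {..<n}"
    unfolding cvnorm_L2 using assms by (auto intro!: L2_set_mono norm_triangle_ineq)
  also have "\<dots> \<le> cvnorm v + cvnorm w"
    unfolding cvnorm_L2 using assms by (auto intro: L2_set_triangle_ineq)
  finally show ?thesis .
qed

lemma norm_index_le_cvnorm: "i < dim_vec v \<Longrightarrow> cmod (v $ i) \<le> cvnorm v"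
  unfolding cvnorm_L2 by (rule member_le_L2_set) auto

lemma cvnorm_unit_vec: "i < n \<Longrightarrow> cvnorm (unit_vec n i) = 1"
proof -
  assume "i < n"
  then have "(\<Sum>k<n. (cmod (unit_vec n i $ k))\<^sup>2) = (\<Sum>k<n. if k = i then 1 else 0)"
    by (intro sum.cong) auto
  then show ?thesis using \<open>i < n\<close> by (simp add: cvnorm_def)
qed

lemma mult_mat_vec_index:
  "A \<in> carrier_mat n m \<Longrightarrow> v \<in> carrier_vec m \<Longrightarrow> i < n \<Longrightarrow> (A *\<^sub>v v) $ i = (\<Sum>j<m. A $$ (i, j) * v $ j)"
  by (auto simp: scalar_prod_def atLeast0LessThan intro!: sum.cong)

text \<open>\<open>Sup\<close> on the reals says nothing useful about an unbounded set, so a bound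
  must precede any use of \<open>opnorm\<close>; the sum of the moduli of all entries is crude but
  enough.\<close>

lemma opnorm_set_bdd: "bdd_above {cvnorm (A *\<^sub>v v) | v. v \<in> carrier_vec (dim_col A) \<and> cvnorm v \<le> 1}"
proof (rule bdd_aboveI[of _ "\<Sum>i<dim_row A. \<Sum>j<dim_col A. cmod (A $$ (i, j))"], clarify)
  fix v assume v: "v \<in> carrier_vec (dim_col A)" "cvnorm v \<le> 1"
  have A: "A \<in> carrier_mat (dim_row A) (dim_col A)" by auto
  have "cvnorm (A *\<^sub>v v) \<le> (\<Sum>i<dim_row A. cmod ((A *\<^sub>v v) $ i))"
    unfolding cvnorm_L2 dim_mult_mat_vec by (rule L2_set_le_sum) auto
  also have "\<dots> \<le> (\<Sum>i<dim_row A. \<Sum>j<dim_col A. cmod (A $$ (i, j)))"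
  proof (rule sum_mono)
    fix i assume "i \<in> {..<dim_row A}"
    then have "cmod ((A *\<^sub>v v) $ i) \<le> (\<Sum>j<dim_col A. cmod (A $$ (i, j) * v $ j))"
      by (auto simp: mult_mat_vec_index[OF A v(1)] simp del: index_mult_mat_vec intro: norm_sum)
    also have "\<dots> \<le> (\<Sum>j<dim_col A. cmod (A $$ (i, j)))"
    proof (rule sum_mono)
      fix j assume "j \<in> {..<dim_col A}"
      then have "cmod (v $ j) \<le> 1" using norm_index_le_cvnorm[of j v] v by auto
      then show "cmod (A $$ (i, j) * v $ j) \<le> cmod (A $$ (i, j))"
        by (simp add: norm_mult mult_left_le)
    qed
    finally show "cmod ((A *\<^sub>v v) $ i) \<le> (\<Sum>j<dim_col A. cmod (A $$ (i, j)))" .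
  qed
  finally show "cvnorm (A *\<^sub>v v) \<le> (\<Sum>i<dim_row A. \<Sum>j<dim_col A. cmod (A $$ (i, j)))" .
qed

lemma cvnorm_zero [simp]: "cvnorm (0\<^sub>v n) = 0"
  by (simp add: cvnorm_def)

lemma cvnorm_eq_0: "v \<in> carrier_vec n \<Longrightarrow> cvnorm v = 0 \<Longrightarrow> v = 0\<^sub>v n"
  using norm_index_le_cvnorm[of _ v] by (intro eq_vecI) force+

lemma mult_mat_zero_vec: "A \<in> carrier_mat n m \<Longrightarrow> A *\<^sub>v 0\<^sub>v m = (0\<^sub>v n :: complex vec)"
  by (intro eq_vecI) auto

lemma opnorm_nonneg [simp]: "0 \<le> opnorm A"
  unfolding opnorm_def
proof (rule cSup_upper2[OF _ _ opnorm_set_bdd])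
  show "cvnorm (A *\<^sub>v 0\<^sub>v (dim_col A)) \<in> {cvnorm (A *\<^sub>v v) | v. v \<in> carrier_vec (dim_col A) \<and> cvnorm v \<le> 1}"
    by (auto intro!: exI[of _ "0\<^sub>v (dim_col A)"])
qed simp

lemma opnorm_bound:
  assumes A: "A \<in> carrier_mat n m" and v: "v \<in> carrier_vec m"
  shows "cvnorm (A *\<^sub>v v) \<le> opnorm A * cvnorm v"
proof (cases "cvnorm v = 0")
  case True
  then show ?thesis using cvnorm_eq_0[OF v] mult_mat_zero_vec[OF A] by simp
next
  case False
  let ?c = "complex_of_real (1 / cvnorm v)"
  have c: "cmod ?c = 1 / cvnorm v" by (simp add: norm_divide)
  have "cvnorm (A *\<^sub>v (?c \<cdot>\<^sub>v v)) \<le> opnorm A"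
    unfolding opnorm_def
    using A v False by (intro cSup_upper[OF _ opnorm_set_bdd]) (auto simp: cvnorm_smult c simp del: of_real_divide intro!: exI[of _ "?c \<cdot>\<^sub>v v"])
  also have "A *\<^sub>v (?c \<cdot>\<^sub>v v) = ?c \<cdot>\<^sub>v (A *\<^sub>v v)" using A v by (rule mult_mat_vec)
  finally show ?thesis using False unfolding cvnorm_smult c by (simp add: field_simps less_le)
qed

lemma opnorm_le:
  assumes A: "A \<in> carrier_mat n m" and c: "0 \<le> c"
    and b: "\<And>v. v \<in> carrier_vec m \<Longrightarrow> cvnorm (A *\<^sub>v v) \<le> c * cvnorm v"
  shows "opnorm A \<le> c"
  unfolding opnorm_def
proof (rule cSup_least)
  have "0\<^sub>v (dim_col A) \<in> carrier_vec (dim_col A) \<and> cvnorm (0\<^sub>v (dim_col A)) \<le> 1" by simp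
  then show "{cvnorm (A *\<^sub>v v) |v. v \<in> carrier_vec (dim_col A) \<and> cvnorm v \<le> 1} \<noteq> {}" by blast
  fix x assume "x \<in> {cvnorm (A *\<^sub>v v) |v. v \<in> carrier_vec (dim_col A) \<and> cvnorm v \<le> 1}"
  then obtain v where v: "x = cvnorm (A *\<^sub>v v)" "v \<in> carrier_vec m" "cvnorm v \<le> 1" using A by auto
  then have "x \<le> c * cvnorm v" using b by simp
  also have "\<dots> \<le> c" using v(3) c by (simp add: mult_left_le)
  finally show "x \<le> c" .
qed

lemma opnorm_zero [simp]: "opnorm (0\<^sub>m n m) = 0"
proof -
  have "0\<^sub>m n m *\<^sub>v v = 0\<^sub>v n" if "v \<in> carrier_vec m" for v :: "complex vec"
    using that by (intro eq_vecI) (auto simp: scalar_prod_def)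
  then have "opnorm (0\<^sub>m n m) \<le> 0" by (intro opnorm_le[of _ n m]) auto
  then show ?thesis using opnorm_nonneg[of "0\<^sub>m n m"] by linarith
qed

lemma opnorm_add:
  assumes A: "A \<in> carrier_mat n m" and B: "B \<in> carrier_mat n m"
  shows "opnorm (A + B) \<le> opnorm A + opnorm B"
proof (rule opnorm_le[of _ n m])
  fix v :: "complex vec" assume v: "v \<in> carrier_vec m"
  have "cvnorm ((A + B) *\<^sub>v v) \<le> cvnorm (A *\<^sub>v v) + cvnorm (B *\<^sub>v v)"
    unfolding add_mult_distrib_mat_vec[OF A B v] using A B v by (intro cvnorm_triangle[of _ n]) auto
  then show "cvnorm ((A + B) *\<^sub>v v) \<le> (opnorm A + opnorm B) * cvnorm v"
    using opnorm_bound[OF A v] opnorm_bound[OF B v] by (simp add: distrib_right)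
qed (use A B in auto)

lemma opnorm_mult:
  assumes A: "A \<in> carrier_mat n m" and B: "B \<in> carrier_mat m k"
  shows "opnorm (A * B) \<le> opnorm A * opnorm B"
proof (rule opnorm_le[of _ n k])
  fix v :: "complex vec" assume v: "v \<in> carrier_vec k"
  have "cvnorm (A *\<^sub>v (B *\<^sub>v v)) \<le> opnorm A * cvnorm (B *\<^sub>v v)"
    using B v by (intro opnorm_bound[OF A]) auto
  also have "\<dots> \<le> opnorm A * (opnorm B * cvnorm v)" by (intro mult_left_mono opnorm_bound[OF B v]) auto
  finally show "cvnorm (A * B *\<^sub>v v) \<le> opnorm A * opnorm B * cvnorm v"
    using A B v by (simp add: mult.assoc)
qed (use A B in auto)

lemma opnorm_smult:
  assumes A: "A \<in> carrier_mat n m"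
  shows "opnorm (c \<cdot>\<^sub>m A) \<le> cmod c * opnorm A"
proof (rule opnorm_le[of _ n m])
  fix v :: "complex vec" assume v: "v \<in> carrier_vec m"
  have "(c \<cdot>\<^sub>m A) *\<^sub>v v = c \<cdot>\<^sub>v (A *\<^sub>v v)" using A v by (intro eq_vecI) (auto simp: smult_scalar_prod_distrib[of _ m])
  then show "cvnorm (c \<cdot>\<^sub>m A *\<^sub>v v) \<le> cmod c * opnorm A * cvnorm v"
    using opnorm_bound[OF A v] by (simp add: cvnorm_smult mult.assoc mult_left_mono)
qed (use A in auto)

lemma opnorm_minus_commute:
  assumes A: "A \<in> carrier_mat n m" and B: "B \<in> carrier_mat n m"
  shows "opnorm (A - B) = opnorm (B - A)"
proof -
  have *: "opnorm (A - B) \<le> opnorm (B - A)" if "A \<in> carrier_mat n m" "B \<in> carrier_mat n m" for A B :: "complex mat"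
  proof -
    have "A - B = (- 1) \<cdot>\<^sub>m (B - A)" using that by (intro eq_matI) auto
    then show ?thesis using opnorm_smult[OF minus_carrier_mat[OF that(1), of B], of "- 1"] by simp
  qed
  show ?thesis using *[OF A B] *[OF B A] by linarith
qed

lemma opnorm_triangle:
  assumes "A \<in> carrier_mat n m" "B \<in> carrier_mat n m" "C \<in> carrier_mat n m"
  shows "opnorm (A - C) \<le> opnorm (A - B) + opnorm (B - C)"
proof -
  have "A - C = (A - B) + (B - C)" using assms by (intro eq_matI) auto
  then show ?thesis using opnorm_add[OF minus_carrier_mat[OF assms(2), of A] minus_carrier_mat[OF assms(3), of B]] by simp
qed

text \<open>Turns norm statements into entrywise ones: this recovers a local matrix from its class
  under \<open>qeq\<close> and bounds functionals that are finite sums of entries.\<close>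

lemma opnorm_index_le:
  assumes A: "A \<in> carrier_mat n m" and ij: "i < n" "j < m"
  shows "cmod (A $$ (i, j)) \<le> opnorm A"
proof -
  have "A $$ (i, j) = (A *\<^sub>v unit_vec m j) $ i" using A ij by simp
  also have "cmod \<dots> \<le> cvnorm (A *\<^sub>v unit_vec m j)" using A ij by (intro norm_index_le_cvnorm) auto
  also have "\<dots> \<le> opnorm A" using opnorm_bound[OF A, of "unit_vec m j"] ij by (simp add: cvnorm_unit_vec)
  finally show ?thesis .
qed

text \<open>For \<open>w = mat_adjoint A *\<^sub>v v\<close>, the squared norm of \<open>w\<close>
  is the inner product of \<open>A *\<^sub>v w\<close> and \<open>v\<close>. Cauchy-Schwarz bounds
  it, and a factor \<open>cvnorm w\<close> cancels unless it is zero.\<close>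

lemma opnorm_adjoint_le:
  assumes A: "A \<in> carrier_mat n m"
  shows "opnorm (mat_adjoint A) \<le> opnorm A"
proof (rule opnorm_le[of _ m n])
  have A': "mat_adjoint A \<in> carrier_mat m n" using A by simp
  fix v :: "complex vec" assume v: "v \<in> carrier_vec n"
  define w where "w = mat_adjoint A *\<^sub>v v"
  have w: "w \<in> carrier_vec m" using A v by (auto simp: w_def)
  have "complex_of_real ((cvnorm w)\<^sup>2) = (\<Sum>i<m. w $ i * cnj (w $ i))"
    unfolding cvnorm_power2 of_real_sum complex_norm_square using w by simp
  also have "\<dots> = (\<Sum>i<m. \<Sum>j<n. w $ i * (A $$ (j, i) * cnj (v $ j)))"
    using A v by (intro sum.cong refl, subst (2) w_def)
      (simp add: mult_mat_vec_index[OF A' v] sum_distrib_left del: index_mult_mat_vec)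
  also have "\<dots> = (\<Sum>j<n. (A *\<^sub>v w) $ j * cnj (v $ j))"
    using A w by (subst sum.swap) (auto simp: mult_mat_vec_index[OF A w] sum_distrib_left sum_distrib_right mult_ac simp del: index_mult_mat_vec intro!: sum.cong)
  finally have "(cvnorm w)\<^sup>2 = cmod (\<Sum>j<n. (A *\<^sub>v w) $ j * cnj (v $ j))"
    by (metis abs_of_nonneg norm_of_real zero_le_power2)
  also have "\<dots> \<le> (\<Sum>j<n. \<bar>cmod ((A *\<^sub>v w) $ j)\<bar> * \<bar>cmod (v $ j)\<bar>)"
    by (rule order.trans[OF norm_sum]) (simp add: norm_mult)
  also have "\<dots> \<le> cvnorm (A *\<^sub>v w) * cvnorm v"
    unfolding cvnorm_L2 using A v by (intro order.trans[OF L2_set_mult_ineq]) auto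
  also have "\<dots> \<le> (opnorm A * cvnorm w) * cvnorm v" by (intro mult_right_mono opnorm_bound[OF A w]) auto
  finally have "cvnorm w * cvnorm w \<le> cvnorm w * (opnorm A * cvnorm v)" by (simp add: power2_eq_square mult_ac)
  then show "cvnorm (mat_adjoint A *\<^sub>v v) \<le> opnorm A * cvnorm v"
    unfolding w_def[symmetric] using cvnorm_nonneg[of w] 
    by (cases "cvnorm w = 0") (auto simp: less_le)
qed (use A in auto)

text \<open>For \<open>X\<close> of size \<open>n\<close>, an index of \<open>amp a b X\<close> is written \<open>(i * n + t) * b + r\<close> with
  \<open>i < a\<close>, \<open>t < n\<close>, \<open>r < b\<close>.\<close>

definition amp :: "nat \<Rightarrow> nat \<Rightarrow> complex mat \<Rightarrow> complex mat" where
  "amp a b X = kron (kron (1\<^sub>m a) X) (1\<^sub>m b)"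

lemma amp_carrier [simp]: "X \<in> carrier_mat n n \<Longrightarrow> amp a b X \<in> carrier_mat (a * n * b) (a * n * b)"
  by (auto simp: amp_def kron_def)

lemma amp_dim [simp]: "dim_row (amp a b X) = a * dim_row X * b" "dim_col (amp a b X) = a * dim_col X * b"
  by (auto simp: amp_def kron_def)

section \<open>Mixed-radix indices and the entries of amplifications\<close>

lemma digits2_less:
  fixes i r :: nat
  assumes "i < a" "r < b" shows "i * b + r < a * b"
proof -
  have "i * b + r < Suc i * b" using assms by simp
  also have "\<dots> \<le> a * b" using assms by (intro mult_right_mono) auto
  finally show ?thesis .
qed

lemma digits_less:
  fixes i t r :: nat
  assumes "i < a" "t < n" "r < b" shows "(i * n + t) * b + r < a * n * b"
  using assms by (intro digits2_less)

lemma digits_exist: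
  fixes x :: nat
  assumes "x < a * n * b"
  obtains i t r where "i < a" "t < n" "r < b" "x = (i * n + t) * b + r"
proof -
  have "n > 0" "b > 0" using assms by (auto intro!: Nat.gr0I)
  moreover have "x div b < a * n" using assms by (simp add: less_mult_imp_div_less)
  moreover then have "x div b div n < a" by (simp add: less_mult_imp_div_less)
  ultimately show ?thesis
    using that[of "x div b div n" "x div b mod n" "x mod b"] by simp
qed

lemma amp_index:
  assumes X: "X \<in> carrier_mat n n" and "i < a" "t < n" "r < b" "i' < a" "t' < n" "r' < b"
  shows "amp a b X $$ ((i * n + t) * b + r, (i' * n + t') * b + r') = (if i = i' \<and> r = r' then X $$ (t, t') else 0)"
proof -
  have "i * n + t < a * n" "i' * n + t' < a * n" using assms by (auto intro: digits2_less)
  moreover have "(i * n + t) * b + r < a * n * b" "(i' * n + t') * b + r' < a * n * b"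
    using assms by (auto intro: digits_less)
  ultimately show ?thesis using assms by (auto simp: amp_def kron_def)
qed

text \<open>Every index has a digit form, so comparing entries in that form suffices; the algebraic
  laws of \<open>amp\<close> below are all obtained this way.\<close>

lemma amp_eqI:
  assumes M: "M \<in> carrier_mat (a * n * b) (a * n * b)" and X: "X \<in> carrier_mat n n"
    and "\<And>i t r i' t' r'. i < a \<Longrightarrow> t < n \<Longrightarrow> r < b \<Longrightarrow> i' < a \<Longrightarrow> t' < n \<Longrightarrow> r' < b \<Longrightarrow>
      M $$ ((i * n + t) * b + r, (i' * n + t') * b + r') = (if i = i' \<and> r = r' then X $$ (t, t') else 0)"
  shows "M = amp a b X"
proof (rule eq_matI)
  fix x y assume "x < dim_row (amp a b X)" "y < dim_col (amp a b X)"
  then have "x < a * n * b" "y < a * n * b" using X by auto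
  then show "M $$ (x, y) = amp a b X $$ (x, y)"
    by (elim digits_exist) (simp add: amp_index[OF X] assms(3))
qed (use M amp_carrier[OF X, of a b] in auto)

lemma sum_digits2: "(\<Sum>x<a * b. f x) = (\<Sum>i<a. \<Sum>r<b. f (i * b + r))" for a b :: nat
proof -
  have "sum f {i * b..<i * b + b} = (\<Sum>r<b. f (i * b + r))" for i
    by (subst sum.atLeastLessThan_shift_0) (simp add: atLeast0LessThan)
  then show ?thesis by (simp add: sum.nat_group[symmetric])
qed

lemma sum_digits: "(\<Sum>x<a * n * b. f x) = (\<Sum>i<a. \<Sum>t<n. \<Sum>r<b. f ((i * n + t) * b + r))" for a b n :: nat
  by (simp add: sum_digits2)

lemma amp_add:
  assumes "X \<in> carrier_mat n n" "Y \<in> carrier_mat n n"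
  shows "amp a b (X + Y) = amp a b X + amp a b Y"
  by (rule amp_eqI[where n = n, symmetric])
    (use assms amp_carrier[OF assms(1), of a b] amp_carrier[OF assms(2), of a b] digits_less in \<open>auto simp: amp_index\<close>)

lemma amp_smult:
  assumes "X \<in> carrier_mat n n"
  shows "amp a b (c \<cdot>\<^sub>m X) = c \<cdot>\<^sub>m amp a b X"
  by (rule amp_eqI[where n = n, symmetric])
    (use assms amp_carrier[OF assms(1), of a b] digits_less in \<open>auto simp: amp_index\<close>)

lemma amp_adjoint:
  assumes "X \<in> carrier_mat n n"
  shows "amp a b (mat_adjoint X) = mat_adjoint (amp a b X)"
  by (rule amp_eqI[where n = n, symmetric])
    (use assms amp_carrier[OF assms(1), of a b] digits_less in \<open>auto simp: amp_index\<close>)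

lemma amp_one: "amp a b (1\<^sub>m n) = 1\<^sub>m (a * n * b)"
proof (rule amp_eqI[where n = n, symmetric])
  fix i t r i' t' r' :: nat assume h: "i < a" "t < n" "r < b" "i' < a" "t' < n" "r' < b"
  have "i = i' \<and> t = t' \<and> r = r'" if "(i * n + t) * b + r = (i' * n + t') * b + r'"
  proof -
    have 1: "i * n + t = i' * n + t'" using arg_cong[OF that, of "\<lambda>x. x div b"] h by simp
    moreover have "r = r'" using arg_cong[OF that, of "\<lambda>x. x mod b"] h by simp
    moreover have "i = i'" using arg_cong[OF 1, of "\<lambda>x. x div n"] h by simp
    ultimately show ?thesis by simp
  qed
  then show "1\<^sub>m (a * n * b) $$ ((i * n + t) * b + r, (i' * n + t') * b + r') = (if i = i' \<and> r = r' then 1\<^sub>m n $$ (t, t') else 0)"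
    using h digits_less by auto
qed auto

lemma amp_mult:
  assumes X: "X \<in> carrier_mat n n" and Y: "Y \<in> carrier_mat n n"
  shows "amp a b (X * Y) = amp a b X * amp a b Y"
proof (rule amp_eqI[where n = n, symmetric])
  fix i t r i' t' r' :: nat assume h: "i < a" "t < n" "r < b" "i' < a" "t' < n" "r' < b"
  have "(amp a b X * amp a b Y) $$ ((i * n + t) * b + r, (i' * n + t') * b + r')
    = (\<Sum>j<a. \<Sum>s<n. \<Sum>c<b. amp a b X $$ ((i * n + t) * b + r, (j * n + s) * b + c)
        * amp a b Y $$ ((j * n + s) * b + c, (i' * n + t') * b + r'))"
    unfolding mult_mat_index[OF amp_carrier[OF X] amp_carrier[OF Y] digits_less[OF h(1-3)] digits_less[OF h(4-6)]]
    by (rule sum_digits)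
  \<comment> \<open>Two Kronecker deltas leave only \<open>j = i\<close> and \<open>c = r\<close>;
    the remaining sum over \<open>s\<close> is the product of \<open>X\<close> and
    \<open>Y\<close>.\<close>
  also have "\<dots> = (\<Sum>j<a. \<Sum>s<n. \<Sum>c<b. if c = r then if j = i then if i = i' \<and> r = r' then X $$ (t, s) * Y $$ (s, t') else 0 else 0 else 0)"
    using h by (intro sum.cong refl) (auto simp: amp_index[OF X] amp_index[OF Y])
  also have "\<dots> = (\<Sum>j<a. if j = i then \<Sum>s<n. if i = i' \<and> r = r' then X $$ (t, s) * Y $$ (s, t') else 0 else 0)"
    using h by (intro sum.cong refl) auto
  also have "\<dots> = (if i = i' \<and> r = r' then (X * Y) $$ (t, t') else 0)"
    using h by (cases "i = i' \<and> r = r'") (auto simp: mult_mat_index[OF X Y] simp del: index_mult_mat(1))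
  finally show "(amp a b X * amp a b Y) $$ ((i * n + t) * b + r, (i' * n + t') * b + r')
    = (if i = i' \<and> r = r' then (X * Y) $$ (t, t') else 0)" .
qed (use X Y in auto)

text \<open>Associativity of tensoring with identities. The equation \<open>e\<close> rebrackets the
  digits so that the left factors merge with each other and so do the right ones.\<close>

lemma amp_amp:
  assumes X: "X \<in> carrier_mat n n"
  shows "amp a b (amp a' b' X) = amp (a * a') (b' * b) X"
proof (rule amp_eqI[where n = n])
  have e: "(((i * a' + i') * n + t) * (b' * b) + (r' * b + r)) = (i * (a' * n * b') + ((i' * n + t) * b' + r')) * b + r"
    for i i' t r r' by (simp add: algebra_simps)
  fix i t r j u s assume h: "i < a * a'" "t < n" "r < b' * b" "j < a * a'" "u < n" "s < b' * b"
  define i1 i2 j1 j2 where "i1 = i div a'" "i2 = i mod a'" "j1 = j div a'" "j2 = j mod a'"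
  define r1 r2 s1 s2 where "r1 = r div b" "r2 = r mod b" "s1 = s div b" "s2 = s mod b"
  have "a' > 0" "b > 0" using h by (auto intro!: Nat.gr0I)
  then have l: "i1 < a" "i2 < a'" "j1 < a" "j2 < a'" "r1 < b'" "r2 < b" "s1 < b'" "s2 < b"
    using h by (auto simp: i1_i2_j1_j2_def r1_r2_s1_s2_def less_mult_imp_div_less)
  have i: "i = i1 * a' + i2" "j = j1 * a' + j2" "r = r1 * b + r2" "s = s1 * b + s2"
    by (simp_all add: i1_i2_j1_j2_def r1_r2_s1_s2_def)
  have eq: "i = j \<longleftrightarrow> i1 = j1 \<and> i2 = j2" "r = s \<longleftrightarrow> r1 = s1 \<and> r2 = s2"
    by (auto simp: i1_i2_j1_j2_def r1_r2_s1_s2_def) (metis div_mult_mod_eq)+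
  have "amp a b (amp a' b' X) $$ ((i * n + t) * (b' * b) + r, (j * n + u) * (b' * b) + s)
    = amp a b (amp a' b' X) $$ ((i1 * (a' * n * b') + ((i2 * n + t) * b' + r1)) * b + r2,
       (j1 * (a' * n * b') + ((j2 * n + u) * b' + s1)) * b + s2)"
    unfolding e[symmetric] i[symmetric] ..
  also have "\<dots> = (if i1 = j1 \<and> r2 = s2 then amp a' b' X $$ ((i2 * n + t) * b' + r1, (j2 * n + u) * b' + s1) else 0)"
    using l h by (intro amp_index amp_carrier X digits_less) auto
  also have "\<dots> = (if i = j \<and> r = s then X $$ (t, u) else 0)"
    using l h by (auto simp: amp_index[OF X] eq)
  finally show "amp a b (amp a' b' X) $$ ((i * n + t) * (b' * b) + r, (j * n + u) * (b' * b) + s)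
     = (if i = j \<and> r = s then X $$ (t, u) else 0)" .
qed (use X amp_carrier[OF amp_carrier[OF X, of a' b'], of a b] in \<open>auto simp: mult_ac\<close>)

text \<open>\<open>amp a b X\<close> acts as \<open>X\<close> on each of the \<open>a * b\<close>
  slices \<open>w i r\<close> of a vector, and squared norms add over slices.\<close>

lemma opnorm_amp_le:
  assumes X: "X \<in> carrier_mat n n"
  shows "opnorm (amp a b X) \<le> opnorm X"
proof (rule opnorm_le[OF amp_carrier[OF X]])
  fix v :: "complex vec" assume v: "v \<in> carrier_vec (a * n * b)"
  define w where "w i r = vec n (\<lambda>t. v $ ((i * n + t) * b + r))" for i r
  have w: "w i r \<in> carrier_vec n" for i r by (simp add: w_def)
  have e: "(amp a b X *\<^sub>v v) $ ((i * n + t) * b + r) = (X *\<^sub>v w i r) $ t" if h: "i < a" "t < n" "r < b" for i t r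
  proof -
    have "(amp a b X *\<^sub>v v) $ ((i * n + t) * b + r)
      = (\<Sum>j<a. \<Sum>s<n. \<Sum>c<b. amp a b X $$ ((i * n + t) * b + r, (j * n + s) * b + c) * v $ ((j * n + s) * b + c))"
      unfolding mult_mat_vec_index[OF amp_carrier[OF X] v digits_less[OF h]] by (rule sum_digits)
    also have "\<dots> = (\<Sum>j<a. \<Sum>s<n. \<Sum>c<b. if c = r then if j = i then X $$ (t, s) * v $ ((i * n + s) * b + r) else 0 else 0)"
      using h by (intro sum.cong refl) (auto simp: amp_index[OF X])
    also have "\<dots> = (\<Sum>j<a. if j = i then \<Sum>s<n. X $$ (t, s) * v $ ((i * n + s) * b + r) else 0)"
      using h by (intro sum.cong refl) auto
    also have "\<dots> = (X *\<^sub>v w i r) $ t"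
      using h by (simp add: mult_mat_vec_index[OF X w] del: index_mult_mat_vec) (simp add: w_def)
    finally show ?thesis .
  qed
  have sw: "(cvnorm u)\<^sup>2 = (\<Sum>i<a. \<Sum>r<b. \<Sum>t<n. (cmod (u $ ((i * n + t) * b + r)))\<^sup>2)"
    if "u \<in> carrier_vec (a * n * b)" for u
  proof -
    have "(cvnorm u)\<^sup>2 = (\<Sum>i<a. \<Sum>t<n. \<Sum>r<b. (cmod (u $ ((i * n + t) * b + r)))\<^sup>2)"
      using that by (simp add: cvnorm_power2 sum_digits)
    also have "\<dots> = (\<Sum>i<a. \<Sum>r<b. \<Sum>t<n. (cmod (u $ ((i * n + t) * b + r)))\<^sup>2)"
      by (intro sum.cong refl sum.swap)
    finally show ?thesis .
  qed
  have "(cvnorm (amp a b X *\<^sub>v v))\<^sup>2 = (\<Sum>i<a. \<Sum>r<b. \<Sum>t<n. (cmod ((amp a b X *\<^sub>v v) $ ((i * n + t) * b + r)))\<^sup>2)"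
    by (rule sw, rule mult_mat_vec_carrier[OF amp_carrier[OF X] v])
  also have "\<dots> = (\<Sum>i<a. \<Sum>r<b. (cvnorm (X *\<^sub>v w i r))\<^sup>2)"
    using X by (intro sum.cong refl) (auto simp: e cvnorm_power2 simp del: index_mult_mat_vec)
  also have "\<dots> \<le> (\<Sum>i<a. \<Sum>r<b. (opnorm X * cvnorm (w i r))\<^sup>2)"
    by (intro sum_mono power_mono opnorm_bound[OF X w]) auto
  also have "\<dots> = (opnorm X)\<^sup>2 * (\<Sum>i<a. \<Sum>r<b. (cvnorm (w i r))\<^sup>2)"
    by (simp add: sum_distrib_left power_mult_distrib)
  also have "(\<Sum>i<a. \<Sum>r<b. (cvnorm (w i r))\<^sup>2) = (cvnorm v)\<^sup>2"
    unfolding sw[OF v] by (simp add: cvnorm_power2 w_def)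
  finally have "(cvnorm (amp a b X *\<^sub>v v))\<^sup>2 \<le> (opnorm X * cvnorm v)\<^sup>2" by (simp add: power_mult_distrib)
  then show "cvnorm (amp a b X *\<^sub>v v) \<le> opnorm X * cvnorm v" by (rule power2_le_imp_le) simp
qed simp

section \<open>The quasi-local algebra\<close>

text \<open>Only the sizes are fixed, without the Cauchy condition. \<open>qeq\<close> is already
  symmetric and transitive here, so products such as \<open>qmult (T a) (T b)\<close> can be
  compared without showing that they are elements of the algebra.\<close>

definition lvl_seq :: "nat \<Rightarrow> (nat \<Rightarrow> complex mat) \<Rightarrow> bool" where
  "lvl_seq d a \<longleftrightarrow> (\<forall>N. a N \<in> carrier_mat (lvl_dim d N) (lvl_dim d N))"

lemma lvl_seqD: "lvl_seq d a \<Longrightarrow> a N \<in> carrier_mat (lvl_dim d N) (lvl_dim d N)"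
  by (simp add: lvl_seq_def)

lemma qelem_lvl_seq: "qelem d a \<Longrightarrow> lvl_seq d a"
  by (simp add: qelem_def lvl_seq_def)

lemma lvl_seq_ops:
  assumes "lvl_seq d a"
  shows "lvl_seq d b \<Longrightarrow> lvl_seq d (qadd a b)" "lvl_seq d b \<Longrightarrow> lvl_seq d (qmult a b)"
    "lvl_seq d (qscale c a)" "lvl_seq d (qstar a)"
  using assms by (auto simp: lvl_seq_def qadd_def qmult_def qscale_def qstar_def)

lemma lvl_seq_qone: "lvl_seq d (qone d)"
  by (simp add: lvl_seq_def qone_def)

lemma emb_amp: "emb d N M X = amp (d ^ (M - N)) (d ^ (M - N)) X"
  by (simp add: emb_def amp_def)

lemma emb_lvl_dim:
  assumes "N \<le> M"
  shows "d ^ (M - N) * lvl_dim d N * d ^ (M - N) = lvl_dim d M"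
proof -
  have "(M - N) + (2 * N + 1) + (M - N) = 2 * M + 1" using assms by simp
  then show ?thesis unfolding lvl_dim_def by (metis power_add)
qed

lemma emb_carrier:
  assumes "X \<in> carrier_mat (lvl_dim d N) (lvl_dim d N)" "N \<le> M"
  shows "emb d N M X \<in> carrier_mat (lvl_dim d M) (lvl_dim d M)"
  using amp_carrier[OF assms(1), of "d ^ (M - N)" "d ^ (M - N)"] emb_lvl_dim[OF assms(2), of d]
  by (simp add: emb_amp)

lemma opnorm_diff_self: "opnorm (A - A) = 0"
proof -
  have "A - A = 0\<^sub>m (dim_row A) (dim_col A)" by (intro eq_matI) auto
  then show ?thesis by (simp only: opnorm_zero)
qed

text \<open>Finitely many levels never matter. This absorbs the zero matrices that
  \<open>loc\<close> uses where the interval does not fit.\<close>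

lemma qeq_eventually_eq: "(\<And>N. N0 \<le> N \<Longrightarrow> a N = b N) \<Longrightarrow> qeq a b"
  unfolding qeq_def
  by (rule tendsto_eventually, rule eventually_sequentiallyI[of N0]) (simp add: opnorm_diff_self)

lemma qeq_refl: "qeq a a"
  by (rule qeq_eventually_eq) simp

lemma qeq_sym:
  assumes "lvl_seq d a" "lvl_seq d b" "qeq a b"
  shows "qeq b a"
  using assms(3) unfolding qeq_def
  by (simp add: opnorm_minus_commute[OF lvl_seqD[OF assms(1)] lvl_seqD[OF assms(2)]])

lemma qeq_le:
  assumes "\<And>N. opnorm (a N - b N) \<le> u N" "u \<longlonglongrightarrow> 0"
  shows "qeq a b"
  unfolding qeq_def
  by (rule tendsto_sandwich[OF _ _ tendsto_const assms(2)]) (simp_all add: assms(1))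

lemma qeq_trans:
  assumes "lvl_seq d a" "lvl_seq d b" "lvl_seq d c" "qeq a b" "qeq b c"
  shows "qeq a c"
proof (rule qeq_le)
  show "opnorm (a N - c N) \<le> opnorm (a N - b N) + opnorm (b N - c N)" for N
    by (rule opnorm_triangle[OF assms(1-3)[THEN lvl_seqD]])
  show "(\<lambda>N. opnorm (a N - b N) + opnorm (b N - c N)) \<longlonglongrightarrow> 0"
    using tendsto_add[OF assms(4,5)[unfolded qeq_def]] by simp
qed

lemma qeq_qadd:
  assumes s: "lvl_seq d a" "lvl_seq d b" "lvl_seq d a'" "lvl_seq d b'" and "qeq a b" "qeq a' b'"
  shows "qeq (qadd a a') (qadd b b')"
proof (rule qeq_le)
  fix N
  note c = s[THEN lvl_seqD, of N]
  have "(a N + a' N) - (b N + b' N) = (a N - b N) + (a' N - b' N)"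
    using c by (intro eq_matI) auto
  then show "opnorm (qadd a a' N - qadd b b' N) \<le> opnorm (a N - b N) + opnorm (a' N - b' N)"
    using opnorm_add[OF minus_carrier_mat[OF c(2), of "a N"] minus_carrier_mat[OF c(4), of "a' N"]]
    by (simp add: qadd_def)
next
  show "(\<lambda>N. opnorm (a N - b N) + opnorm (a' N - b' N)) \<longlonglongrightarrow> 0"
    using tendsto_add[OF assms(5,6)[unfolded qeq_def]] by simp
qed

lemma qeq_qscale:
  assumes s: "lvl_seq d a" "lvl_seq d b" and "qeq a b"
  shows "qeq (qscale c a) (qscale c b)"
proof (rule qeq_le)
  fix N
  note c = s[THEN lvl_seqD, of N]
  have "c \<cdot>\<^sub>m a N - c \<cdot>\<^sub>m b N = c \<cdot>\<^sub>m (a N - b N)"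
    using c by (intro eq_matI) (auto simp: algebra_simps)
  then show "opnorm (qscale c a N - qscale c b N) \<le> cmod c * opnorm (a N - b N)"
    using opnorm_smult[OF minus_carrier_mat[OF c(2), of "a N"], of c] by (simp add: qscale_def)
next
  show "(\<lambda>N. cmod c * opnorm (a N - b N)) \<longlonglongrightarrow> 0"
    using tendsto_mult_left[OF assms(3)[unfolded qeq_def], of "cmod c"] by simp
qed

lemma qeq_qstar:
  assumes s: "lvl_seq d a" "lvl_seq d b" and "qeq a b"
  shows "qeq (qstar a) (qstar b)"
proof (rule qeq_le)
  fix N
  note c = s[THEN lvl_seqD, of N]
  have "mat_adjoint (a N) - mat_adjoint (b N) = mat_adjoint (a N - b N)"
    using c by (intro eq_matI) auto
  then show "opnorm (qstar a N - qstar b N) \<le> opnorm (a N - b N)"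
    using opnorm_adjoint_le[OF minus_carrier_mat[OF c(2), of "a N"]] by (simp add: qstar_def)
qed (use assms(3) in \<open>simp add: qeq_def\<close>)

text \<open>Telescoping, with \<open>A'\<close> rewritten as a perturbation of \<open>B'\<close>:
  besides the differences, only the norms of \<open>B\<close> and \<open>B'\<close> enter.\<close>

lemma opnorm_mult_diff:
  assumes A: "A \<in> carrier_mat n n" "B \<in> carrier_mat n n" "A' \<in> carrier_mat n n" "B' \<in> carrier_mat n n"
  shows "opnorm (A * A' - B * B') \<le> opnorm (A - B) * (opnorm (A' - B') + opnorm B') + opnorm B * opnorm (A' - B')"
proof -
  have "A * A' - B * B' = (A - B) * ((A' - B') + B') + B * (A' - B')"
  proof -
    have "(A' - B') + B' = A'" using A by (intro eq_matI) auto
    moreover have "(A - B) * A' = A * A' - B * A'" using A by (intro minus_mult_distrib_mat)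
    moreover have "B * (A' - B') = B * A' - B * B'" using A by (intro mult_minus_distrib_mat)
    moreover have "A * A' - B * B' = (A * A' - B * A') + (B * A' - B * B')"
      using A by (intro eq_matI) auto
    ultimately show ?thesis by simp
  qed
  also have "opnorm \<dots> \<le> opnorm ((A - B) * ((A' - B') + B')) + opnorm (B * (A' - B'))"
    using A by (intro opnorm_add[of _ n n] mult_square_carrier add_carrier_mat minus_carrier_mat) auto
  also have "opnorm ((A - B) * ((A' - B') + B')) \<le> opnorm (A - B) * opnorm ((A' - B') + B')"
    using A by (intro opnorm_mult[of _ n n _ n] add_carrier_mat minus_carrier_mat) auto
  also have "opnorm ((A' - B') + B') \<le> opnorm (A' - B') + opnorm B'"
    using A by (intro opnorm_add[of _ n n] minus_carrier_mat) auto
  also have "opnorm (B * (A' - B')) \<le> opnorm B * opnorm (A' - B')"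
    using A by (intro opnorm_mult[of _ n n _ n] minus_carrier_mat) auto
  finally show ?thesis by (simp add: mult_left_mono)
qed

text \<open>Boundedness is asked of the comparison sequences \<open>b\<close> and \<open>b'\<close>,
  which in the applications are local elements or the identity.\<close>

lemma qeq_qmult:
  assumes s: "lvl_seq d a" "lvl_seq d b" "lvl_seq d a'" "lvl_seq d b'" and ab: "qeq a b" "qeq a' b'"
    and bd: "\<And>N. opnorm (b N) \<le> B" "\<And>N. opnorm (b' N) \<le> B'"
  shows "qeq (qmult a a') (qmult b b')"
proof (rule qeq_le)
  fix N
  note c = s[THEN lvl_seqD, of N]
  have "opnorm (qmult a a' N - qmult b b' N)
    \<le> opnorm (a N - b N) * (opnorm (a' N - b' N) + opnorm (b' N)) + opnorm (b N) * opnorm (a' N - b' N)"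
    unfolding qmult_def by (rule opnorm_mult_diff[OF c])
  also have "\<dots> \<le> opnorm (a N - b N) * (opnorm (a' N - b' N) + B') + B * opnorm (a' N - b' N)"
    using bd by (intro add_mono mult_left_mono mult_right_mono) auto
  finally show "opnorm (qmult a a' N - qmult b b' N)
    \<le> opnorm (a N - b N) * (opnorm (a' N - b' N) + B') + B * opnorm (a' N - b' N)" .
next
  note t = ab[unfolded qeq_def]
  have "(\<lambda>N. opnorm (a N - b N) * (opnorm (a' N - b' N) + B') + B * opnorm (a' N - b' N)) \<longlonglongrightarrow> 0 * (0 + B') + B * 0"
    by (intro tendsto_intros t)
  then show "(\<lambda>N. opnorm (a N - b N) * (opnorm (a' N - b' N) + B') + B * opnorm (a' N - b' N)) \<longlonglongrightarrow> 0"
    by simp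
qed

section \<open>Elements localised in an interval\<close>

lemma loc_amp:
  "- int N \<le> m1 \<Longrightarrow> m2 \<le> int N \<Longrightarrow> loc d m1 m2 X N = amp (d ^ nat (m1 + int N)) (d ^ nat (int N - m2)) X"
  by (simp add: loc_def amp_def)

lemma lvl_dim_split:
  assumes "m1 \<le> m2" "- int N \<le> m1" "m2 \<le> int N"
  shows "d ^ nat (m1 + int N) * d ^ isize m1 m2 * d ^ nat (int N - m2) = lvl_dim d N"
proof -
  have "nat (m1 + int N) + isize m1 m2 + nat (int N - m2) = 2 * N + 1"
    using assms by (simp add: isize_def)
  then show ?thesis by (metis lvl_dim_def power_add)
qed

lemma loc_lvl_seq:
  assumes "m1 \<le> m2" and X: "X \<in> carrier_mat (d ^ isize m1 m2) (d ^ isize m1 m2)"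
  shows "lvl_seq d (loc d m1 m2 X)"
  unfolding lvl_seq_def
proof
  fix N
  show "loc d m1 m2 X N \<in> carrier_mat (lvl_dim d N) (lvl_dim d N)"
  proof (cases "- int N \<le> m1 \<and> m2 \<le> int N")
    case True
    then show ?thesis
      using amp_carrier[OF X, of "d ^ nat (m1 + int N)" "d ^ nat (int N - m2)"] lvl_dim_split[of m1 m2 N d] assms
      by (simp add: loc_amp)
  qed (auto simp: loc_def)
qed

lemma loc_emb:
  assumes "m1 \<le> m2" and X: "X \<in> carrier_mat (d ^ isize m1 m2) (d ^ isize m1 m2)"
    and N: "- int N \<le> m1" "m2 \<le> int N" "N \<le> M"
  shows "emb d N M (loc d m1 m2 X N) = loc d m1 m2 X M"
proof -
  have "(M - N) + nat (m1 + int N) = nat (m1 + int M)" "nat (int N - m2) + (M - N) = nat (int M - m2)"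
    using assms by auto
  then have "d ^ (M - N) * d ^ nat (m1 + int N) = d ^ nat (m1 + int M)"
     "d ^ nat (int N - m2) * d ^ (M - N) = d ^ nat (int M - m2)"
    by (metis power_add)+
  then show ?thesis using N by (simp add: loc_amp emb_amp amp_amp[OF X])
qed

lemma qelem_loc:
  assumes "m1 \<le> m2" and X: "X \<in> carrier_mat (d ^ isize m1 m2) (d ^ isize m1 m2)"
  shows "qelem d (loc d m1 m2 X)"
  unfolding qelem_def
proof (intro conjI allI impI)
  show "loc d m1 m2 X N \<in> carrier_mat (lvl_dim d N) (lvl_dim d N)" for N
    by (rule lvl_seqD[OF loc_lvl_seq[OF assms]])
  fix \<epsilon> :: real assume e: "0 < \<epsilon>"
  show "\<exists>N0. \<forall>N M. N0 \<le> N \<and> N \<le> M \<longrightarrow> opnorm (emb d N M (loc d m1 m2 X N) - loc d m1 m2 X M) < \<epsilon>"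
  \<comment> \<open>From this level on the window \<open>[-N, N]\<close> contains the interval and
    the embedded matrices coincide exactly.\<close>
  proof (intro exI[of _ "nat (max \<bar>m1\<bar> \<bar>m2\<bar>)"] allI impI)
    fix N M assume "nat (max \<bar>m1\<bar> \<bar>m2\<bar>) \<le> N \<and> N \<le> M"
    then have "emb d N M (loc d m1 m2 X N) = loc d m1 m2 X M" by (intro loc_emb assms) auto
    then show "opnorm (emb d N M (loc d m1 m2 X N) - loc d m1 m2 X M) < \<epsilon>"
      using e by (simp add: opnorm_diff_self)
  qed
qed

lemma opnorm_loc_le:
  assumes X: "X \<in> carrier_mat (d ^ isize m1 m2) (d ^ isize m1 m2)"
  shows "opnorm (loc d m1 m2 X N) \<le> opnorm X"
proof (cases "- int N \<le> m1 \<and> m2 \<le> int N")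
  case True
  then show ?thesis using opnorm_amp_le[OF X] by (simp add: loc_amp)
qed (auto simp: loc_def)

lemma loc_ops:
  assumes X: "X \<in> carrier_mat (d ^ isize m1 m2) (d ^ isize m1 m2)"
  shows "Y \<in> carrier_mat (d ^ isize m1 m2) (d ^ isize m1 m2) \<Longrightarrow>
      loc d m1 m2 (X + Y) = qadd (loc d m1 m2 X) (loc d m1 m2 Y)"
    "Y \<in> carrier_mat (d ^ isize m1 m2) (d ^ isize m1 m2) \<Longrightarrow>
      loc d m1 m2 (X * Y) = qmult (loc d m1 m2 X) (loc d m1 m2 Y)"
    "loc d m1 m2 (c \<cdot>\<^sub>m X) = qscale c (loc d m1 m2 X)"
    "loc d m1 m2 (mat_adjoint X) = qstar (loc d m1 m2 X)"
proof -
  note op = qadd_def qmult_def qscale_def qstar_def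
  have z: "0\<^sub>m n n * 0\<^sub>m n n = (0\<^sub>m n n :: complex mat)" "mat_adjoint (0\<^sub>m n n) = (0\<^sub>m n n :: complex mat)"
    "c \<cdot>\<^sub>m 0\<^sub>m n n = (0\<^sub>m n n :: complex mat)" for n c
    by (auto intro!: eq_matI)
  show "loc d m1 m2 (c \<cdot>\<^sub>m X) = qscale c (loc d m1 m2 X)"
    "loc d m1 m2 (mat_adjoint X) = qstar (loc d m1 m2 X)"
    unfolding fun_eq_iff loc_def amp_def[symmetric] op by (auto simp: z amp_smult[OF X] amp_adjoint[OF X])
  assume Y: "Y \<in> carrier_mat (d ^ isize m1 m2) (d ^ isize m1 m2)"
  show "loc d m1 m2 (X + Y) = qadd (loc d m1 m2 X) (loc d m1 m2 Y)"
    "loc d m1 m2 (X * Y) = qmult (loc d m1 m2 X) (loc d m1 m2 Y)"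
    unfolding fun_eq_iff loc_def amp_def[symmetric] op by (auto simp: z amp_add[OF X Y] amp_mult[OF X Y])
qed

lemma loc_one_qeq:
  assumes "m1 \<le> m2"
  shows "qeq (loc d m1 m2 (1\<^sub>m (d ^ isize m1 m2))) (qone d)"
proof (rule qeq_eventually_eq[of "nat (max \<bar>m1\<bar> \<bar>m2\<bar>)"])
  fix N assume "nat (max \<bar>m1\<bar> \<bar>m2\<bar>) \<le> N"
  then have N: "- int N \<le> m1" "m2 \<le> int N" by auto
  then show "loc d m1 m2 (1\<^sub>m (d ^ isize m1 m2)) N = qone d N"
    by (simp add: loc_amp amp_one qone_def lvl_dim_split[OF assms N])
qed

lemma loc_extend_qeq:
  assumes l: "l1 \<le> k1" "k2 \<le> l2" and X: "X \<in> carrier_mat (d ^ isize k1 k2) (d ^ isize k1 k2)"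
  shows "qeq (loc d k1 k2 X) (loc d l1 l2 (amp (d ^ nat (k1 - l1)) (d ^ nat (l2 - k2)) X))"
proof (rule qeq_eventually_eq[of "nat (max \<bar>l1\<bar> \<bar>l2\<bar>)"])
  fix N assume "nat (max \<bar>l1\<bar> \<bar>l2\<bar>) \<le> N"
  then have N: "- int N \<le> l1" "l2 \<le> int N" "- int N \<le> k1" "k2 \<le> int N" using l by auto
  then have "nat (l1 + int N) + nat (k1 - l1) = nat (k1 + int N)" "nat (l2 - k2) + nat (int N - l2) = nat (int N - k2)"
    using l by auto
  then have "d ^ nat (l1 + int N) * d ^ nat (k1 - l1) = d ^ nat (k1 + int N)"
    "d ^ nat (l2 - k2) * d ^ nat (int N - l2) = d ^ nat (int N - k2)"
    by (metis power_add)+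
  then show "loc d k1 k2 X N = loc d l1 l2 (amp (d ^ nat (k1 - l1)) (d ^ nat (l2 - k2)) X) N"
    using N by (simp add: loc_amp amp_amp[OF X])
qed

text \<open>At every large level the entry \<open>(i, j)\<close> of \<open>X\<close> reappears at
  \<open>(i * b, j * b)\<close>, so a fixed number is bounded by norms that tend to zero. Local
  elements thus have a unique representing matrix.\<close>

lemma loc_eqI:
  assumes d: "d > 0"
    and X: "X \<in> carrier_mat (d ^ isize m1 m2) (d ^ isize m1 m2)"
    and Y: "Y \<in> carrier_mat (d ^ isize m1 m2) (d ^ isize m1 m2)"
    and eq: "qeq (loc d m1 m2 X) (loc d m1 m2 Y)"
  shows "X = Y"
proof (rule eq_matI)
  fix i j assume "i < dim_row Y" "j < dim_col Y"
  then have ij: "i < d ^ isize m1 m2" "j < d ^ isize m1 m2" using Y by auto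
  have "cmod (X $$ (i, j) - Y $$ (i, j)) \<le> opnorm (loc d m1 m2 X N - loc d m1 m2 Y N)"
    if "nat (max \<bar>m1\<bar> \<bar>m2\<bar>) \<le> N" for N
  proof -
    define a b where "a = d ^ nat (m1 + int N)" "b = d ^ nat (int N - m2)"
    have ab: "a > 0" "b > 0" using d by (auto simp: a_b_def)
    have l: "loc d m1 m2 Z N = amp a b Z" for Z
      using that unfolding a_b_def by (intro loc_amp) auto
    have "amp a b X - amp a b Y \<in> carrier_mat (a * d ^ isize m1 m2 * b) (a * d ^ isize m1 m2 * b)"
      using amp_carrier[OF Y] by (rule minus_carrier_mat)
    moreover have lt: "i * b < a * d ^ isize m1 m2 * b" "j * b < a * d ^ isize m1 m2 * b"
      using digits_less[OF ab(1) ij(1) ab(2)] digits_less[OF ab(1) ij(2) ab(2)] by auto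
    moreover have "amp a b Z $$ (i * b, j * b) = Z $$ (i, j)" if "Z \<in> carrier_mat (d ^ isize m1 m2) (d ^ isize m1 m2)" for Z
      using amp_index[OF that ab(1) ij(1) ab(2) ab(1) ij(2) ab(2)] by simp
    ultimately show ?thesis using X Y opnorm_index_le[OF _ lt, of "amp a b X - amp a b Y"] by (simp add: l)
  qed
  then have "\<forall>\<^sub>F N in sequentially. cmod (X $$ (i, j) - Y $$ (i, j)) \<le> opnorm (loc d m1 m2 X N - loc d m1 m2 Y N)"
    by (rule eventually_sequentiallyI)
  from tendsto_lowerbound[OF eq[unfolded qeq_def] this] show "X $$ (i, j) = Y $$ (i, j)" by simp
qed (use X Y in auto)

lemma qelem_qone: "qelem d (qone d)"
proof -
  have "emb d N M (qone d N) = qone d M" if "N \<le> M" for N M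
    by (simp add: emb_amp qone_def amp_one emb_lvl_dim[OF that])
  then show ?thesis by (auto simp: qelem_def opnorm_diff_self qone_def)
qed

lemma opnorm_one_le: "opnorm (1\<^sub>m n) \<le> 1"
  by (rule opnorm_le[of _ n n]) auto

lemma matrix_state_loc:
  assumes w: "qstate d \<omega>" and m: "m1 \<le> m2"
  shows "matrix_state (d ^ isize m1 m2) (\<lambda>X. \<omega> (loc d m1 m2 X))"
proof -
  \<comment> \<open>The local identity agrees with \<open>qone\<close> only from some level on;
    invariance of \<open>\<omega>\<close> under \<open>qeq\<close> transfers the
    normalisation.\<close>
  have "\<omega> (loc d m1 m2 (1\<^sub>m (d ^ isize m1 m2))) = 1"
    using w loc_one_qeq[OF m, of d] qelem_loc[OF m, of "1\<^sub>m (d ^ isize m1 m2)" d] qelem_qone[of d]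
    unfolding qstate_def by (metis one_carrier_mat)
  then show ?thesis
    using w qelem_loc[OF m, of _ d] unfolding matrix_state_def qstate_def by (auto simp: loc_ops)
qed

text \<open>\<open>density\<close> tests a functional on matrices of size \<open>n\<close> alone, so
  agreement there makes the two definite descriptions identical.\<close>

lemma state_entropy_cong:
  assumes "\<And>X. X \<in> carrier_mat n n \<Longrightarrow> f X = g X"
  shows "state_entropy n f = state_entropy n g"
proof -
  have "(\<lambda>\<rho>. \<rho> \<in> carrier_mat n n \<and> (\<forall>X\<in>carrier_mat n n. f X = mtrace (\<rho> * X)))
      = (\<lambda>\<rho>. \<rho> \<in> carrier_mat n n \<and> (\<forall>X\<in>carrier_mat n n. g X = mtrace (\<rho> * X)))"
    using assms by (auto simp: fun_eq_iff)
  then show ?thesis by (simp add: state_entropy_def density_def)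
qed

text \<open>A representing matrix \<open>\<phi> X\<close> is chosen for each \<open>X\<close>. By
  \<open>loc_eqI\<close> it is the only one, so every identity that \<open>T\<close> satisfies up to
  \<open>qeq\<close> becomes an exact identity for \<open>\<phi>\<close>.\<close>

lemma local_hom_exists:
  assumes d: "d > 0" and k: "k1 \<le> k2" and l: "l1 \<le> l2"
    and aut: "qautomorphism d T" and ml: "maps_local d T k1 k2 l1 l2"
  defines "p \<equiv> d ^ isize k1 k2" and "q \<equiv> d ^ isize l1 l2"
  obtains \<phi> where
    "\<And>X. X \<in> carrier_mat p p \<Longrightarrow> \<phi> X \<in> carrier_mat q q"
    "\<And>X. X \<in> carrier_mat p p \<Longrightarrow> qeq (T (loc d k1 k2 X)) (loc d l1 l2 (\<phi> X))"
    "\<And>X Y. X \<in> carrier_mat p p \<Longrightarrow> Y \<in> carrier_mat p p \<Longrightarrow> \<phi> (X + Y) = \<phi> X + \<phi> Y"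
    "\<And>c X. X \<in> carrier_mat p p \<Longrightarrow> \<phi> (c \<cdot>\<^sub>m X) = c \<cdot>\<^sub>m \<phi> X"
    "\<And>X Y. X \<in> carrier_mat p p \<Longrightarrow> Y \<in> carrier_mat p p \<Longrightarrow> \<phi> (X * Y) = \<phi> X * \<phi> Y"
    "\<And>X. X \<in> carrier_mat p p \<Longrightarrow> \<phi> (mat_adjoint X) = mat_adjoint (\<phi> X)"
    "\<phi> (1\<^sub>m p) = 1\<^sub>m q"
proof -
  let ?K = "loc d k1 k2" and ?L = "loc d l1 l2"
  have eK: "qelem d (?K X)" if "X \<in> carrier_mat p p" for X
    using that unfolding p_def by (rule qelem_loc[OF k])
  have T: "qelem d (T a)" if "qelem d a" for a using aut that unfolding qautomorphism_def by blast
  have Tcong: "qeq (T a) (T b)" if "qelem d a" "qelem d b" "qeq a b" for a b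
    using aut that unfolding qautomorphism_def by blast
  have Tops: "qelem d a \<Longrightarrow> qelem d b \<Longrightarrow> qeq (T (qadd a b)) (qadd (T a) (T b))"
    "qelem d a \<Longrightarrow> qelem d b \<Longrightarrow> qeq (T (qmult a b)) (qmult (T a) (T b))"
    "qelem d a \<Longrightarrow> qeq (T (qscale z a)) (qscale z (T a))"
    "qelem d a \<Longrightarrow> qeq (T (qstar a)) (qstar (T a))" for a b z
    using aut unfolding qautomorphism_def by blast+
  have "\<exists>Y\<in>carrier_mat q q. qeq (T (?K X)) (?L Y)" if "X \<in> carrier_mat p p" for X
  proof -
    have "in_local d k1 k2 (?K X)" using eK[OF that] that qeq_refl by (auto simp: in_local_def p_def)
    then show ?thesis using ml by (auto simp: maps_local_def in_local_def q_def)
  qed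
  then obtain \<phi> where c: "\<And>X. X \<in> carrier_mat p p \<Longrightarrow> \<phi> X \<in> carrier_mat q q"
    and e: "\<And>X. X \<in> carrier_mat p p \<Longrightarrow> qeq (T (?K X)) (?L (\<phi> X))" by metis
  have sL: "lvl_seq d (?L Y)" if "Y \<in> carrier_mat q q" for Y
    using that unfolding q_def by (rule loc_lvl_seq[OF l])
  have sT: "lvl_seq d (T (?K X))" if "X \<in> carrier_mat p p" for X
    by (intro qelem_lvl_seq T eK that)
  have bL: "opnorm (?L Y N) \<le> opnorm Y" if "Y \<in> carrier_mat q q" for Y N
    using that unfolding q_def by (rule opnorm_loc_le)
  have uniq: "\<phi> X = Y" if X: "X \<in> carrier_mat p p" and Y: "Y \<in> carrier_mat q q"
    and h: "lvl_seq d a" "qeq (T (?K X)) a" "qeq a (?L Y)" for X Y a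
  proof -
    have "qeq (?L (\<phi> X)) a"
      using qeq_trans[OF sL[OF c[OF X]] sT[OF X] h(1) qeq_sym[OF sT[OF X] sL[OF c[OF X]] e[OF X]] h(2)] .
    then have "qeq (?L (\<phi> X)) (?L Y)"
      using qeq_trans[OF sL[OF c[OF X]] h(1) sL[OF Y] _ h(3)] by blast
    then show ?thesis using loc_eqI[OF d] c[OF X] Y unfolding q_def by blast
  qed
  note lK = loc_ops[where ?m1.0 = k1 and ?m2.0 = k2 and d = d, folded p_def]
  note lL = loc_ops[where ?m1.0 = l1 and ?m2.0 = l2 and d = d, folded q_def]
  have add: "\<phi> (X + Y) = \<phi> X + \<phi> Y" if X: "X \<in> carrier_mat p p" and Y: "Y \<in> carrier_mat p p" for X Y
  proof (rule uniq)
    show "qeq (T (?K (X + Y))) (qadd (T (?K X)) (T (?K Y)))"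
      unfolding lK(1)[OF X Y] by (intro Tops eK X Y)
    show "qeq (qadd (T (?K X)) (T (?K Y))) (?L (\<phi> X + \<phi> Y))"
      unfolding lL(1)[OF c[OF X] c[OF Y]] by (intro qeq_qadd[of d] sT sL c e X Y)
  qed (use X Y c sT in \<open>simp_all add: lvl_seq_ops\<close>)
  have mult: "\<phi> (X * Y) = \<phi> X * \<phi> Y" if X: "X \<in> carrier_mat p p" and Y: "Y \<in> carrier_mat p p" for X Y
  proof (rule uniq)
    show "qeq (T (?K (X * Y))) (qmult (T (?K X)) (T (?K Y)))"
      unfolding lK(2)[OF X Y] by (intro Tops eK X Y)
    show "qeq (qmult (T (?K X)) (T (?K Y))) (?L (\<phi> X * \<phi> Y))"
      \<comment> \<open>Local elements are bounded uniformly over the levels, as the product rule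
        for \<open>qeq\<close> requires.\<close>
      unfolding lL(2)[OF c[OF X] c[OF Y]] by (rule qeq_qmult[of d, OF _ _ _ _ _ _ bL bL]) (intro sT sL c e X Y)+
  qed (use X Y c sT in \<open>simp_all add: lvl_seq_ops\<close>)
  have smult: "\<phi> (z \<cdot>\<^sub>m X) = z \<cdot>\<^sub>m \<phi> X" if X: "X \<in> carrier_mat p p" for X z
  proof (rule uniq)
    show "qeq (T (?K (z \<cdot>\<^sub>m X))) (qscale z (T (?K X)))"
      unfolding lK(3)[OF X] by (intro Tops eK X)
    show "qeq (qscale z (T (?K X))) (?L (z \<cdot>\<^sub>m \<phi> X))"
      unfolding lL(3)[OF c[OF X]] by (intro qeq_qscale[of d] sT sL c e X)
  qed (use X c sT in \<open>simp_all add: lvl_seq_ops\<close>)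
  have star: "\<phi> (mat_adjoint X) = mat_adjoint (\<phi> X)" if X: "X \<in> carrier_mat p p" for X
  proof (rule uniq)
    show "qeq (T (?K (mat_adjoint X))) (qstar (T (?K X)))"
      unfolding lK(4)[OF X] by (intro Tops eK X)
    show "qeq (qstar (T (?K X))) (?L (mat_adjoint (\<phi> X)))"
      unfolding lL(4)[OF c[OF X]] by (intro qeq_qstar[of d] sT sL c e X)
  qed (use X c sT in \<open>simp_all add: lvl_seq_ops\<close>)
  have one: "\<phi> (1\<^sub>m p) = 1\<^sub>m q"
  proof -
    \<comment> \<open>Unitality is not an axiom for \<open>T\<close>: it follows from surjectivity.\<close>
    have 1: "1\<^sub>m p \<in> carrier_mat p p" "1\<^sub>m q \<in> carrier_mat q q" by auto
    note s1 = lvl_seq_qone[of d]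
    have sT1: "lvl_seq d (T (qone d))" by (intro qelem_lvl_seq T qelem_qone)
    let ?e = "?L (\<phi> (1\<^sub>m p))"
    have se: "lvl_seq d ?e" by (intro sL c 1)
    have "qeq (qone d) (?K (1\<^sub>m p))"
      using loc_one_qeq[OF k, of d] qeq_sym[OF qelem_lvl_seq[OF eK[OF 1(1)]] s1] by (simp add: p_def)
    then have "qeq (T (qone d)) (T (?K (1\<^sub>m p)))" by (intro Tcong qelem_qone eK 1)
    then have T1: "qeq (T (qone d)) ?e" using qeq_trans[OF sT1 sT[OF 1(1)] se _ e[OF 1(1)]] by blast
    have "\<forall>b. qelem d b \<longrightarrow> (\<exists>a. qelem d a \<and> qeq (T a) b)"
      using aut unfolding qautomorphism_def by (elim conjE)
    \<comment> \<open>With \<open>T a\<close> equivalent to 1, the chain is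
      \<open>1 ~ T a = T (a 1) ~ T a T 1 ~ T 1\<close>, and \<open>T 1\<close> is represented by
      \<open>?e\<close>.\<close>
    then obtain a where a: "qelem d a" "qeq (T a) (qone d)" using qelem_qone by blast
    have sa: "lvl_seq d (T a)" by (intro qelem_lvl_seq T a)
    have "qmult a (qone d) = a"
      by (intro ext) (simp add: qmult_def qone_def right_mult_one_mat[OF lvl_seqD[OF qelem_lvl_seq[OF a(1)]]])
    then have m: "qeq (T a) (qmult (T a) (T (qone d)))"
      using Tops(2)[OF a(1) qelem_qone] by simp
    have "qmult (qone d) ?e = ?e"
      by (intro ext) (simp add: qmult_def qone_def left_mult_one_mat[OF lvl_seqD[OF se]])
    moreover have "qeq (qmult (T a) (T (qone d))) (qmult (qone d) ?e)"
      by (rule qeq_qmult[OF sa s1 sT1 se a(2) T1, of 1]) (simp add: qone_def opnorm_one_le, rule bL, intro c 1)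
    ultimately have "qeq (qmult (T a) (T (qone d))) ?e" by simp
    then have "qeq (T a) ?e" by (rule qeq_trans[OF sa lvl_seq_ops(2)[OF sa sT1] se m])
    then have "qeq (qone d) ?e" by (rule qeq_trans[OF s1 sa se qeq_sym[OF sa s1 a(2)]])
    then have "qeq (?L (1\<^sub>m q)) ?e"
      using qeq_trans[OF sL[OF 1(2)] s1 se loc_one_qeq[OF l, of d, folded q_def]] by blast
    then show ?thesis using loc_eqI[OF d] c[OF 1(1)] 1(2) unfolding q_def by metis
  qed
  show ?thesis by (rule that[OF c e add smult mult star one])
qed

lemma restr_entropy_diff_le:
  assumes d: "d > 0" and k: "k1 \<le> k2" and l: "l1 \<le> k1" "k2 \<le> l2"
    and aut: "qautomorphism d T" and ml: "maps_local d T k1 k2 l1 l2" and w: "qstate d \<omega>"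
  shows "\<bar>restr_entropy d (\<omega> \<circ> T) k1 k2 - restr_entropy d \<omega> k1 k2\<bar> \<le> 2 * real_of_int (l2 - l1 - k2 + k1) * log 2 d"
proof -
  define n where "n = nat (l2 - l1 - k2 + k1)"
  define p where "p = d ^ isize k1 k2"
  define q where "q = d ^ isize l1 l2"
  have l12: "l1 \<le> l2" using k l by simp
  have "isize l1 l2 = isize k1 k2 + n" using k l by (auto simp: isize_def n_def)
  then have q: "q = p * d ^ n" by (simp add: p_def q_def power_add)
  have pos: "p > 0" "d ^ n > 0" using d by (auto simp: p_def)
  have log: "log 2 (real (d ^ n)) = real_of_int (l2 - l1 - k2 + k1) * log 2 d"
    using d l by (simp add: log_nat_power n_def)
  have st: "matrix_state q (\<lambda>Y. \<omega> (loc d l1 l2 Y))"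
    unfolding q_def by (rule matrix_state_loc[OF w l12])
  have wcong: "\<omega> a = \<omega> b" if "qelem d a" "qelem d b" "qeq a b" for a b
    using w that unfolding qstate_def by blast
  have eK: "qelem d (loc d k1 k2 X)" if "X \<in> carrier_mat p p" for X
    using that unfolding p_def by (rule qelem_loc[OF k])
  have eL: "qelem d (loc d l1 l2 X)" if "X \<in> carrier_mat q q" for X
    using that unfolding q_def by (rule qelem_loc[OF l12])
  obtain \<phi> where c: "\<And>X. X \<in> carrier_mat p p \<Longrightarrow> \<phi> X \<in> carrier_mat q q"
    and e: "\<And>X. X \<in> carrier_mat p p \<Longrightarrow> qeq (T (loc d k1 k2 X)) (loc d l1 l2 (\<phi> X))"
    and hom: "\<And>X Y. X \<in> carrier_mat p p \<Longrightarrow> Y \<in> carrier_mat p p \<Longrightarrow> \<phi> (X + Y) = \<phi> X + \<phi> Y"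
    "\<And>c X. X \<in> carrier_mat p p \<Longrightarrow> \<phi> (c \<cdot>\<^sub>m X) = c \<cdot>\<^sub>m \<phi> X"
    "\<And>X Y. X \<in> carrier_mat p p \<Longrightarrow> Y \<in> carrier_mat p p \<Longrightarrow> \<phi> (X * Y) = \<phi> X * \<phi> Y"
    "\<And>X. X \<in> carrier_mat p p \<Longrightarrow> \<phi> (mat_adjoint X) = mat_adjoint (\<phi> X)"
    "\<phi> (1\<^sub>m p) = 1\<^sub>m q"
    unfolding p_def q_def by (rule local_hom_exists[OF d k l12 aut ml]) (rule that[unfolded p_def q_def])
  have 1: "\<bar>state_entropy p (\<lambda>X. \<omega> (loc d l1 l2 (\<phi> X))) - state_entropy q (\<lambda>Y. \<omega> (loc d l1 l2 Y))\<bar> \<le> log 2 (real (d ^ n))"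
    by (rule entropy_unital_hom[where \<phi> = \<phi>, OF st q pos c hom])
  \<comment> \<open>The inclusion of local algebras: identities on the \<open>k1 - l1\<close> sites
    added to the left and the \<open>l2 - k2\<close> sites added to the right.\<close>
  define \<iota> where "\<iota> = amp (d ^ nat (k1 - l1)) (d ^ nat (l2 - k2))"
  have dims: "d ^ nat (k1 - l1) * p * d ^ nat (l2 - k2) = q"
  proof -
    have "nat (k1 - l1) + isize k1 k2 + nat (l2 - k2) = isize l1 l2" using k l by (simp add: isize_def)
    then show ?thesis unfolding p_def q_def by (metis power_add)
  qed
  have ci: "\<iota> X \<in> carrier_mat q q" if "X \<in> carrier_mat p p" for X
    using amp_carrier[OF that, of "d ^ nat (k1 - l1)" "d ^ nat (l2 - k2)"] by (simp add: \<iota>_def dims)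
  have 2: "\<bar>state_entropy p (\<lambda>X. \<omega> (loc d l1 l2 (\<iota> X))) - state_entropy q (\<lambda>Y. \<omega> (loc d l1 l2 Y))\<bar> \<le> log 2 (real (d ^ n))"
    by (rule entropy_unital_hom[where \<phi> = \<iota>, OF st q pos ci])
      (auto simp: \<iota>_def amp_add amp_smult amp_mult amp_adjoint amp_one dims)
  have r1: "restr_entropy d (\<omega> \<circ> T) k1 k2 = state_entropy p (\<lambda>X. \<omega> (loc d l1 l2 (\<phi> X)))"
    unfolding restr_entropy_def p_def[symmetric]
  proof (rule state_entropy_cong)
    fix X :: "complex mat" assume X: "X \<in> carrier_mat p p"
    have "qelem d (T (loc d k1 k2 X))" using aut eK[OF X] unfolding qautomorphism_def by blast
    then show "(\<omega> \<circ> T) (loc d k1 k2 X) = \<omega> (loc d l1 l2 (\<phi> X))"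
      using wcong[OF _ eL[OF c[OF X]] e[OF X]] by simp
  qed
  have r2: "restr_entropy d \<omega> k1 k2 = state_entropy p (\<lambda>X. \<omega> (loc d l1 l2 (\<iota> X)))"
    unfolding restr_entropy_def p_def[symmetric]
  proof (rule state_entropy_cong)
    fix X :: "complex mat" assume X: "X \<in> carrier_mat p p"
    have "qeq (loc d k1 k2 X) (loc d l1 l2 (\<iota> X))"
      unfolding \<iota>_def using l X by (intro loc_extend_qeq) (auto simp: p_def)
    then show "\<omega> (loc d k1 k2 X) = \<omega> (loc d l1 l2 (\<iota> X))"
      by (rule wcong[OF eK[OF X] eL[OF ci[OF X]]])
  qed
  \<comment> \<open>Triangle inequality through the entropy on \<open>[l1, l2]\<close>.\<close>
  show ?thesis using 1 2 unfolding r1 r2 log by linarith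
qed

section \<open>States as limits; two entropies\<close>

lemma isize_sym: "isize (-1) 0 = 2" "isize (-1) 1 = 3"
  by (simp_all add: isize_def)

text \<open>Amplification does not increase the norm, so the Cauchy condition with tolerance 1
  bounds all levels beyond \<open>N0\<close> by \<open>1 + opnorm (a N0)\<close>; a tail is all that
  is used below.\<close>

lemma qelem_bounded:
  assumes "qelem d a"
  obtains N0 B where "\<And>N. N0 \<le> N \<Longrightarrow> opnorm (a N) \<le> B"
proof -
  have "(1 :: real) > 0" by simp
  with assms obtain N0 where N0: "\<And>N M. N0 \<le> N \<Longrightarrow> N \<le> M \<Longrightarrow> opnorm (emb d N M (a N) - a M) < 1"
    unfolding qelem_def by metis
  note c = lvl_seqD[OF qelem_lvl_seq[OF assms]]
  have "opnorm (a M) \<le> 1 + opnorm (a N0)" if "N0 \<le> M" for M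
  proof -
    have e: "emb d N0 M (a N0) \<in> carrier_mat (lvl_dim d M) (lvl_dim d M)" by (rule emb_carrier[OF c that])
    have "a M = (a M - emb d N0 M (a N0)) + emb d N0 M (a N0)" using c[of M] e by (intro eq_matI) auto
    then have "opnorm (a M) \<le> opnorm (a M - emb d N0 M (a N0)) + opnorm (emb d N0 M (a N0))"
      using opnorm_add[OF minus_carrier_mat[OF e, of "a M"] e] by simp
    also have "opnorm (a M - emb d N0 M (a N0)) \<le> 1"
      unfolding opnorm_minus_commute[OF c e] using N0[of N0 M] that by simp
    also have "opnorm (emb d N0 M (a N0)) \<le> opnorm (a N0)" unfolding emb_amp by (rule opnorm_amp_le[OF c])
    finally show ?thesis by simp
  qed
  then show ?thesis by (rule that)
qed

text \<open>Positivity of a limit state is read off level by level from this sequence; the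
  convergence of those values needs it to be Cauchy.\<close>

lemma qelem_star_mult:
  assumes a: "qelem d a"
  shows "qelem d (qmult (qstar a) a)"
  unfolding qelem_def
proof (intro conjI allI impI)
  note s = qelem_lvl_seq[OF a]
  note c = lvl_seqD[OF s]
  show "qmult (qstar a) a N \<in> carrier_mat (lvl_dim d N) (lvl_dim d N)" for N
    by (intro lvl_seqD lvl_seq_ops s)
  fix \<epsilon> :: real assume e: "0 < \<epsilon>"
  obtain N0 B where B: "\<And>N. N0 \<le> N \<Longrightarrow> opnorm (a N) \<le> B" by (rule qelem_bounded[OF a], rule that)
  have B0: "0 \<le> B" using B[of N0] opnorm_nonneg[of "a N0"] by linarith
  \<comment> \<open>Chosen so that \<open>\<delta> * (1 + B) + B * \<delta> < \<epsilon>\<close>;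
    the cap 1 bounds the extra \<open>opnorm (E - a M)\<close> in the product estimate.\<close>
  define \<delta> where "\<delta> = min 1 (\<epsilon> / (2 * B + 2))"
  have d0: "\<delta> > 0" "\<delta> \<le> 1" using e B0 by (auto simp: \<delta>_def)
  have "\<delta> \<le> \<epsilon> / (2 * B + 2)" by (simp add: \<delta>_def)
  then have "\<delta> * (2 * B + 2) \<le> \<epsilon>" using B0 by (simp add: pos_le_divide_eq)
  then have d1: "\<delta> * (2 * B + 1) < \<epsilon>" using d0 by (simp add: distrib_left)
  from a d0 obtain N1 where N1: "\<And>N M. N1 \<le> N \<Longrightarrow> N \<le> M \<Longrightarrow> opnorm (emb d N M (a N) - a M) < \<delta>"
    unfolding qelem_def by metis
  show "\<exists>N0. \<forall>N M. N0 \<le> N \<and> N \<le> M \<longrightarrow> opnorm (emb d N M (qmult (qstar a) a N) - qmult (qstar a) a M) < \<epsilon>"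
  proof (intro exI[of _ "max N0 N1"] allI impI)
    fix N M assume h: "max N0 N1 \<le> N \<and> N \<le> M"
    define E where "E = emb d N M (a N)"
    have E: "E \<in> carrier_mat (lvl_dim d M) (lvl_dim d M)" unfolding E_def using h by (intro emb_carrier c) auto
    have eq: "emb d N M (mat_adjoint (a N) * a N) = mat_adjoint E * E"
      unfolding E_def emb_amp using c[of N] by (simp add: amp_mult amp_adjoint)
    have x: "opnorm (E - a M) \<le> \<delta>" unfolding E_def using N1[of N M] h by simp
    have "mat_adjoint E - mat_adjoint (a M) = mat_adjoint (E - a M)" using E c[of M] by (intro eq_matI) auto
    then have y: "opnorm (mat_adjoint E - mat_adjoint (a M)) \<le> \<delta>"
      using opnorm_adjoint_le[OF minus_carrier_mat[OF c, of E M]] x by simp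
    have b: "opnorm (a M) \<le> B" "opnorm (mat_adjoint (a M)) \<le> B"
      using B[of M] h opnorm_adjoint_le[OF c, of M] by auto
    have "opnorm (mat_adjoint E * E - mat_adjoint (a M) * a M)
       \<le> opnorm (mat_adjoint E - mat_adjoint (a M)) * (opnorm (E - a M) + opnorm (a M))
        + opnorm (mat_adjoint (a M)) * opnorm (E - a M)"
      using E c[of M] by (intro opnorm_mult_diff) auto
    also have "\<dots> \<le> \<delta> * (1 + B) + B * \<delta>"
      using x y b d0 B0 by (intro add_mono mult_mono) auto
    also have "\<dots> < \<epsilon>" using d1 by (simp add: algebra_simps)
    finally show "opnorm (emb d N M (qmult (qstar a) a N) - qmult (qstar a) a M) < \<epsilon>"
      by (simp add: qmult_def qstar_def eq)
  qed
qed

text \<open>A consistent family of functionals with a common norm bound extends to the completion by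
  continuity. Consistency and normalisation start at \<open>N1\<close>, since low levels may not
  contain the sites on which the state is prescribed.\<close>

lemma qstate_limI:
  fixes F :: "nat \<Rightarrow> complex mat \<Rightarrow> complex"
  assumes add: "\<And>N A B. A \<in> carrier_mat (lvl_dim d N) (lvl_dim d N) \<Longrightarrow> B \<in> carrier_mat (lvl_dim d N) (lvl_dim d N) \<Longrightarrow>
      F N (A + B) = F N A + F N B"
    and smult: "\<And>N c A. A \<in> carrier_mat (lvl_dim d N) (lvl_dim d N) \<Longrightarrow> F N (c \<cdot>\<^sub>m A) = c * F N A"
    and bound: "\<And>N A. A \<in> carrier_mat (lvl_dim d N) (lvl_dim d N) \<Longrightarrow> cmod (F N A) \<le> C * opnorm A"
    and compat: "\<And>N M A. N1 \<le> N \<Longrightarrow> N \<le> M \<Longrightarrow> A \<in> carrier_mat (lvl_dim d N) (lvl_dim d N) \<Longrightarrow>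
      F M (emb d N M A) = F N A"
    and pos: "\<And>N A. A \<in> carrier_mat (lvl_dim d N) (lvl_dim d N) \<Longrightarrow>
      Im (F N (mat_adjoint A * A)) = 0 \<and> 0 \<le> Re (F N (mat_adjoint A * A))"
    and one: "\<And>N. N1 \<le> N \<Longrightarrow> F N (1\<^sub>m (lvl_dim d N)) = 1"
  shows "qstate d (\<lambda>a. lim (\<lambda>N. F N (a N)))"
proof -
  have diff: "F N (A - B) = F N A - F N B"
    if "A \<in> carrier_mat (lvl_dim d N) (lvl_dim d N)" "B \<in> carrier_mat (lvl_dim d N) (lvl_dim d N)" for N A B
  proof -
    have "A - B = A + (- 1) \<cdot>\<^sub>m B" using that by (intro eq_matI) auto
    then show ?thesis using that by (simp add: add smult)
  qed
  have conv: "convergent (\<lambda>N. F N (a N))" if a: "qelem d a" for a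
  proof (rule Cauchy_convergent, rule CauchyI')
    note c = lvl_seqD[OF qelem_lvl_seq[OF a]]
    fix \<epsilon> :: real assume e: "0 < \<epsilon>"
    \<comment> \<open>The added 1 keeps the denominator positive even for
      \<open>C = 0\<close>.\<close>
    define \<delta> where "\<delta> = \<epsilon> / (\<bar>C\<bar> + 1)"
    have "\<delta> > 0" using e by (simp add: \<delta>_def)
    with a obtain N0 where N0: "\<And>N M. N0 \<le> N \<Longrightarrow> N \<le> M \<Longrightarrow> opnorm (emb d N M (a N) - a M) < \<delta>"
      unfolding qelem_def by metis
    show "\<exists>M. \<forall>m\<ge>M. \<forall>n>m. dist (F m (a m)) (F n (a n)) < \<epsilon>"
    proof (intro exI[of _ "max N0 N1"] allI impI)
      fix m n assume mn: "max N0 N1 \<le> m" "m < n"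
      have E: "emb d m n (a m) \<in> carrier_mat (lvl_dim d n) (lvl_dim d n)" using mn by (intro emb_carrier c) auto
      have "F m (a m) = F n (emb d m n (a m))" using mn by (intro compat[symmetric] c) auto
      then have "dist (F m (a m)) (F n (a n)) = cmod (F n (emb d m n (a m) - a n))"
        using E c[of n] by (simp add: diff dist_norm)
      also have "\<dots> \<le> C * opnorm (emb d m n (a m) - a n)" by (intro bound minus_carrier_mat c)
      also have "\<dots> \<le> \<bar>C\<bar> * opnorm (emb d m n (a m) - a n)" by (intro mult_right_mono) auto
      also have "\<dots> \<le> \<bar>C\<bar> * \<delta>" using N0[of m n] mn by (intro mult_left_mono) auto
      also have "\<dots> < \<epsilon>" using e by (simp add: \<delta>_def field_simps)
      finally show "dist (F m (a m)) (F n (a n)) < \<epsilon>" .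
    qed
  qed
  then have L: "(\<lambda>N. F N (a N)) \<longlonglongrightarrow> lim (\<lambda>N. F N (a N))" if "qelem d a" for a
    using that convergent_LIMSEQ_iff by blast
  show ?thesis
    unfolding qstate_def
  proof (intro conjI allI impI)
    fix a b assume h: "qelem d a \<and> qelem d b \<and> qeq a b"
    note c = lvl_seqD[OF qelem_lvl_seq[OF conjunct1[OF h]]] lvl_seqD[OF qelem_lvl_seq[OF conjunct1[OF conjunct2[OF h]]]]
    have "(\<lambda>N. F N (a N) - F N (b N)) \<longlonglongrightarrow> 0"
    proof (rule tendsto_0_le[of "\<lambda>N. opnorm (a N - b N)" _ _ C])
      show "\<forall>\<^sub>F N in sequentially. cmod (F N (a N) - F N (b N)) \<le> norm (opnorm (a N - b N)) * C"
        using bound[OF minus_carrier_mat[OF c(2)]] by (simp add: diff[OF c, symmetric] mult.commute)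
      show "(\<lambda>N. opnorm (a N - b N)) \<longlonglongrightarrow> 0" using h by (simp add: qeq_def)
    qed
    moreover have "(\<lambda>N. F N (a N) - F N (b N)) \<longlonglongrightarrow> lim (\<lambda>N. F N (a N)) - lim (\<lambda>N. F N (b N))"
      using h by (intro tendsto_diff L) auto
    ultimately show "lim (\<lambda>N. F N (a N)) = lim (\<lambda>N. F N (b N))"
      using LIMSEQ_unique by fastforce
  next
    fix a b assume h: "qelem d a \<and> qelem d b"
    note c = lvl_seqD[OF qelem_lvl_seq[OF conjunct1[OF h]]] lvl_seqD[OF qelem_lvl_seq[OF conjunct2[OF h]]]
    have "(\<lambda>N. F N (a N) + F N (b N)) \<longlonglongrightarrow> lim (\<lambda>N. F N (a N)) + lim (\<lambda>N. F N (b N))"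
      using h by (intro tendsto_add L) auto
    then show "lim (\<lambda>N. F N (qadd a b N)) = lim (\<lambda>N. F N (a N)) + lim (\<lambda>N. F N (b N))"
      by (intro limI) (simp add: qadd_def add c)
  next
    fix z a assume h: "qelem d a"
    note c = lvl_seqD[OF qelem_lvl_seq[OF h]]
    have "(\<lambda>N. z * F N (a N)) \<longlonglongrightarrow> z * lim (\<lambda>N. F N (a N))"
      by (intro tendsto_mult_left L h)
    then show "lim (\<lambda>N. F N (qscale z a N)) = z * lim (\<lambda>N. F N (a N))"
      by (intro limI) (simp add: qscale_def smult c)
  next
    fix a assume h: "qelem d a"
    note c = lvl_seqD[OF qelem_lvl_seq[OF h]]
    note l = L[OF qelem_star_mult[OF h]]
    have p: "Im (F N (qmult (qstar a) a N)) = 0" "0 \<le> Re (F N (qmult (qstar a) a N))" for N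
      using pos[OF c] by (auto simp: qmult_def qstar_def)
    show "Im (lim (\<lambda>N. F N (qmult (qstar a) a N))) = 0"
      using tendsto_Im[OF l] by (simp add: p LIMSEQ_const_iff)
    show "0 \<le> Re (lim (\<lambda>N. F N (qmult (qstar a) a N)))"
      by (rule LIMSEQ_le_const[OF tendsto_Re[OF l]]) (auto simp: p)
  next
    show "lim (\<lambda>N. F N (qone d N)) = 1"
      by (intro limI tendsto_eventually eventually_sequentiallyI[of N1]) (simp add: one qone_def)
  qed
qed

lemma state_entropy_tracial:
  assumes n: "n > 0" and f: "\<And>X. X \<in> carrier_mat n n \<Longrightarrow> f X = mtrace X / of_nat n"
  shows "state_entropy n f = log 2 n"
proof -
  define \<rho> where "\<rho> = mat n n (\<lambda>(i, j). if i = j then complex_of_real (1 / n) else 0)"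
  have r: "\<rho> \<in> carrier_mat n n" by (simp add: \<rho>_def)
  have "f X = mtrace (\<rho> * X)" if X: "X \<in> carrier_mat n n" for X
  proof -
    have "mtrace (\<rho> * X) = (\<Sum>i<n. \<Sum>l<n. if l = i then X $$ (i, i) / of_nat n else 0)"
      unfolding mtrace_mult[OF r X] by (intro sum.cong refl) (auto simp: \<rho>_def)
    then show ?thesis using X by (simp add: f mtrace_def sum_divide_distrib)
  qed
  then have den: "density n f = \<rho>" by (rule density_eqI[OF r])
  have "char_poly \<rho> = (\<Prod>a\<leftarrow>diag_mat \<rho>. [:- a, 1:])"
    by (rule char_poly_upper_triangular[OF r]) (auto simp: \<rho>_def)
  also have "diag_mat \<rho> = map (\<lambda>i. complex_of_real (1 / n)) [0..<n]"
    by (auto simp: diag_mat_def \<rho>_def)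
  finally have "char_poly \<rho> = (\<Prod>i<n. [:- complex_of_real (1 / n), 1:])"
    by (simp add: prod_list_map_upt[symmetric] o_def del: prod_constant)
  from vN_entropy_char_poly[OF this] show ?thesis
    using n by (simp add: state_entropy_def den eta_eq log_divide)
qed

text \<open>Idempotence forces every root of the characteristic polynomial to be 0 or 1, and
  \<open>eta\<close> vanishes at both. This gives the entropy of a pure state.\<close>

lemma vN_entropy_projection:
  assumes r: "\<rho> \<in> carrier_mat n n" and idem: "\<rho> * \<rho> = \<rho>"
  shows "vN_entropy \<rho> = 0"
proof -
  have "eta (Re z) = 0" if z: "poly (char_poly \<rho>) z = 0" for z
  proof -
    from z obtain v where v: "v \<in> carrier_vec n" "v \<noteq> 0\<^sub>v n" "\<rho> *\<^sub>v v = z \<cdot>\<^sub>v v"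
      using r by (auto simp: eigenvalue_root_char_poly[OF r, symmetric] eigenvalue_def eigenvector_def)
    have "\<rho> *\<^sub>v (\<rho> *\<^sub>v v) = \<rho> *\<^sub>v v" by (metis assoc_mult_mat_vec[OF r r v(1)] idem)
    then have "z \<cdot>\<^sub>v v = \<rho> *\<^sub>v (\<rho> *\<^sub>v v)" using v(3) by simp
    also have "\<dots> = z \<cdot>\<^sub>v (z \<cdot>\<^sub>v v)" using v r by (simp add: mult_mat_vec[of _ n n])
    finally have e: "z \<cdot>\<^sub>v v = z \<cdot>\<^sub>v (z \<cdot>\<^sub>v v)" .
    obtain i where i: "i < n" "v $ i \<noteq> 0" using v by (metis eq_vecI carrier_vecD index_zero_vec)
    have "z * v $ i = z * (z * v $ i)" using arg_cong[OF e, of "\<lambda>w. w $ i"] i v by simp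
    then have "z = 0 \<or> z = 1" using i by auto
    then show ?thesis by (auto simp: eta_def)
  qed
  then show ?thesis by (simp add: vN_entropy_def)
qed

section \<open>The automorphism exchanging two sites\<close>

text \<open>Conjugation by the permutation matrix of \<open>\<pi>\<close>, when \<open>\<pi>\<close>
  permutes the indices.\<close>

definition reindex :: "nat \<Rightarrow> (nat \<Rightarrow> nat) \<Rightarrow> complex mat \<Rightarrow> complex mat" where
  "reindex n \<pi> X = mat n n (\<lambda>(x, y). X $$ (\<pi> x, \<pi> y))"

text \<open>Involutions suffice because the automorphism to be built is its own inverse; one map
  then serves both directions of every change of summation index.\<close>

locale index_involution =
  fixes n :: nat and \<pi> :: "nat \<Rightarrow> nat"
  assumes less: "x < n \<Longrightarrow> \<pi> x < n" and invol: "x < n \<Longrightarrow> \<pi> (\<pi> x) = x"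
begin

lemma reindex_carrier [simp]: "reindex n \<pi> X \<in> carrier_mat n n"
  by (simp add: reindex_def)

lemma sum_reindex: "(\<Sum>x<n. f (\<pi> x)) = (\<Sum>x<n. f x)"
  by (rule sum.reindex_bij_witness[of _ \<pi> \<pi>]) (auto simp: less invol)

lemma reindex_reindex: "X \<in> carrier_mat n n \<Longrightarrow> reindex n \<pi> (reindex n \<pi> X) = X"
  by (rule eq_matI) (auto simp: reindex_def less invol)

lemma reindex_add: "X \<in> carrier_mat n n \<Longrightarrow> Y \<in> carrier_mat n n \<Longrightarrow> reindex n \<pi> (X + Y) = reindex n \<pi> X + reindex n \<pi> Y"
  by (rule eq_matI) (auto simp: reindex_def less)

lemma reindex_diff: "X \<in> carrier_mat n n \<Longrightarrow> Y \<in> carrier_mat n n \<Longrightarrow> reindex n \<pi> (X - Y) = reindex n \<pi> X - reindex n \<pi> Y"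
  by (rule eq_matI) (auto simp: reindex_def less)

lemma reindex_smult: "X \<in> carrier_mat n n \<Longrightarrow> reindex n \<pi> (c \<cdot>\<^sub>m X) = c \<cdot>\<^sub>m reindex n \<pi> X"
  by (rule eq_matI) (auto simp: reindex_def less)

lemma reindex_adjoint: "X \<in> carrier_mat n n \<Longrightarrow> reindex n \<pi> (mat_adjoint X) = mat_adjoint (reindex n \<pi> X)"
  by (rule eq_matI) (auto simp: reindex_def less)

lemma reindex_one: "reindex n \<pi> (1\<^sub>m n) = 1\<^sub>m n"
  by (rule eq_matI) (auto simp: reindex_def less dest: arg_cong[of _ _ \<pi>] simp: invol)

lemma reindex_mult:
  assumes X: "X \<in> carrier_mat n n" and Y: "Y \<in> carrier_mat n n"
  shows "reindex n \<pi> (X * Y) = reindex n \<pi> X * reindex n \<pi> Y"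
proof (rule eq_matI)
  fix i j assume "i < dim_row (reindex n \<pi> X * reindex n \<pi> Y)" "j < dim_col (reindex n \<pi> X * reindex n \<pi> Y)"
  then have ij: "i < n" "j < n" by (auto simp: reindex_def)
  have "(reindex n \<pi> X * reindex n \<pi> Y) $$ (i, j) = (\<Sum>l<n. X $$ (\<pi> i, \<pi> l) * Y $$ (\<pi> l, \<pi> j))"
    unfolding mult_mat_index[OF reindex_carrier reindex_carrier ij]
    using ij by (intro sum.cong) (auto simp: reindex_def)
  also have "\<dots> = (X * Y) $$ (\<pi> i, \<pi> j)"
    unfolding mult_mat_index[OF X Y less[OF ij(1)] less[OF ij(2)]]
    by (rule sum_reindex)
  finally show "reindex n \<pi> (X * Y) $$ (i, j) = (reindex n \<pi> X * reindex n \<pi> Y) $$ (i, j)"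
    using ij by (simp add: reindex_def)
qed (auto simp: reindex_def)

text \<open>The permuted vector \<open>w\<close> has the norm of \<open>v\<close>, and the image of
  \<open>v\<close> is the permuted image of \<open>w\<close>.\<close>

lemma opnorm_reindex_le:
  assumes X: "X \<in> carrier_mat n n"
  shows "opnorm (reindex n \<pi> X) \<le> opnorm X"
proof (rule opnorm_le[OF reindex_carrier])
  fix v :: "complex vec" assume v: "v \<in> carrier_vec n"
  define w where "w = vec n (\<lambda>i. v $ \<pi> i)"
  have w: "w \<in> carrier_vec n" by (simp add: w_def)
  have "(reindex n \<pi> X *\<^sub>v v) $ i = (X *\<^sub>v w) $ \<pi> i" if i: "i < n" for i
  proof -
    have "(X *\<^sub>v w) $ \<pi> i = (\<Sum>j<n. X $$ (\<pi> i, \<pi> j) * w $ \<pi> j)"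
      unfolding mult_mat_vec_index[OF X w less[OF i]] by (rule sum_reindex[symmetric])
    also have "\<dots> = (\<Sum>j<n. reindex n \<pi> X $$ (i, j) * v $ j)"
      using i by (intro sum.cong) (auto simp: w_def reindex_def less invol)
    finally show ?thesis unfolding mult_mat_vec_index[OF reindex_carrier v i] by simp
  qed
  then have "(\<Sum>i<n. (cmod ((reindex n \<pi> X *\<^sub>v v) $ i))\<^sup>2) = (\<Sum>i<n. (cmod ((X *\<^sub>v w) $ \<pi> i))\<^sup>2)"
    by (intro sum.cong) auto
  also have "\<dots> = (\<Sum>i<n. (cmod ((X *\<^sub>v w) $ i))\<^sup>2)" by (rule sum_reindex)
  finally have "cvnorm (reindex n \<pi> X *\<^sub>v v) = cvnorm (X *\<^sub>v w)"
    using X unfolding cvnorm_def dim_mult_mat_vec by (simp add: reindex_def del: index_mult_mat_vec)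
  also have "\<dots> \<le> opnorm X * cvnorm w" by (rule opnorm_bound[OF X w])
  also have "cvnorm w = cvnorm v"
    using v sum_reindex[of "\<lambda>i. (cmod (v $ i))\<^sup>2"] by (simp add: cvnorm_def w_def)
  finally show "cvnorm (reindex n \<pi> X *\<^sub>v v) \<le> opnorm X * cvnorm v" .
qed simp

lemma opnorm_reindex:
  assumes X: "X \<in> carrier_mat n n"
  shows "opnorm (reindex n \<pi> X) = opnorm X"
  using opnorm_reindex_le[OF X] opnorm_reindex_le[OF reindex_carrier[of X]] by (simp add: reindex_reindex[OF X])

end

text \<open>Three base-\<open>d\<close> digits with the outer two exchanged;
  \<open>t div d div d\<close> is the leading digit for \<open>t < d * d * d\<close>.\<close>

definition swap3 :: "nat \<Rightarrow> nat \<Rightarrow> nat" where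
  "swap3 d t = (t mod d * d + t div d mod d) * d + t div d div d"

lemma swap3_digits: "i < d \<Longrightarrow> j < d \<Longrightarrow> k < d \<Longrightarrow> swap3 d ((i * d + j) * d + k) = (k * d + j) * d + i"
  by (simp add: swap3_def)

lemma swap3_involution: "index_involution (d * d * d) (swap3 d)"
proof
  fix x assume x: "x < d * d * d"
  then show "swap3 d x < d * d * d" by (elim digits_exist) (simp add: swap3_digits digits_less)
  from x show "swap3 d (swap3 d x) = x" by (elim digits_exist) (simp add: swap3_digits)
qed

text \<open>At level \<open>N > 0\<close> the sites \<open>-1, 0, 1\<close> are the three base-\<open>d\<close> digits above the lowest \<open>N - 1\<close>;
  level 0 contains only the site \<open>0\<close>.\<close>

definition lvl_swap :: "nat \<Rightarrow> nat \<Rightarrow> nat \<Rightarrow> nat" where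
  "lvl_swap d N x = (if N = 0 then x else
     (let a = d ^ (N - 1) in (x div a div (d * d * d) * (d * d * d) + swap3 d (x div a mod (d * d * d))) * a + x mod a))"

lemma lvl_swap_digits:
  assumes "N > 0" "t < d * d * d" "r < d ^ (N - 1)"
  shows "lvl_swap d N ((i * (d * d * d) + t) * d ^ (N - 1) + r) = (i * (d * d * d) + swap3 d t) * d ^ (N - 1) + r"
proof -
  have dm: "(x * p + r) div p = x" "(x * p + r) mod p = r" if "r < p" for x p r :: nat
    using that by simp_all
  have "((i * (d * d * d) + t) * d ^ (N - 1) + r) div d ^ (N - 1) = i * (d * d * d) + t"
    by (rule dm[OF assms(3)])
  moreover have "(i * (d * d * d) + t) div (d * d * d) = i" "(i * (d * d * d) + t) mod (d * d * d) = t"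
    by (rule dm[OF assms(2)])+
  moreover have "((i * (d * d * d) + t) * d ^ (N - 1) + r) mod d ^ (N - 1) = r"
    by (rule dm[OF assms(3)])
  ultimately show ?thesis using assms(1) by (simp only: lvl_swap_def Let_def) simp
qed

lemma lvl_dim_pos: "N > 0 \<Longrightarrow> lvl_dim d N = d ^ (N - 1) * (d * d * d) * d ^ (N - 1)"
proof -
  assume "N > 0"
  then have "(N - 1) + 3 + (N - 1) = 2 * N + 1" by simp
  then have "d ^ (N - 1) * d ^ 3 * d ^ (N - 1) = lvl_dim d N" unfolding lvl_dim_def by (metis power_add)
  then show ?thesis by (simp add: power3_eq_cube)
qed

lemma lvl_swap_involution: "index_involution (lvl_dim d N) (lvl_swap d N)"
proof (cases "N = 0")
  case True
  then show ?thesis by unfold_locales (auto simp: lvl_swap_def)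
next
  case False
  interpret s: index_involution "d * d * d" "swap3 d" by (rule swap3_involution)
  show ?thesis
  proof
    fix x assume "x < lvl_dim d N"
    then have x: "x < d ^ (N - 1) * (d * d * d) * d ^ (N - 1)" using False by (simp only: lvl_dim_pos neq0_conv)
    from x obtain i t r where h: "i < d ^ (N - 1)" "t < d * d * d" "r < d ^ (N - 1)"
      "x = (i * (d * d * d) + t) * d ^ (N - 1) + r" by (rule digits_exist)
    have N: "N > 0" using False by simp
    show "lvl_swap d N x < lvl_dim d N"
      unfolding h(4) lvl_swap_digits[OF N h(2,3)] lvl_dim_pos[OF N] by (rule digits_less[OF h(1) s.less[OF h(2)] h(3)])
    show "lvl_swap d N (lvl_swap d N x) = x"
      unfolding h(4) lvl_swap_digits[OF N h(2,3)] lvl_swap_digits[OF N s.less[OF h(2)] h(3)] s.invol[OF h(2)] ..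
  qed
qed

section \<open>The swap as a map of the quasi-local algebra\<close>

definition site_swap :: "nat \<Rightarrow> (nat \<Rightarrow> complex mat) \<Rightarrow> nat \<Rightarrow> complex mat" where
  "site_swap d a N = reindex (lvl_dim d N) (lvl_swap d N) (a N)"

text \<open>Passing from \<open>N\<close> to \<open>M\<close> adds \<open>M - N\<close> digits at
  each end, so the three middle digits stay in the middle; \<open>e\<close> rebrackets the index to
  show it.\<close>

lemma lvl_swap_emb:
  assumes N: "0 < N" "N \<le> M" and h: "i < d ^ (M - N)" "t < lvl_dim d N" "r < d ^ (M - N)"
  shows "lvl_swap d M ((i * lvl_dim d N + t) * d ^ (M - N) + r) = (i * lvl_dim d N + lvl_swap d N t) * d ^ (M - N) + r"
proof -
  define a b c where "a = d ^ (N - 1)" and "b = d ^ (M - N)" and "c = d * d * d"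
  have ab: "d ^ (M - 1) = a * b" using N by (simp add: a_def b_def power_add[symmetric])
  have n: "lvl_dim d N = a * c * a" unfolding a_def c_def by (rule lvl_dim_pos[OF N(1)])
  from h(2) obtain i1 s r1 where t: "i1 < a" "s < c" "r1 < a" "t = (i1 * c + s) * a + r1"
    unfolding n by (rule digits_exist)
  have e: "(i * lvl_dim d N + ((i1 * c + s') * a + r1)) * b + r = ((i * a + i1) * c + s') * (a * b) + (r1 * b + r)" for s'
    unfolding n by (simp add: algebra_simps)
  have "r1 * b + r < a * b" using t h unfolding b_def by (intro digits2_less)
  moreover have "M > 0" using N by simp
  ultimately have "lvl_swap d M (((i * a + i1) * c + s) * (a * b) + (r1 * b + r)) = ((i * a + i1) * c + swap3 d s) * (a * b) + (r1 * b + r)"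
    using t(2) unfolding ab[symmetric] c_def by (intro lvl_swap_digits)
  moreover have "lvl_swap d N t = (i1 * c + swap3 d s) * a + r1"
    unfolding t(4) using t N unfolding a_def c_def by (intro lvl_swap_digits)
  ultimately show ?thesis unfolding b_def[symmetric] t(4) e by (simp add: e)
qed

text \<open>Compatibility with the embeddings is what makes the levelwise permutations one map that
  preserves Cauchy sequences.\<close>

lemma emb_reindex:
  assumes N: "0 < N" "N \<le> M" and X: "X \<in> carrier_mat (lvl_dim d N) (lvl_dim d N)"
  shows "emb d N M (reindex (lvl_dim d N) (lvl_swap d N) X) = reindex (lvl_dim d M) (lvl_swap d M) (emb d N M X)"
proof -
  interpret index_involution "lvl_dim d N" "lvl_swap d N" by (rule lvl_swap_involution)
  show ?thesis unfolding emb_amp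
  proof (rule amp_eqI[symmetric])
    show "reindex (lvl_dim d M) (lvl_swap d M) (amp (d ^ (M - N)) (d ^ (M - N)) X)
      \<in> carrier_mat (d ^ (M - N) * lvl_dim d N * d ^ (M - N)) (d ^ (M - N) * lvl_dim d N * d ^ (M - N))"
      unfolding emb_lvl_dim[OF N(2)] by (simp add: reindex_def)
    fix i t r i' t' r' :: nat
    assume h: "i < d ^ (M - N)" "t < lvl_dim d N" "r < d ^ (M - N)" "i' < d ^ (M - N)" "t' < lvl_dim d N" "r' < d ^ (M - N)"
    show "reindex (lvl_dim d M) (lvl_swap d M) (amp (d ^ (M - N)) (d ^ (M - N)) X) $$
        ((i * lvl_dim d N + t) * d ^ (M - N) + r, (i' * lvl_dim d N + t') * d ^ (M - N) + r')
      = (if i = i' \<and> r = r' then reindex (lvl_dim d N) (lvl_swap d N) X $$ (t, t') else 0)"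
      using digits_less[OF h(1-3)] digits_less[OF h(4-6)] unfolding emb_lvl_dim[OF N(2)]
      using h by (simp add: reindex_def[of "lvl_dim d M"] lvl_swap_emb[OF N] amp_index[OF X] less)
        (simp add: reindex_def)
  qed simp
qed

lemma site_swap_lvl_seq: "lvl_seq d (site_swap d a)"
  by (simp add: lvl_seq_def site_swap_def reindex_def)

lemma site_swap_site_swap:
  assumes "lvl_seq d a" shows "site_swap d (site_swap d a) = a"
proof
  fix N
  interpret index_involution "lvl_dim d N" "lvl_swap d N" by (rule lvl_swap_involution)
  show "site_swap d (site_swap d a) N = a N"
    unfolding site_swap_def by (rule reindex_reindex[OF lvl_seqD[OF assms]])
qed

lemma site_swap_ops:
  assumes a: "lvl_seq d a"
  shows "lvl_seq d b \<Longrightarrow> site_swap d (qadd a b) = qadd (site_swap d a) (site_swap d b)"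
    "lvl_seq d b \<Longrightarrow> site_swap d (qmult a b) = qmult (site_swap d a) (site_swap d b)"
    "site_swap d (qscale c a) = qscale c (site_swap d a)"
    "site_swap d (qstar a) = qstar (site_swap d a)"
    "site_swap d (qone d) = qone d"
proof -
  note i = lvl_swap_involution[of d]
  note op = qadd_def qmult_def qscale_def qstar_def qone_def
  show "site_swap d (qscale c a) = qscale c (site_swap d a)" "site_swap d (qstar a) = qstar (site_swap d a)"
    "site_swap d (qone d) = qone d"
    unfolding fun_eq_iff site_swap_def op
    by (auto intro!: index_involution.reindex_smult index_involution.reindex_adjoint index_involution.reindex_one i lvl_seqD[OF a])
  assume b: "lvl_seq d b"
  show "site_swap d (qadd a b) = qadd (site_swap d a) (site_swap d b)"
    "site_swap d (qmult a b) = qmult (site_swap d a) (site_swap d b)"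
    unfolding fun_eq_iff site_swap_def op
    by (auto intro!: index_involution.reindex_add index_involution.reindex_mult i lvl_seqD[OF a] lvl_seqD[OF b])
qed

text \<open>The swap is isometric at every level. The two directions of the equivalence give
  injectivity of the automorphism and its well-definedness on classes.\<close>

lemma qeq_site_swap:
  assumes a: "lvl_seq d a" and b: "lvl_seq d b"
  shows "qeq (site_swap d a) (site_swap d b) \<longleftrightarrow> qeq a b"
proof -
  have "opnorm (site_swap d a N - site_swap d b N) = opnorm (a N - b N)" for N
  proof -
    interpret index_involution "lvl_dim d N" "lvl_swap d N" by (rule lvl_swap_involution)
    show ?thesis
      unfolding site_swap_def reindex_diff[OF lvl_seqD[OF a] lvl_seqD[OF b], symmetric]
      by (rule opnorm_reindex[OF minus_carrier_mat[OF lvl_seqD[OF b]]])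
  qed
  then show ?thesis by (simp add: qeq_def)
qed

lemma qelem_site_swap:
  assumes a: "qelem d a"
  shows "qelem d (site_swap d a)"
  unfolding qelem_def
proof (intro conjI allI impI)
  note c = lvl_seqD[OF qelem_lvl_seq[OF a]]
  show "site_swap d a N \<in> carrier_mat (lvl_dim d N) (lvl_dim d N)" for N by (rule lvl_seqD[OF site_swap_lvl_seq])
  fix \<epsilon> :: real assume "0 < \<epsilon>"
  with a obtain N0 where N0: "\<And>N M. N0 \<le> N \<Longrightarrow> N \<le> M \<Longrightarrow> opnorm (emb d N M (a N) - a M) < \<epsilon>"
    unfolding qelem_def by metis
  show "\<exists>N0. \<forall>N M. N0 \<le> N \<and> N \<le> M \<longrightarrow> opnorm (emb d N M (site_swap d a N) - site_swap d a M) < \<epsilon>"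
  \<comment> \<open>The 1 excludes level 0, since \<open>emb_reindex\<close> starts at level
    1.\<close>
  proof (intro exI[of _ "max 1 N0"] allI impI)
    fix N M assume h: "max 1 N0 \<le> N \<and> N \<le> M"
    interpret index_involution "lvl_dim d M" "lvl_swap d M" by (rule lvl_swap_involution)
    have E: "emb d N M (a N) \<in> carrier_mat (lvl_dim d M) (lvl_dim d M)" using h by (intro emb_carrier c) auto
    have "emb d N M (site_swap d a N) = reindex (lvl_dim d M) (lvl_swap d M) (emb d N M (a N))"
      unfolding site_swap_def using h by (intro emb_reindex c) auto
    then have "emb d N M (site_swap d a N) - site_swap d a M = reindex (lvl_dim d M) (lvl_swap d M) (emb d N M (a N) - a M)"
      by (simp add: site_swap_def reindex_diff[OF E c])
    then show "opnorm (emb d N M (site_swap d a N) - site_swap d a M) < \<epsilon>"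
      using N0[of N M] h by (simp add: opnorm_reindex[OF minus_carrier_mat[OF c]])
  qed
qed

lemma qautomorphism_site_swap: "qautomorphism d (site_swap d)"
  unfolding qautomorphism_def
proof (intro conjI allI impI)
  fix b assume b: "qelem d b"
  show "\<exists>a. qelem d a \<and> qeq (site_swap d a) b"
    using qelem_site_swap[OF b] site_swap_site_swap[OF qelem_lvl_seq[OF b]] qeq_refl by metis
qed (auto simp: qelem_site_swap qeq_site_swap site_swap_ops qelem_lvl_seq qeq_refl)

text \<open>Supplies the state for the lower bound: the already swapped pair state, which a second
  swap takes back.\<close>

lemma qstate_site_swap:
  assumes "qstate d \<omega>"
  shows "qstate d (\<omega> \<circ> site_swap d)"
proof -
  have "site_swap d (qmult (qstar a) a) = qmult (qstar (site_swap d a)) (site_swap d a)" if "qelem d a" for a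
    using qelem_lvl_seq[OF that] by (simp add: site_swap_ops lvl_seq_ops)
  moreover have "site_swap d (qone d) = qone d" by (rule site_swap_ops(5)[OF lvl_seq_qone])
  ultimately show ?thesis
    using assms unfolding qstate_def
    by (auto simp: qelem_site_swap qeq_site_swap site_swap_ops qelem_lvl_seq)
qed

text \<open>Reduces the action on \<open>[-1, 1]\<close> to a finite computation with
  \<open>swap3\<close>, exact from level 1 on, the first level containing these sites.\<close>

lemma site_swap_loc:
  assumes d: "d > 0" and Y: "Y \<in> carrier_mat (d * d * d) (d * d * d)"
  shows "qeq (site_swap d (loc d (-1) 1 Y)) (loc d (-1) 1 (reindex (d * d * d) (swap3 d) Y))"
proof (rule qeq_eventually_eq[of 1])
  interpret s: index_involution "d * d * d" "swap3 d" by (rule swap3_involution)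
  fix N :: nat assume N: "1 \<le> N"
  define a where "a = d ^ (N - 1)"
  have l: "loc d (-1) 1 Z N = amp a a Z" for Z
    using N by (subst loc_amp) (auto simp: a_def nat_diff_distrib)
  have n: "lvl_dim d N = a * (d * d * d) * a" using N by (simp only: lvl_dim_pos a_def)
  have "reindex (lvl_dim d N) (lvl_swap d N) (amp a a Y) = amp a a (reindex (d * d * d) (swap3 d) Y)"
  proof (rule amp_eqI)
    fix i t r i' t' r' :: nat
    assume h: "i < a" "t < d * d * d" "r < a" "i' < a" "t' < d * d * d" "r' < a"
    have N': "N > 0" using N by simp
    note s = lvl_swap_digits[OF N' h(2) h(3)[unfolded a_def], folded a_def]
      lvl_swap_digits[OF N' h(5) h(6)[unfolded a_def], folded a_def]
    have "reindex (lvl_dim d N) (lvl_swap d N) (amp a a Y) $$ ((i * (d * d * d) + t) * a + r, (i' * (d * d * d) + t') * a + r')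
      = amp a a Y $$ ((i * (d * d * d) + swap3 d t) * a + r, (i' * (d * d * d) + swap3 d t') * a + r')"
      using digits_less[OF h(1-3)] digits_less[OF h(4-6)] by (simp only: reindex_def n index_mat s prod.case)
    also have "\<dots> = (if i = i' \<and> r = r' then Y $$ (swap3 d t, swap3 d t') else 0)"
      by (rule amp_index[OF Y h(1) s.less[OF h(2)] h(3,4) s.less[OF h(5)] h(6)])
    finally show "reindex (lvl_dim d N) (lvl_swap d N) (amp a a Y) $$ ((i * (d * d * d) + t) * a + r, (i' * (d * d * d) + t') * a + r')
      = (if i = i' \<and> r = r' then reindex (d * d * d) (swap3 d) Y $$ (t, t') else 0)"
      using h by (simp add: reindex_def)
  qed (simp_all add: reindex_def n)
  then show "site_swap d (loc d (-1) 1 Y) N = loc d (-1) 1 (reindex (d * d * d) (swap3 d) Y) N"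
    by (simp add: site_swap_def l)
qed

section \<open>Attaining the bounds\<close>

text \<open>\<open>pair_index d s i\<close> is the position of the basis vector \<open>|i,i,s\<rangle>\<close> of the sites \<open>-1, 0, 1\<close>.  In
  \<open>pair_functional\<close> all sites outside \<open>[-1,1]\<close> are in the state \<open>|0\<rangle>\<close>, so at level \<open>N\<close> this index only acquires
  \<open>N - 1\<close> trailing (and leading) zero digits.\<close>

definition pair_index :: "nat \<Rightarrow> nat \<Rightarrow> nat \<Rightarrow> nat" where
  "pair_index d s i = (i * d + i) * d + s"

lemma pair_index_less: "s < d \<Longrightarrow> i < d \<Longrightarrow> pair_index d s i < d * d * d"
  unfolding pair_index_def by (intro digits_less)

lemma pair_index_eq_iff: "s < d \<Longrightarrow> i < d \<Longrightarrow> j < d \<Longrightarrow> pair_index d s i = pair_index d s j \<longleftrightarrow> i = j"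
proof -
  assume h: "s < d" "i < d" "j < d"
  have "pair_index d s k mod d = s" "pair_index d s k div d = k * d + k" if "k < d" for k
    using h by (simp_all add: pair_index_def)
  moreover have "(k * d + k) div d = k" if "k < d" for k using that by simp
  ultimately show ?thesis using h by metis
qed

text \<open>The uniform mixture over \<open>s\<close> of the vector states of
  \<open>d^(-1/2)\<close> times the sum of \<open>|i,i,s>\<close> over \<open>i\<close>; normalising
  the vector and the mixture gives a factor \<open>1/d\<close> each. The value at level 0, which
  cannot hold three sites, does not affect the limit.\<close>

definition pair_functional :: "nat \<Rightarrow> nat \<Rightarrow> complex mat \<Rightarrow> complex" where
  "pair_functional d N A = (if N = 0 then 0 else
     (\<Sum>s<d. \<Sum>i<d. \<Sum>j<d. A $$ (pair_index d s i * d ^ (N - 1), pair_index d s j * d ^ (N - 1))) / of_nat (d * d))"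

definition pair_state :: "nat \<Rightarrow> (nat \<Rightarrow> complex mat) \<Rightarrow> complex" where
  "pair_state d a = lim (\<lambda>N. pair_functional d N (a N))"

lemma pair_index_lvl:
  assumes "N > 0" "d > 0" "s < d" "i < d"
  shows "pair_index d s i * d ^ (N - 1) < lvl_dim d N"
  using digits_less[of 0 "d ^ (N - 1)" "pair_index d s i" "d * d * d" 0 "d ^ (N - 1)"] pair_index_less[of s d i] assms
  by (simp add: lvl_dim_pos)

lemma qstate_pair_state:
  assumes d: "d > 0"
  shows "qstate d (pair_state d)"
  unfolding pair_state_def[abs_def]
\<comment> \<open>There are \<open>d^3\<close> entries, each of modulus at most
  \<open>opnorm A\<close>, divided by \<open>d^2\<close>: hence the constant
  \<open>d\<close>.\<close>
proof (rule qstate_limI[where ?N1.0 = 1 and C = "real d"])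
  fix N and A :: "complex mat" assume A: "A \<in> carrier_mat (lvl_dim d N) (lvl_dim d N)"
  note pl = pair_index_lvl[OF _ d] pair_index_lvl[OF _ d, simplified]
  show "pair_functional d N (A + B) = pair_functional d N A + pair_functional d N B"
    if B: "B \<in> carrier_mat (lvl_dim d N) (lvl_dim d N)" for B
    using A B by (auto simp: pair_functional_def pl sum.distrib add_divide_distrib)
  show "pair_functional d N (c \<cdot>\<^sub>m A) = c * pair_functional d N A" for c
    using A by (auto simp: pair_functional_def pl sum_distrib_left)
  show "cmod (pair_functional d N A) \<le> real d * opnorm A"
  proof (cases "N = 0")
    case True
    then show ?thesis by (simp add: pair_functional_def)
  next
    case False
    let ?e = "\<lambda>s i j. A $$ (pair_index d s i * d ^ (N - 1), pair_index d s j * d ^ (N - 1))"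
    have "cmod (\<Sum>s<d. \<Sum>i<d. \<Sum>j<d. ?e s i j) \<le> (\<Sum>s<d. \<Sum>i<d. \<Sum>j<d. cmod (?e s i j))"
      by (intro order.trans[OF norm_sum] sum_mono order.refl)
    also have "\<dots> \<le> (\<Sum>s<d. \<Sum>i<d. \<Sum>j<d. opnorm A)"
      using False by (intro sum_mono opnorm_index_le[OF A] pl) auto
    finally show ?thesis using False d by (simp add: pair_functional_def norm_divide norm_mult field_simps)
  qed
  show "pair_functional d M (emb d N M A) = pair_functional d N A" if N: "1 \<le> N" "N \<le> M" for M
  proof -
    have p: "d ^ (M - 1) = d ^ (N - 1) * d ^ (M - N)" using N by (simp add: power_add[symmetric])
    have "emb d N M A $$ (x * d ^ (M - 1), y * d ^ (M - 1)) = A $$ (x * d ^ (N - 1), y * d ^ (N - 1))"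
      if "x * d ^ (N - 1) < lvl_dim d N" "y * d ^ (N - 1) < lvl_dim d N" for x y
      using amp_index[OF A, of 0 "d ^ (M - N)" "x * d ^ (N - 1)" 0 "d ^ (M - N)" 0 "y * d ^ (N - 1)" 0] that d
      unfolding emb_amp p by (simp add: mult.assoc)
    then show ?thesis using N by (auto simp: pair_functional_def pl intro!: sum.cong arg_cong2[where f = "(/)"])
  qed
  show "Im (pair_functional d N (mat_adjoint A * A)) = 0 \<and> 0 \<le> Re (pair_functional d N (mat_adjoint A * A))"
  proof (cases "N = 0")
    case True
    then show ?thesis by (simp add: pair_functional_def)
  next
    case False
    let ?x = "\<lambda>s i. pair_index d s i * d ^ (N - 1)"
    have A': "mat_adjoint A \<in> carrier_mat (lvl_dim d N) (lvl_dim d N)" using A by simp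
    \<comment> \<open>For fixed \<open>s\<close> the double sum is the squared length of
      \<open>A\<close> applied to the sum over \<open>i\<close> of the basis vectors at
      \<open>?x s i\<close>.\<close>
    have "(\<Sum>i<d. \<Sum>j<d. (mat_adjoint A * A) $$ (?x s i, ?x s j))
       = of_real (\<Sum>k<lvl_dim d N. (cmod (\<Sum>i<d. A $$ (k, ?x s i)))\<^sup>2)" if s: "s < d" for s
    proof -
      have "(\<Sum>i<d. \<Sum>j<d. (mat_adjoint A * A) $$ (?x s i, ?x s j))
        = (\<Sum>i<d. \<Sum>j<d. \<Sum>k<lvl_dim d N. A $$ (k, ?x s j) * cnj (A $$ (k, ?x s i)))"
      proof (intro sum.cong refl)
        fix i j assume "i \<in> {..<d}" "j \<in> {..<d}"
        then have l: "?x s i < lvl_dim d N" "?x s j < lvl_dim d N" using False s by (auto intro!: pl)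
        show "(mat_adjoint A * A) $$ (?x s i, ?x s j) = (\<Sum>k<lvl_dim d N. A $$ (k, ?x s j) * cnj (A $$ (k, ?x s i)))"
          unfolding mult_mat_index[OF A' A l] using l A by (intro sum.cong) (auto simp: mult.commute)
      qed
      also have "\<dots> = (\<Sum>i<d. \<Sum>k<lvl_dim d N. \<Sum>j<d. A $$ (k, ?x s j) * cnj (A $$ (k, ?x s i)))"
        by (intro sum.cong refl sum.swap)
      also have "\<dots> = (\<Sum>k<lvl_dim d N. \<Sum>i<d. \<Sum>j<d. A $$ (k, ?x s j) * cnj (A $$ (k, ?x s i)))"
        by (rule sum.swap)
      also have "\<dots> = (\<Sum>k<lvl_dim d N. (\<Sum>j<d. A $$ (k, ?x s j)) * cnj (\<Sum>i<d. A $$ (k, ?x s i)))"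
        unfolding cnj_sum sum_product by (intro sum.cong refl sum.swap)
      finally show ?thesis unfolding of_real_sum complex_norm_square .
    qed
    then have "pair_functional d N (mat_adjoint A * A)
       = of_real ((\<Sum>s<d. \<Sum>k<lvl_dim d N. (cmod (\<Sum>i<d. A $$ (k, ?x s i)))\<^sup>2) / real (d * d))"
      using False by (simp add: pair_functional_def)
    then show ?thesis by (simp only: Re_complex_of_real Im_complex_of_real) (auto intro!: divide_nonneg_nonneg sum_nonneg)
  qed
next
  fix N :: nat assume N: "1 \<le> N"
  then have N': "N > 0" by simp
  have "(\<Sum>s<d. \<Sum>i<d. \<Sum>j<d. 1\<^sub>m (lvl_dim d N) $$ (pair_index d s i * d ^ (N - 1), pair_index d s j * d ^ (N - 1)))
     = (\<Sum>s<d. \<Sum>i<d. \<Sum>j<d. if j = i then 1 else (0::complex))"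
    using N' d by (intro sum.cong refl) (auto simp: pair_index_lvl[OF N' d, simplified] pair_index_eq_iff)
  then show "pair_functional d N (1\<^sub>m (lvl_dim d N)) = 1"
    using N d by (simp add: pair_functional_def)
qed

lemma pair_state_loc:
  assumes d: "d > 0" and Y: "Y \<in> carrier_mat (d * d * d) (d * d * d)"
  shows "pair_state d (loc d (-1) 1 Y)
    = (\<Sum>s<d. \<Sum>i<d. \<Sum>j<d. Y $$ (pair_index d s i, pair_index d s j)) / of_nat (d * d)"
  unfolding pair_state_def
proof (intro limI tendsto_eventually eventually_sequentiallyI[of 1])
  fix N :: nat assume N: "1 \<le> N"
  have "loc d (-1) 1 Y N = amp (d ^ (N - 1)) (d ^ (N - 1)) Y"
    using N by (subst loc_amp) (auto simp: nat_diff_distrib)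
  moreover have "amp (d ^ (N - 1)) (d ^ (N - 1)) Y $$ (x * d ^ (N - 1), y * d ^ (N - 1)) = Y $$ (x, y)"
    if "x < d * d * d" "y < d * d * d" for x y
    using amp_index[OF Y, of 0 "d ^ (N - 1)" x 0 "d ^ (N - 1)" 0 y 0] that d by simp
  ultimately show "pair_functional d N (loc d (-1) 1 Y N)
    = (\<Sum>s<d. \<Sum>i<d. \<Sum>j<d. Y $$ (pair_index d s i, pair_index d s j)) / of_nat (d * d)"
    using N by (simp add: pair_functional_def pair_index_less)
qed

text \<open>Enlarging \<open>[-1, 0]\<close> to \<open>[-1, 1]\<close> brings the element into an
  algebra that the swap preserves.\<close>

lemma site_swap_maps_local:
  assumes d: "d > 0"
  shows "maps_local d (site_swap d) (-1) 0 (-1) 1"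
  unfolding maps_local_def
proof (intro allI impI)
  fix a assume "in_local d (-1) 0 a"
  then obtain X where a: "qelem d a" and X: "X \<in> carrier_mat (d ^ isize (-1) 0) (d ^ isize (-1) 0)"
    and aX: "qeq a (loc d (-1) 0 X)" by (auto simp: in_local_def)
  define Y where "Y = amp (d ^ nat (- 1 - (- 1))) (d ^ nat (1 - 0)) X"
  have Y: "Y \<in> carrier_mat (d * d * d) (d * d * d)"
    using amp_carrier[OF X, of 1 d] by (simp add: Y_def isize_sym power2_eq_square)
  have XY: "qeq (loc d (-1) 0 X) (loc d (-1) 1 Y)" unfolding Y_def by (rule loc_extend_qeq[OF _ _ X]) auto
  have dim: "d ^ isize (-1) 1 = d * d * d" by (simp add: isize_sym power3_eq_cube)
  have sX: "lvl_seq d (loc d (-1) 0 X)" by (rule loc_lvl_seq[OF _ X]) simp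
  have sY: "lvl_seq d (loc d (-1) 1 Z)" if "Z \<in> carrier_mat (d * d * d) (d * d * d)" for Z
    using that by (intro loc_lvl_seq) (auto simp: dim)
  let ?Z = "reindex (d * d * d) (swap3 d) Y"
  have Z: "?Z \<in> carrier_mat (d * d * d) (d * d * d)" by (simp add: reindex_def)
  have "qeq a (loc d (-1) 1 Y)" by (rule qeq_trans[OF qelem_lvl_seq[OF a] sX sY[OF Y] aX XY])
  then have "qeq (site_swap d a) (site_swap d (loc d (-1) 1 Y))"
    using qeq_site_swap[OF qelem_lvl_seq[OF a] sY[OF Y]] by simp
  then have "qeq (site_swap d a) (loc d (-1) 1 ?Z)"
    by (rule qeq_trans[OF site_swap_lvl_seq site_swap_lvl_seq sY[OF Z] _ site_swap_loc[OF d Y]])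
  then show "in_local d (-1) 1 (site_swap d a)"
    unfolding in_local_def dim using qelem_site_swap[OF a] Z by blast
qed

text \<open>Brings the values on \<open>[-1, 0]\<close>, before and after the swap, into reach of
  the explicit three-site formula; the last identity serves the state that is swapped twice.\<close>

lemma pair_state_extend:
  assumes d: "d > 0" and X: "X \<in> carrier_mat (d * d) (d * d)"
  shows "pair_state d (loc d (-1) 0 X) = pair_state d (loc d (-1) 1 (amp 1 d X))"
    "pair_state d (site_swap d (loc d (-1) 0 X)) = pair_state d (loc d (-1) 1 (reindex (d * d * d) (swap3 d) (amp 1 d X)))"
    "site_swap d (site_swap d (loc d (-1) 0 X)) = loc d (-1) 0 X"
proof -
  have X': "X \<in> carrier_mat (d ^ isize (-1) 0) (d ^ isize (-1) 0)" using X by (simp add: isize_sym power2_eq_square)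
  have Y: "amp 1 d X \<in> carrier_mat (d * d * d) (d * d * d)" using amp_carrier[OF X, of 1 d] by simp
  have dim: "d ^ isize (-1) 1 = d * d * d" by (simp add: isize_sym power3_eq_cube)
  have XY: "qeq (loc d (-1) 0 X) (loc d (-1) 1 (amp 1 d X))"
    using loc_extend_qeq[OF _ _ X', of "-1" 1] by simp
  have eX: "qelem d (loc d (-1) 0 X)" by (rule qelem_loc[OF _ X']) simp
  have eY: "qelem d (loc d (-1) 1 Z)" if "Z \<in> carrier_mat (d * d * d) (d * d * d)" for Z
    using that by (intro qelem_loc) (auto simp: dim)
  let ?Z = "reindex (d * d * d) (swap3 d) (amp 1 d X)"
  have Z: "?Z \<in> carrier_mat (d * d * d) (d * d * d)" by (simp add: reindex_def)
  have cong: "pair_state d a = pair_state d b" if "qelem d a" "qelem d b" "qeq a b" for a b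
    using qstate_pair_state[OF d] that unfolding qstate_def by blast
  show "pair_state d (loc d (-1) 0 X) = pair_state d (loc d (-1) 1 (amp 1 d X))"
    by (rule cong[OF eX eY[OF Y] XY])
  have "qeq (site_swap d (loc d (-1) 0 X)) (site_swap d (loc d (-1) 1 (amp 1 d X)))"
    using qeq_site_swap[OF qelem_lvl_seq[OF eX] qelem_lvl_seq[OF eY[OF Y]]] XY by blast
  then have "qeq (site_swap d (loc d (-1) 0 X)) (loc d (-1) 1 ?Z)"
    by (rule qeq_trans[OF site_swap_lvl_seq site_swap_lvl_seq qelem_lvl_seq[OF eY[OF Z]] _ site_swap_loc[OF d Y]])
  then show "pair_state d (site_swap d (loc d (-1) 0 X)) = pair_state d (loc d (-1) 1 ?Z)"
    by (intro cong qelem_site_swap eX eY Z)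
  show "site_swap d (site_swap d (loc d (-1) 0 X)) = loc d (-1) 0 X"
    by (intro site_swap_site_swap qelem_lvl_seq eX)
qed

lemma restr_entropy_pair_state:
  assumes d: "d > 0"
  shows "restr_entropy d (pair_state d) (-1) 0 = 0"
proof -
  \<comment> \<open>The projection onto the maximally entangled vector, \<open>d^(-1/2)\<close>
    times the sum of \<open>|i,i>\<close>.\<close>
  define \<rho> where "\<rho> = mat (d * d) (d * d)
    (\<lambda>(x, y). if x div d = x mod d \<and> y div d = y mod d then 1 / complex_of_nat d else 0)"
  have r: "\<rho> \<in> carrier_mat (d * d) (d * d)" by (simp add: \<rho>_def)
  have ri: "\<rho> $$ (i * d + i', j * d + j') = (if i = i' \<and> j = j' then 1 / of_nat d else 0)"
    if "i < d" "i' < d" "j < d" "j' < d" for i i' j j'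
    using that by (simp add: \<rho>_def digits2_less)
  have idem: "\<rho> * \<rho> = \<rho>"
  proof (rule eq_matI)
    fix x y assume "x < dim_row \<rho>" "y < dim_col \<rho>"
    then have xy: "x < d * d" "y < d * d" by (auto simp: \<rho>_def)
    define i i' j j' where "i = x div d" "i' = x mod d" "j = y div d" "j' = y mod d"
    then have h: "i < d" "i' < d" "j < d" "j' < d" "x = i * d + i'" "y = j * d + j'"
      using xy d by (auto simp: less_mult_imp_div_less)
    have "(\<rho> * \<rho>) $$ (x, y) = (\<Sum>k<d. \<Sum>l<d. \<rho> $$ (x, k * d + l) * \<rho> $$ (k * d + l, y))"
      unfolding mult_mat_index[OF r r xy] by (rule sum_digits2)
    \<comment> \<open>The \<open>d\<close> surviving terms \<open>1/d * 1/d\<close> add up to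
      \<open>1/d\<close>.\<close>
    also have "\<dots> = (\<Sum>k<d. \<Sum>l<d. if l = k then (if i = i' \<and> j = j' then 1 / of_nat d * (1 / of_nat d) else 0) else 0)"
      unfolding h(5,6) using h(1-4) by (intro sum.cong refl) (auto simp: ri)
    also have "\<dots> = \<rho> $$ (x, y)" unfolding h(5,6) using h(1-4) d by (simp add: ri)
    finally show "(\<rho> * \<rho>) $$ (x, y) = \<rho> $$ (x, y)" .
  qed (auto simp: \<rho>_def)
  have "pair_state d (loc d (-1) 0 X) = mtrace (\<rho> * X)" if X: "X \<in> carrier_mat (d * d) (d * d)" for X
  proof -
    have Y: "amp 1 d X \<in> carrier_mat (d * d * d) (d * d * d)" using amp_carrier[OF X, of 1 d] by simp
    have "pair_state d (loc d (-1) 0 X)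
      = (\<Sum>s<d. \<Sum>i<d. \<Sum>j<d. amp 1 d X $$ (pair_index d s i, pair_index d s j)) / of_nat (d * d)"
      unfolding pair_state_extend(1)[OF d X] by (rule pair_state_loc[OF d Y])
    also have "(\<Sum>s<d. \<Sum>i<d. \<Sum>j<d. amp 1 d X $$ (pair_index d s i, pair_index d s j))
      = (\<Sum>s<d. \<Sum>i<d. \<Sum>j<d. X $$ (i * d + i, j * d + j))"
    proof (intro sum.cong refl)
      fix s i j assume "s \<in> {..<d}" "i \<in> {..<d}" "j \<in> {..<d}"
      then show "amp 1 d X $$ (pair_index d s i, pair_index d s j) = X $$ (i * d + i, j * d + j)"
        using amp_index[OF X, of 0 1 "i * d + i" s d 0 "j * d + j" s] by (simp add: pair_index_def digits2_less)
    qed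
    \<comment> \<open>The summand no longer depends on \<open>s\<close>, so that sum gives a factor
      \<open>d\<close> which cancels one in the denominator.\<close>
    also have "\<dots> / of_nat (d * d) = (\<Sum>j<d. \<Sum>i<d. X $$ (i * d + i, j * d + j)) / of_nat d"
      using d by (subst sum.swap) simp
    also have "\<dots> = (\<Sum>i<d. \<Sum>i'<d. if i' = i then \<Sum>j<d. X $$ (j * d + j, i * d + i) / of_nat d else 0)"
      by (simp add: sum_divide_distrib)
    also have "\<dots> = (\<Sum>i<d. \<Sum>i'<d. \<Sum>j<d. \<Sum>j'<d. \<rho> $$ (i * d + i', j * d + j') * X $$ (j * d + j', i * d + i'))"
    proof (intro sum.cong refl)
      fix i i' assume "i \<in> {..<d}" "i' \<in> {..<d}"
      then have "(\<Sum>j<d. \<Sum>j'<d. \<rho> $$ (i * d + i', j * d + j') * X $$ (j * d + j', i * d + i'))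
        = (\<Sum>j<d. \<Sum>j'<d. if j' = j then if i' = i then X $$ (j * d + j, i * d + i) / of_nat d else 0 else 0)"
        by (intro sum.cong refl) (auto simp: ri)
      then show "(if i' = i then \<Sum>j<d. X $$ (j * d + j, i * d + i) / of_nat d else 0)
        = (\<Sum>j<d. \<Sum>j'<d. \<rho> $$ (i * d + i', j * d + j') * X $$ (j * d + j', i * d + i'))"
        by simp
    qed
    also have "\<dots> = mtrace (\<rho> * X)"
      unfolding mtrace_mult[OF r X] sum_digits2 ..
    finally show ?thesis .
  qed
  then have "density (d * d) (\<lambda>X. pair_state d (loc d (-1) 0 X)) = \<rho>" by (rule density_eqI[OF r])
  then show ?thesis
    by (simp add: restr_entropy_def state_entropy_def isize_sym power2_eq_square vN_entropy_projection[OF r idem])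
qed

text \<open>The swap turns \<open>|i,i,s>\<close> into \<open>|s,i,i>\<close>. Restricting to the
  first two sites traces out the last digit, which forces \<open>i = j\<close> and leaves every
  diagonal entry of \<open>X\<close> with the same weight: the tracial state in dimension
  \<open>d^2\<close>.\<close>

lemma restr_entropy_pair_state_swap:
  assumes d: "d > 0"
  shows "restr_entropy d (pair_state d \<circ> site_swap d) (-1) 0 = 2 * log 2 d"
proof -
  have "pair_state d (site_swap d (loc d (-1) 0 X)) = mtrace X / of_nat (d * d)" if X: "X \<in> carrier_mat (d * d) (d * d)" for X
  proof -
    let ?Z = "reindex (d * d * d) (swap3 d) (amp 1 d X)"
    have Z: "?Z \<in> carrier_mat (d * d * d) (d * d * d)" by (simp add: reindex_def)
    have "pair_state d (site_swap d (loc d (-1) 0 X))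
      = (\<Sum>s<d. \<Sum>i<d. \<Sum>j<d. ?Z $$ (pair_index d s i, pair_index d s j)) / of_nat (d * d)"
      unfolding pair_state_extend(2)[OF d X] by (rule pair_state_loc[OF d Z])
    also have "(\<Sum>s<d. \<Sum>i<d. \<Sum>j<d. ?Z $$ (pair_index d s i, pair_index d s j))
      = (\<Sum>s<d. \<Sum>i<d. \<Sum>j<d. if j = i then X $$ (s * d + i, s * d + i) else 0)"
    proof (intro sum.cong refl)
      fix s i j assume "s \<in> {..<d}" "i \<in> {..<d}" "j \<in> {..<d}"
      then have h: "s < d" "i < d" "j < d" by auto
      have sw: "swap3 d (pair_index d s k) = (s * d + k) * d + k" if "k < d" for k
        unfolding pair_index_def using h that by (intro swap3_digits)
      show "?Z $$ (pair_index d s i, pair_index d s j) = (if j = i then X $$ (s * d + i, s * d + i) else 0)"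
        using h amp_index[OF X, of 0 1 "s * d + i" i d 0 "s * d + j" j]
        by (auto simp: reindex_def pair_index_less sw digits2_less)
    qed
    also have "\<dots> = (\<Sum>s<d. \<Sum>i<d. X $$ (s * d + i, s * d + i))" by simp
    also have "\<dots> = mtrace X" using X by (simp add: mtrace_def sum_digits2)
    finally show ?thesis .
  qed
  then have "state_entropy (d * d) (\<lambda>X. pair_state d (site_swap d (loc d (-1) 0 X))) = log 2 (real (d * d))"
    using d by (intro state_entropy_tracial) auto
  then show ?thesis using d by (simp add: restr_entropy_def isize_sym power2_eq_square log_mult)
qed

lemma restr_entropy_pair_state_swap_swap:
  assumes d: "d > 0"
  shows "restr_entropy d (pair_state d \<circ> site_swap d \<circ> site_swap d) (-1) 0 = 0"
proof -
  have "state_entropy (d * d) (\<lambda>X. (pair_state d \<circ> site_swap d \<circ> site_swap d) (loc d (-1) 0 X))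
      = state_entropy (d * d) (\<lambda>X. pair_state d (loc d (-1) 0 X))"
    by (rule state_entropy_cong) (simp add: pair_state_extend(3)[OF d])
  then show ?thesis
    using restr_entropy_pair_state[OF d] by (simp add: restr_entropy_def isize_sym power2_eq_square)
qed

text \<open>Demanding \<open>0 < l2 - l1 - k2 + k1\<close> keeps sharpness from being trivial: for
  \<open>n = 0\<close> both bounds already say that the entropies agree. The two witnesses share the
  intervals and the automorphism and differ in the state.\<close>

theorem mainTheorem12:
  fixes d :: nat
  assumes "d \<ge> 2"
  shows
   "(\<forall>k1 k2 l1 l2 T \<omega>.
       k1 \<le> k2 \<and> l1 \<le> k1 \<and> k2 \<le> l2 \<and> qautomorphism d T \<and> maps_local d T k1 k2 l1 l2 \<and> qstate d \<omega>
       \<longrightarrow> restr_entropy d \<omega> k1 k2 - 2 * real_of_int (l2 - l1 - k2 + k1) * log 2 d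
              \<le> restr_entropy d (\<omega> \<circ> T) k1 k2
         \<and> restr_entropy d (\<omega> \<circ> T) k1 k2
              \<le> restr_entropy d \<omega> k1 k2 + 2 * real_of_int (l2 - l1 - k2 + k1) * log 2 d)
    \<and> (\<exists>k1 k2 l1 l2 T \<omega>.
       k1 \<le> k2 \<and> l1 \<le> k1 \<and> k2 \<le> l2 \<and> 0 < l2 - l1 - k2 + k1 \<and>
       qautomorphism d T \<and> maps_local d T k1 k2 l1 l2 \<and> qstate d \<omega> \<and>
       restr_entropy d (\<omega> \<circ> T) k1 k2
         = restr_entropy d \<omega> k1 k2 + 2 * real_of_int (l2 - l1 - k2 + k1) * log 2 d)
    \<and> (\<exists>k1 k2 l1 l2 T \<omega>.
       k1 \<le> k2 \<and> l1 \<le> k1 \<and> k2 \<le> l2 \<and> 0 < l2 - l1 - k2 + k1 \<and>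
       qautomorphism d T \<and> maps_local d T k1 k2 l1 l2 \<and> qstate d \<omega> \<and>
       restr_entropy d (\<omega> \<circ> T) k1 k2
         = restr_entropy d \<omega> k1 k2 - 2 * real_of_int (l2 - l1 - k2 + k1) * log 2 d)"
proof (intro conjI)
  have d: "d > 0" using assms by simp
  show "\<forall>k1 k2 l1 l2 T \<omega>.
       k1 \<le> k2 \<and> l1 \<le> k1 \<and> k2 \<le> l2 \<and> qautomorphism d T \<and> maps_local d T k1 k2 l1 l2 \<and> qstate d \<omega>
       \<longrightarrow> restr_entropy d \<omega> k1 k2 - 2 * real_of_int (l2 - l1 - k2 + k1) * log 2 d
              \<le> restr_entropy d (\<omega> \<circ> T) k1 k2
         \<and> restr_entropy d (\<omega> \<circ> T) k1 k2
              \<le> restr_entropy d \<omega> k1 k2 + 2 * real_of_int (l2 - l1 - k2 + k1) * log 2 d"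
    using restr_entropy_diff_le[OF d] by (simp add: abs_le_iff) (smt (verit))
  note ex = qautomorphism_site_swap site_swap_maps_local[OF d] qstate_pair_state[OF d]
    qstate_site_swap[OF qstate_pair_state[OF d]]
  note ent = restr_entropy_pair_state[OF d] restr_entropy_pair_state_swap[OF d] restr_entropy_pair_state_swap_swap[OF d]
  show "\<exists>k1 k2 l1 l2 T \<omega>.
       k1 \<le> k2 \<and> l1 \<le> k1 \<and> k2 \<le> l2 \<and> 0 < l2 - l1 - k2 + k1 \<and>
       qautomorphism d T \<and> maps_local d T k1 k2 l1 l2 \<and> qstate d \<omega> \<and>
       restr_entropy d (\<omega> \<circ> T) k1 k2
         = restr_entropy d \<omega> k1 k2 + 2 * real_of_int (l2 - l1 - k2 + k1) * log 2 d"
    \<comment> \<open>Here \<open>n = 1 - (-1) - 0 + (-1) = 1\<close>, and the entropy rises by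
      \<open>2 * log 2 d\<close>, from 0 to the maximum possible on two sites.\<close>
    by (rule exI[of _ "-1"], rule exI[of _ 0], rule exI[of _ "-1"], rule exI[of _ 1],
        rule exI[of _ "site_swap d"], rule exI[of _ "pair_state d"]) (simp add: ex ent)
  show "\<exists>k1 k2 l1 l2 T \<omega>.
       k1 \<le> k2 \<and> l1 \<le> k1 \<and> k2 \<le> l2 \<and> 0 < l2 - l1 - k2 + k1 \<and>
       qautomorphism d T \<and> maps_local d T k1 k2 l1 l2 \<and> qstate d \<omega> \<and>
       restr_entropy d (\<omega> \<circ> T) k1 k2
         = restr_entropy d \<omega> k1 k2 - 2 * real_of_int (l2 - l1 - k2 + k1) * log 2 d"
    \<comment> \<open>The reverse process: the second swap lowers the entropy from
      \<open>2 * log 2 d\<close> to 0.\<close>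
    by (rule exI[of _ "-1"], rule exI[of _ 0], rule exI[of _ "-1"], rule exI[of _ 1],
        rule exI[of _ "site_swap d"], rule exI[of _ "pair_state d \<circ> site_swap d"]) (simp add: ex ent)
qed

end
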